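(* Let $\Gamma \subset \mathsf{Homeo}(M)$ be a non-elementary convergence group, let $\sigma \colon \Gamma \times M \rightarrow \mathbb{R}$ be an expanding coarse-cocycle, and let $\mu$ be a coarse $\sigma$-Patterson--Sullivan measure of dimension $\beta$. Then: (1) $\beta \geq \delta_\sigma(\Gamma)>0$. (2) If $y \in M$ is a conical limit point, then $\mu(\{y\}) = 0$. (3) If $\sum_{\gamma \in \Gamma} e^{-\beta \|\gamma\|_\sigma} < + \infty$ (e.g. if $\beta > \delta_\sigma(\Gamma)$), then $\mu(\Lambda^{\rm con}(\Gamma))= 0$. (4) There exists $C>0$ such that $\#\{\gamma\in\Gamma: \|\gamma\|_\sigma\leq R\} \leq Ce^{\delta_\sigma(\Gamma) R}$ for any $R>0$.
   Context: Convergence groups. $M$ is a compact metrizable space. A subgroup $\Gamma\subset\mathsf{Homeo}(M)$ is a (discrete) convergence group if for every sequence $\{\gamma_n\}$ of distinct elements of $\Gamma$ there are $x,y\in M$ and a subsequence $\{\gamma_{n_j}\}$ such that $\gamma_{n_j}|_{M\smallsetminus\{y\}}$ converges locally uniformly to the constant $x$. The limit set $\Lambda(\Gamma)$ is the set of $x\in M$ for which there are $y\in M$ and a sequence $\{\gamma_n\}\subset\Gamma$ with $\gamma_n|_{M\smallsetminus\{y\}}\to x$ locally uniformly. $\Gamma$ is non-elementary if $\#\Lambda(\Gamma)\ge 3$. A point $x\in\Lambda(\Gamma)$ is a conical limit point if there are distinct $a,b\in M$ and $\{\gamma_n\}\subset\Gamma$ with $\gamma_n(x)\to a$ and $\gamma_n(y)\to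 b$ for all $y\in M\smallsetminus\{x\}$; $\Lambda^{\rm con}(\Gamma)$ is the set of conical limit points. An element $\gamma$ is loxodromic if it has two fixed points $\gamma^+\ne\gamma^-$ in $\Lambda(\Gamma)$ such that $\gamma^{\pm n}|_{M\smallsetminus\{\gamma^{\mp}\}}$ converges locally uniformly to $\gamma^{\pm}$ as $n\to+\infty$. Compatible metrics. $\Gamma\sqcup M$ carries a unique compact metrizable topology for which the inclusions of $\Gamma$ (discrete) and of $M$ are embeddings and the natural action of $\Gamma$ (left multiplication on $\Gamma$) is a convergence group action. A compatible metric $\mathrm{d}$ is a metric on $\Gamma\sqcup M$ inducing this topology; fix one. Coarse-cocycles. For $\kappa\ge0$, $\sigma\colon\Gamma\times M\to\mathbb{R}$ is a $\kappa$-coarse-cocycle if (i) $\limsup_{x\to x_0}|\sigma(\gamma,x_0)-\sigma(\gamma,x)|\le\kappa$ for all $\gamma\in\Gamma$, $x_0\in M$, and (ii) $|\sigma(\gamma_1\gamma_2,x)-(\sigma(\gamma_1,\gamma_2x)+\sigma(\gamma_2,x))|\le\kappa$ for all $\gamma_1,\gamma_2\in\Gamma$, $x\in M$. A coarse-cocycle is a $\kappa$-coarse-cocycle for some $\kappa$. It is proper if $\sigma(\gamma_n,\gamma_n^+)\to+\infty$ whenever $\{\gamma_n\}\subset\Gamma$ is a sequence of distinct loxodromic elements with $\liminf_n\mathrm{d}(\gamma_n^-,\gamma_n^+)>0$. It is expanding if it is proper and for each $\gamma\in\Gamma$ there is a number $\|\gamma\|_\sigma\in\mathbb{R}$ (the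 $\sigma$-magnitude) such that for every $\epsilon>0$ there is $C>0$ with $\|\gamma\|_\sigma-C\le\sigma(\gamma,x)\le\|\gamma\|_\sigma+C$ whenever $x\in M$, $\gamma\in\Gamma$ and $\mathrm{d}(x,\gamma^{-1})>\epsilon$ (here $\gamma^{-1}$ is a point of $\Gamma\sqcup M$). The magnitude function is any fixed choice; two choices differ by a bounded amount. Critical exponent: $\delta_\sigma(\Gamma)=\inf\{s>0:\sum_{\gamma\in\Gamma}e^{-s\|\gamma\|_\sigma}<+\infty\}\in[0,+\infty]$. Patterson--Sullivan measures: a Borel probability measure $\mu$ on $M$ is a $C$-coarse $\sigma$-Patterson--Sullivan measure of dimension $\beta$ if for every $\gamma\in\Gamma$ the measures $\mu$ and $\gamma_*\mu$ are mutually absolutely continuous and $e^{-C-\beta\sigma(\gamma^{-1},\cdot)}\le\frac{d\gamma_*\mu}{d\mu}\le e^{C-\beta\sigma(\gamma^{-1},\cdot)}$ $\mu$-almost everywhere; it is coarse if this holds for some $C$. *)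

theory Defs
  imports "HOL-Algebra.Group" "HOL-Analysis.Analysis" "HOL-Probability.Probability_Measure"
begin

section \<open>Homeomorphism groups and locally uniform convergence\<close>

definition homeo_group :: "('m::topological_space \<Rightarrow> 'm) monoid" where
  "homeo_group =
     \<lparr>carrier = {f. \<exists>g. homeomorphism UNIV UNIV f g}, monoid.mult = (\<lambda>f g. f \<circ> g), one = id\<rparr>"

lemma homeo_inv_into:
  assumes "homeomorphism UNIV UNIV f g"
  shows "inv_into UNIV f = g"
  using assms by (metis UNIV_I homeomorphism_def inv_equality)

lemma group_homeo_group: "group (homeo_group :: ('m::topological_space \<Rightarrow> 'm) monoid)"
proof (rule groupI)
  fix f g :: "'m::topological_space \<Rightarrow> 'm"
  assume "f \<in> carrier homeo_group" "g \<in> carrier homeo_group"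
  then show "f \<otimes>\<^bsub>homeo_group\<^esub> g \<in> carrier homeo_group"
    unfolding homeo_group_def using homeomorphism_compose by fastforce
next
  show "\<one>\<^bsub>homeo_group\<^esub> \<in> carrier (homeo_group :: ('m::topological_space \<Rightarrow> 'm) monoid)"
    using homeomorphism_ident[of "UNIV :: 'm set"] by (auto simp: homeo_group_def id_def)
next
  fix f :: "'m::topological_space \<Rightarrow> 'm"
  assume "f \<in> carrier homeo_group"
  then obtain g where g: "homeomorphism UNIV UNIV f g"
    by (auto simp: homeo_group_def)
  then have "g \<circ> f = id"
    by (auto simp: homeomorphism_def)
  with g show "\<exists>h\<in>carrier homeo_group. h \<otimes>\<^bsub>homeo_group\<^esub> f = \<one>\<^bsub>homeo_group\<^esub>"
    by (auto simp: homeo_group_def intro: homeomorphism_symD)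
qed (auto simp: homeo_group_def)

lemma m_inv_homeo_group:
  assumes "f \<in> carrier homeo_group"
  shows "inv\<^bsub>homeo_group\<^esub> f = inv_into UNIV f"
proof -
  obtain g where g: "homeomorphism UNIV UNIV f g"
    using assms by (auto simp: homeo_group_def)
  then have "g \<circ> f = id"
    by (auto simp: homeomorphism_def)
  moreover have "g \<in> carrier homeo_group"
    using g by (auto simp: homeo_group_def intro: homeomorphism_symD)
  ultimately have "inv\<^bsub>homeo_group\<^esub> f = g"
    using assms by (intro group.inv_equality[OF group_homeo_group]) (auto simp: homeo_group_def)
  then show ?thesis
    using homeo_inv_into[OF g] by simp
qed

text \<open>The maps \<open>f n\<close>, restricted to the complement of \<open>y\<close>, converge locally uniformly to the
  constant \<open>x\<close>: each point of \<open>X - {y}\<close> has a neighbourhood in \<open>X - {y}\<close> on which the convergence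
  is uniform. As the limit is constant, uniform convergence on a set only involves the
  neighbourhoods of \<open>x\<close>, so that no choice of a metric is needed.\<close>

definition loc_unif_to_const ::
    "'a topology \<Rightarrow> (nat \<Rightarrow> 'a \<Rightarrow> 'a) \<Rightarrow> 'a \<Rightarrow> 'a \<Rightarrow> bool" where
  "loc_unif_to_const X f y x \<longleftrightarrow>
     (\<forall>z\<in>topspace X - {y}. \<exists>W. openin X W \<and> z \<in> W \<and>
        (\<forall>U. openin X U \<and> x \<in> U \<longrightarrow> (\<forall>\<^sub>F n in sequentially. f n ` (W - {y}) \<subseteq> U)))"

lemma loc_unif_to_const_iff_uniform_limit:
  fixes x y :: "'m::metric_space"
  shows "loc_unif_to_const euclidean f y x \<longleftrightarrow>
     (\<forall>z. z \<noteq> y \<longrightarrow> (\<exists>W. open W \<and> z \<in> W \<and> uniform_limit (W - {y}) f (\<lambda>_. x) sequentially))"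
proof -
  have "(\<forall>U. open U \<and> x \<in> U \<longrightarrow> (\<forall>\<^sub>F n in sequentially. f n ` S \<subseteq> U)) \<longleftrightarrow>
        uniform_limit S f (\<lambda>_. x) sequentially" (is "?L \<longleftrightarrow> ?R") for S
  proof
    assume L: ?L
    show ?R
    proof (rule uniform_limitI)
      fix e :: real assume "e > 0"
      then have "\<forall>\<^sub>F n in sequentially. f n ` S \<subseteq> ball x e"
        using L by (simp add: open_ball)
      then show "\<forall>\<^sub>F n in sequentially. \<forall>z\<in>S. dist (f n z) x < e"
        by eventually_elim (auto simp: dist_commute)
    qed
  next
    assume R: ?R
    show ?L
    proof (intro allI impI, elim conjE)
      fix U assume "open U" "x \<in> U"
      then obtain e where e: "e > 0" "ball x e \<subseteq> U"
        using open_contains_ball by blast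
      have "\<forall>\<^sub>F n in sequentially. \<forall>z\<in>S. dist (f n z) x < e"
        using uniform_limitD[OF R e(1)] .
      then show "\<forall>\<^sub>F n in sequentially. f n ` S \<subseteq> U"
        by eventually_elim (use e in \<open>auto simp: dist_commute subset_iff\<close>)
    qed
  qed
  then show ?thesis
    by (auto simp: loc_unif_to_const_def)
qed


section \<open>Convergence groups\<close>

definition convergence_property ::
    "'a topology \<Rightarrow> ('g \<Rightarrow> 'a \<Rightarrow> 'a) \<Rightarrow> 'g set \<Rightarrow> bool" where
  "convergence_property X act G \<longleftrightarrow>
     (\<forall>\<gamma>::nat \<Rightarrow> 'g. inj \<gamma> \<and> range \<gamma> \<subseteq> G \<longrightarrow>
        (\<exists>x\<in>topspace X. \<exists>y\<in>topspace X. \<exists>r. strict_mono r \<and>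
           loc_unif_to_const X (\<lambda>j. act (\<gamma> (r j))) y x))"

definition convergence_group :: "('m::topological_space \<Rightarrow> 'm) set \<Rightarrow> bool" where
  "convergence_group \<Gamma> \<longleftrightarrow>
     subgroup \<Gamma> homeo_group \<and> convergence_property euclidean (\<lambda>\<gamma>. \<gamma>) \<Gamma>"

definition limit_set :: "('m::topological_space \<Rightarrow> 'm) set \<Rightarrow> 'm set" where
  "limit_set \<Gamma> =
     {x. \<exists>y. \<exists>\<gamma>::nat \<Rightarrow> 'm \<Rightarrow> 'm. range \<gamma> \<subseteq> \<Gamma> \<and> loc_unif_to_const euclidean \<gamma> y x}"

definition non_elementary :: "('m::topological_space \<Rightarrow> 'm) set \<Rightarrow> bool" where
  "non_elementary \<Gamma> \<longleftrightarrow> infinite (limit_set \<Gamma>) \<or> card (limit_set \<Gamma>) \<ge> 3"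

definition conical_limit_set :: "('m::topological_space \<Rightarrow> 'm) set \<Rightarrow> 'm set" where
  "conical_limit_set \<Gamma> =
     {x \<in> limit_set \<Gamma>. \<exists>a b. a \<noteq> b \<and>
        (\<exists>\<gamma>::nat \<Rightarrow> 'm \<Rightarrow> 'm. range \<gamma> \<subseteq> \<Gamma> \<and> (\<lambda>n. \<gamma> n x) \<longlonglongrightarrow> a \<and>
           (\<forall>y. y \<noteq> x \<longrightarrow> (\<lambda>n. \<gamma> n y) \<longlonglongrightarrow> b))}"

text \<open>\<open>\<gamma>\<close> is loxodromic with \<open>\<gamma>\<^sup>+ = p\<close> and \<open>\<gamma>\<^sup>- = q\<close>.\<close>

definition loxodromic_with ::
    "('m::topological_space \<Rightarrow> 'm) set \<Rightarrow> ('m \<Rightarrow> 'm) \<Rightarrow> 'm \<Rightarrow> 'm \<Rightarrow> bool" where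
  "loxodromic_with \<Gamma> \<gamma> p q \<longleftrightarrow>
     \<gamma> \<in> \<Gamma> \<and> p \<noteq> q \<and> p \<in> limit_set \<Gamma> \<and> q \<in> limit_set \<Gamma> \<and> \<gamma> p = p \<and> \<gamma> q = q \<and>
     loc_unif_to_const euclidean (\<lambda>n. \<gamma> ^^ n) q p \<and>
     loc_unif_to_const euclidean (\<lambda>n. (inv\<^bsub>homeo_group\<^esub> \<gamma>) ^^ n) p q"


section \<open>The compactification and compatible metrics\<close>

text \<open>The disjoint union of \<open>\<Gamma>\<close> and \<open>M\<close> is the set \<open>\<Gamma> <+> UNIV\<close>, with the points of \<open>\<Gamma>\<close> embedded
  by \<open>Inl\<close> and those of \<open>M\<close> by \<open>Inr\<close>.\<close>

definition sum_action :: "('m \<Rightarrow> 'm) \<Rightarrow> ('m \<Rightarrow> 'm) + 'm \<Rightarrow> ('m \<Rightarrow> 'm) + 'm" where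
  "sum_action \<gamma> = map_sum (\<lambda>g. \<gamma> \<circ> g) \<gamma>"

definition compactification_topology ::
    "('m::topological_space \<Rightarrow> 'm) set \<Rightarrow> (('m \<Rightarrow> 'm) + 'm) topology \<Rightarrow> bool" where
  "compactification_topology \<Gamma> T \<longleftrightarrow>
     topspace T = \<Gamma> <+> UNIV \<and> compact_space T \<and> metrizable_space T \<and>
     embedding_map (discrete_topology \<Gamma>) T Inl \<and>
     embedding_map euclidean T Inr \<and>
     (\<forall>\<gamma>\<in>\<Gamma>. homeomorphic_map T T (sum_action \<gamma>)) \<and>
     convergence_property T sum_action \<Gamma>"

definition compatible_metric ::
    "('m::topological_space \<Rightarrow> 'm) set \<Rightarrow>
     (('m \<Rightarrow> 'm) + 'm \<Rightarrow> ('m \<Rightarrow> 'm) + 'm \<Rightarrow> real) \<Rightarrow> bool" where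
  "compatible_metric \<Gamma> d \<longleftrightarrow>
     Metric_space (\<Gamma> <+> UNIV) d \<and>
     compactification_topology \<Gamma> (Metric_space.mtopology (\<Gamma> <+> UNIV) d)"


section \<open>Coarse-cocycles\<close>

definition kappa_coarse_cocycle ::
    "real \<Rightarrow> ('m::topological_space \<Rightarrow> 'm) set \<Rightarrow> (('m \<Rightarrow> 'm) \<Rightarrow> 'm \<Rightarrow> real) \<Rightarrow> bool" where
  "kappa_coarse_cocycle \<kappa> \<Gamma> \<sigma> \<longleftrightarrow>
     (\<forall>\<gamma>\<in>\<Gamma>. \<forall>x0. Limsup (at x0) (\<lambda>x. ereal \<bar>\<sigma> \<gamma> x0 - \<sigma> \<gamma> x\<bar>) \<le> ereal \<kappa>) \<and>
     (\<forall>\<gamma>1\<in>\<Gamma>. \<forall>\<gamma>2\<in>\<Gamma>. \<forall>x. \<bar>\<sigma> (\<gamma>1 \<circ> \<gamma>2) x - (\<sigma> \<gamma>1 (\<gamma>2 x) + \<sigma> \<gamma>2 x)\<bar> \<le> \<kappa>)"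

definition coarse_cocycle ::
    "('m::topological_space \<Rightarrow> 'm) set \<Rightarrow> (('m \<Rightarrow> 'm) \<Rightarrow> 'm \<Rightarrow> real) \<Rightarrow> bool" where
  "coarse_cocycle \<Gamma> \<sigma> \<longleftrightarrow> (\<exists>\<kappa>\<ge>0. kappa_coarse_cocycle \<kappa> \<Gamma> \<sigma>)"

definition proper_cocycle ::
    "('m::topological_space \<Rightarrow> 'm) set \<Rightarrow> (('m \<Rightarrow> 'm) + 'm \<Rightarrow> ('m \<Rightarrow> 'm) + 'm \<Rightarrow> real) \<Rightarrow>
     (('m \<Rightarrow> 'm) \<Rightarrow> 'm \<Rightarrow> real) \<Rightarrow> bool" where
  "proper_cocycle \<Gamma> d \<sigma> \<longleftrightarrow>
     (\<forall>(\<gamma>::nat \<Rightarrow> 'm \<Rightarrow> 'm) p q. inj \<gamma> \<and> (\<forall>n. loxodromic_with \<Gamma> (\<gamma> n) (p n) (q n)) \<and>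
        liminf (\<lambda>n. ereal (d (Inr (q n)) (Inr (p n)))) > 0 \<longrightarrow>
        filterlim (\<lambda>n. \<sigma> (\<gamma> n) (p n)) at_top sequentially)"

text \<open>\<open>N\<close> is a choice of the \<open>\<sigma>\<close>-magnitude function on \<open>\<Gamma>\<close>.\<close>

definition magnitude_function ::
    "('m::topological_space \<Rightarrow> 'm) set \<Rightarrow> (('m \<Rightarrow> 'm) + 'm \<Rightarrow> ('m \<Rightarrow> 'm) + 'm \<Rightarrow> real) \<Rightarrow>
     (('m \<Rightarrow> 'm) \<Rightarrow> 'm \<Rightarrow> real) \<Rightarrow> (('m \<Rightarrow> 'm) \<Rightarrow> real) \<Rightarrow> bool" where
  "magnitude_function \<Gamma> d \<sigma> N \<longleftrightarrow>
     (\<forall>\<epsilon>>0. \<exists>C>0. \<forall>x. \<forall>\<gamma>\<in>\<Gamma>. d (Inr x) (Inl (inv\<^bsub>homeo_group\<^esub> \<gamma>)) > \<epsilon> \<longrightarrow>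
        N \<gamma> - C \<le> \<sigma> \<gamma> x \<and> \<sigma> \<gamma> x \<le> N \<gamma> + C)"

definition expanding_coarse_cocycle ::
    "('m::topological_space \<Rightarrow> 'm) set \<Rightarrow> (('m \<Rightarrow> 'm) + 'm \<Rightarrow> ('m \<Rightarrow> 'm) + 'm \<Rightarrow> real) \<Rightarrow>
     (('m \<Rightarrow> 'm) \<Rightarrow> 'm \<Rightarrow> real) \<Rightarrow> bool" where
  "expanding_coarse_cocycle \<Gamma> d \<sigma> \<longleftrightarrow>
     coarse_cocycle \<Gamma> \<sigma> \<and> proper_cocycle \<Gamma> d \<sigma> \<and> (\<exists>N. magnitude_function \<Gamma> d \<sigma> N)"

definition critical_exponent :: "('m \<Rightarrow> 'm) set \<Rightarrow> (('m \<Rightarrow> 'm) \<Rightarrow> real) \<Rightarrow> ereal" where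
  "critical_exponent \<Gamma> N = Inf (ereal ` {s. s > 0 \<and> (\<lambda>\<gamma>. exp (- s * N \<gamma>)) summable_on \<Gamma>})"


section \<open>Patterson--Sullivan measures\<close>

definition PS_measure ::
    "real \<Rightarrow> ('m::topological_space \<Rightarrow> 'm) set \<Rightarrow> (('m \<Rightarrow> 'm) \<Rightarrow> 'm \<Rightarrow> real) \<Rightarrow> real \<Rightarrow>
     'm measure \<Rightarrow> bool" where
  "PS_measure C \<Gamma> \<sigma> \<beta> \<mu> \<longleftrightarrow>
     prob_space \<mu> \<and> sets \<mu> = sets borel \<and>
     (\<forall>\<gamma>\<in>\<Gamma>. absolutely_continuous \<mu> (distr \<mu> borel \<gamma>) \<and>
        absolutely_continuous (distr \<mu> borel \<gamma>) \<mu> \<and>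
        (AE x in \<mu>.
           ennreal (exp (- C - \<beta> * \<sigma> (inv\<^bsub>homeo_group\<^esub> \<gamma>) x)) \<le> RN_deriv \<mu> (distr \<mu> borel \<gamma>) x \<and>
           RN_deriv \<mu> (distr \<mu> borel \<gamma>) x \<le> ennreal (exp (C - \<beta> * \<sigma> (inv\<^bsub>homeo_group\<^esub> \<gamma>) x))))"

definition coarse_PS_measure ::
    "('m::topological_space \<Rightarrow> 'm) set \<Rightarrow> (('m \<Rightarrow> 'm) \<Rightarrow> 'm \<Rightarrow> real) \<Rightarrow> real \<Rightarrow>
     'm measure \<Rightarrow> bool" where
  "coarse_PS_measure \<Gamma> \<sigma> \<beta> \<mu> \<longleftrightarrow> (\<exists>C. PS_measure C \<Gamma> \<sigma> \<beta> \<mu>)"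

end

theory Submission
  imports Defs
begin

text \<open>Everything takes place on the compactification, where a sequence \<open>g\<^sub>n\<close> in \<open>\<Gamma>\<close> converging to \<open>a\<close>
  away from \<open>b\<close> satisfies \<open>g\<^sub>n \<rightarrow> a\<close> and \<open>g\<^sub>n\<^sup>-\<^sup>1 \<rightarrow> b\<close> as points. If \<open>a \<noteq> b\<close>, then \<open>g\<^sub>n\<close> is eventually
  loxodromic with fixed points near \<open>a\<close> and \<open>b\<close>; as \<open>\<Gamma>\<close> has no global fixed point, one can always
  move \<open>a\<close> off \<open>b\<close>, and properness makes the sublevel sets of the magnitude \<open>N\<close> finite.

  Two facts then drive all the estimates. The shadows \<open>g {z. d(z, g\<^sup>-\<^sup>1) > \<epsilon>}\<close> of the elements with
  \<open>N g\<close> in a fixed unit interval cover a point boundedly often. And for all \<open>\<alpha>, \<beta>\<close> there is \<open>f\<close> in a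
  fixed finite set with \<open>N (\<alpha> f \<beta>) = N \<alpha> + N \<beta> + O(1)\<close>.

  Concatenating \<open>n\<close> elements of the annulus \<open>{g. m \<le> N g < m + 1}\<close>, of cardinality \<open>A\<close>, yields by
  bounded multiplicity at least \<open>(A/K)^n\<close> elements with \<open>N \<le> n(m + L) + O(1)\<close>; hence \<open>A \<le> K e^s(m + L)\<close>
  whenever the Poincare series converges at \<open>s\<close>, which gives (4). A free semigroup found by
  ping-pong gives \<open>\<delta> > 0\<close>. For a Patterson--Sullivan measure, which is not a point mass, the
  shadow of \<open>g\<close> has measure comparable to \<open>e^-\<beta>N(g)\<close>, and bounded multiplicity yields \<open>A = O(e^\<beta>m)\<close>,
  hence (1). Finally, the conical limit points are those contained in infinitely many shadows for
  some \<open>\<epsilon>\<close>, which gives (2), and (3) by Borel--Cantelli.\<close>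

abbreviation ginv :: "('m \<Rightarrow> 'm) \<Rightarrow> 'm \<Rightarrow> 'm" where
  "ginv \<equiv> inv_into UNIV"

section \<open>Subsequences with constant or distinct terms, and fibre counting\<close>

lemma finite_range_constant_subseq:
  fixes g :: "nat \<Rightarrow> 'a"
  assumes "finite (range g)"
  obtains r c where "strict_mono (r :: nat \<Rightarrow> nat)" "\<And>n. g (r n) = c"
proof -
  obtain c where "infinite (g -` {c})"
    using assms inf_img_fin_dom[of g UNIV] by auto
  then show thesis
    using infinite_enumerate[of "g -` {c}"] that by auto
qed

lemma infinite_range_inj_subseq:
  fixes g :: "nat \<Rightarrow> 'a"
  assumes "infinite (range g)"
  obtains r where "strict_mono (r :: nat \<Rightarrow> nat)" "inj (\<lambda>n. g (r n))"
proof -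
  \<comment> \<open>\<open>A\<close> collects the first occurrences of values, so \<open>g\<close>
    is injective on \<open>A\<close> and still attains its whole range there.\<close>
  define A where "A = {n. \<forall>m<n. g m \<noteq> g n}"
  have "\<exists>n\<in>A. g n = g k" for k
  proof -
    define n where "n = (LEAST n. g n = g k)"
    have "g n = g k" unfolding n_def by (rule LeastI) simp
    moreover have "\<forall>m<n. g m \<noteq> g k" unfolding n_def using not_less_Least by blast
    ultimately show ?thesis by (intro bexI[of _ n]) (auto simp: A_def)
  qed
  then have "range g \<subseteq> g ` A"
    by (metis imageE image_eqI subsetI)
  with assms have "infinite A"
    using finite_subset by blast
  then obtain r :: "nat \<Rightarrow> nat" where r: "strict_mono r" "\<And>n. r n \<in> A"
    using infinite_enumerate[of A] by blast
  have "g (r m) \<noteq> g (r n)" if "m < n" for m n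
    using that r by (auto simp: A_def strict_mono_def)
  then have "inj (\<lambda>n. g (r n))"
    by (metis injI linorder_neqE_nat)
  with r that show thesis by blast
qed

lemma card_le_mult_card_image:
  assumes "finite A" "\<And>y. y \<in> f ` A \<Longrightarrow> card {x\<in>A. f x = y} \<le> k"
  shows "card A \<le> k * card (f ` A)"
proof -
  have "card A = card (\<Union>y\<in>f ` A. {x\<in>A. f x = y})"
    by (rule arg_cong[where f = card]) auto
  also have "\<dots> \<le> (\<Sum>y\<in>f ` A. card {x\<in>A. f x = y})"
    using assms(1) by (intro card_UN_le) auto
  also have "\<dots> \<le> (\<Sum>y\<in>f ` A. k)"
    using assms(2) by (intro sum_mono)
  finally show ?thesis by (simp add: mult.commute)
qed

section \<open>The compactification\<close>

locale compactified_convergence_group =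
  fixes \<Gamma> :: "('m::metric_space \<Rightarrow> 'm) set"
    and d :: "('m \<Rightarrow> 'm) + 'm \<Rightarrow> ('m \<Rightarrow> 'm) + 'm \<Rightarrow> real"
  assumes compact_UNIV: "compact (UNIV :: 'm set)"
    and convergence_group: "convergence_group \<Gamma>"
    and non_elementary: "non_elementary \<Gamma>"
    and compatible: "compatible_metric \<Gamma> d"
begin

definition T :: "(('m \<Rightarrow> 'm) + 'm) set" where
  "T = \<Gamma> <+> UNIV"

sublocale T: Metric_space T d
  using compatible by (simp add: compatible_metric_def T_def)

lemma compactification:
  "compact_space T.mtopology" "embedding_map euclidean T.mtopology Inr"
  "\<And>g. g \<in> \<Gamma> \<Longrightarrow> homeomorphic_map T.mtopology T.mtopology (sum_action g)"
  "convergence_property T.mtopology sum_action \<Gamma>"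
  using compatible unfolding compatible_metric_def compactification_topology_def T_def by blast+

section \<open>Group laws in \<open>\<Gamma>\<close>, with inverses written as
  \<open>ginv\<close>\<close>

lemma subgroup: "subgroup \<Gamma> homeo_group"
  using convergence_group by (simp add: convergence_group_def)

lemma \<Gamma>_homeo: "g \<in> \<Gamma> \<Longrightarrow> homeomorphism UNIV UNIV g (ginv g)"
  using subgroup.mem_carrier[OF subgroup, of g] homeo_inv_into
  by (fastforce simp: homeo_group_def)

lemma m_inv_eq: "g \<in> \<Gamma> \<Longrightarrow> inv\<^bsub>homeo_group\<^esub> g = ginv g"
  using subgroup.mem_carrier[OF subgroup] m_inv_homeo_group by blast

lemma id_in [simp, intro]: "id \<in> \<Gamma>"
  using subgroup.one_closed[OF subgroup] by (simp add: homeo_group_def)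

lemma comp_in [simp, intro]: "f \<in> \<Gamma> \<Longrightarrow> g \<in> \<Gamma> \<Longrightarrow> f \<circ> g \<in> \<Gamma>"
  using subgroup.m_closed[OF subgroup, of f g] by (simp add: homeo_group_def)

lemma ginv_in [simp, intro]: "g \<in> \<Gamma> \<Longrightarrow> ginv g \<in> \<Gamma>"
  using subgroup.m_inv_closed[OF subgroup, of g] by (simp add: m_inv_eq)

lemma ginv_comp [simp]: "g \<in> \<Gamma> \<Longrightarrow> ginv g \<circ> g = id" "g \<in> \<Gamma> \<Longrightarrow> g \<circ> ginv g = id"
  using \<Gamma>_homeo[of g] by (auto simp: homeomorphism_def)

lemma ginv_app [simp]: "g \<in> \<Gamma> \<Longrightarrow> ginv g (g x) = x" "g \<in> \<Gamma> \<Longrightarrow> g (ginv g x) = x"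
  using \<Gamma>_homeo[of g] by (auto simp: homeomorphism_def)

lemma bij_\<Gamma>: "g \<in> \<Gamma> \<Longrightarrow> bij g"
  by (rule bij_betw_byWitness[where f' = "ginv g"]) auto

lemma eq_iff_\<Gamma> [simp]: "g \<in> \<Gamma> \<Longrightarrow> g x = g y \<longleftrightarrow> x = y"
  by (metis ginv_app(1))

lemma ginv_ginv [simp]: "g \<in> \<Gamma> \<Longrightarrow> ginv (ginv g) = g"
  by (simp add: bij_\<Gamma> inv_inv_eq)

lemma ginv_o: "f \<in> \<Gamma> \<Longrightarrow> g \<in> \<Gamma> \<Longrightarrow> ginv (f \<circ> g) = ginv g \<circ> ginv f"
  by (simp add: bij_\<Gamma> o_inv_distrib)

lemma ginv_eq_iff [simp]: "f \<in> \<Gamma> \<Longrightarrow> g \<in> \<Gamma> \<Longrightarrow> ginv f = ginv g \<longleftrightarrow> f = g"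
  by (metis ginv_ginv)

lemma pow_in [simp, intro]: "g \<in> \<Gamma> \<Longrightarrow> g ^^ n \<in> \<Gamma>"
  by (induction n) auto

lemma continuous_\<Gamma>: "g \<in> \<Gamma> \<Longrightarrow> continuous_on UNIV g"
  using \<Gamma>_homeo[of g] by (auto simp: homeomorphism_def)

section \<open>The action on the compactification and sequential convergence there\<close>

abbreviation act :: "('m \<Rightarrow> 'm) \<Rightarrow> ('m \<Rightarrow> 'm) + 'm \<Rightarrow> ('m \<Rightarrow> 'm) + 'm" where
  "act \<equiv> sum_action"

lemma Inl_in [simp]: "Inl g \<in> T \<longleftrightarrow> g \<in> \<Gamma>"
  by (auto simp: T_def)

lemma Inr_in [simp]: "Inr x \<in> T"
  by (auto simp: T_def)

lemma act_Inl [simp]: "act g (Inl h) = Inl (g \<circ> h)"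
  by (simp add: sum_action_def)

lemma act_Inr [simp]: "act g (Inr x) = Inr (g x)"
  by (simp add: sum_action_def)

lemma act_id [simp]: "act id t = t"
  by (cases t) auto

lemma act_comp: "act (f \<circ> g) t = act f (act g t)"
  by (cases t) (auto simp: o_assoc)

lemma act_in [simp, intro]: "g \<in> \<Gamma> \<Longrightarrow> t \<in> T \<Longrightarrow> act g t \<in> T"
  by (cases t) auto

lemma act_ginv [simp]:
  "g \<in> \<Gamma> \<Longrightarrow> act (ginv g) (act g t) = t" "g \<in> \<Gamma> \<Longrightarrow> act g (act (ginv g) t) = t"
  by (simp_all flip: act_comp)

text \<open>Phrased through the real sequence of distances, so that limit theorems for reals apply
  directly; inside \<open>T\<close> it agrees with \<open>limitin\<close> by
  \<open>tends_iff_limitin\<close>.\<close>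

definition tends :: "(nat \<Rightarrow> ('m \<Rightarrow> 'm) + 'm) \<Rightarrow> ('m \<Rightarrow> 'm) + 'm \<Rightarrow> bool" where
  "tends s l \<longleftrightarrow> (\<lambda>n. d (s n) l) \<longlonglongrightarrow> 0"

lemma tends_iff_limitin:
  assumes "range s \<subseteq> T" "l \<in> T"
  shows "tends s l \<longleftrightarrow> limitin T.mtopology s l sequentially"
proof -
  have "s n \<in> T" for n
    using assms(1) by blast
  then show ?thesis
    using assms(2) by (simp add: T.limitin_metric_dist_null tends_def)
qed

lemma tends_D: "tends s l \<Longrightarrow> e > 0 \<Longrightarrow> \<forall>\<^sub>F n in sequentially. d (s n) l < e"
  unfolding tends_def by (auto dest: order_tendstoD(2))

lemma tends_I: "(\<And>e. e > 0 \<Longrightarrow> \<forall>\<^sub>F n in sequentially. d (s n) l < e) \<Longrightarrow> tends s l"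
  unfolding tends_def
  by (rule order_tendstoI) (auto intro!: always_eventually less_le_trans[OF _ T.nonneg])

lemma tends_const: "l \<in> T \<Longrightarrow> tends (\<lambda>_. l) l"
  by (simp add: tends_def)

lemma tends_subseq: "tends s l \<Longrightarrow> strict_mono r \<Longrightarrow> tends (\<lambda>n. s (r n)) l"
  unfolding tends_def using LIMSEQ_subseq_LIMSEQ[of "\<lambda>n. d (s n) l" 0 r] by (simp add: o_def)

lemma tends_dist:
  assumes "tends s l" "tends s' l'" "\<And>n. s n \<in> T" "\<And>n. s' n \<in> T" "l \<in> T" "l' \<in> T"
  shows "(\<lambda>n. d (s n) (s' n)) \<longlonglongrightarrow> d l l'"
proof -
  have "\<bar>d (s n) (s' n) - d l l'\<bar> \<le> d (s n) l + d (s' n) l'" for n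
    using T.triangle[of "s n" l "s' n"] T.triangle[of l l' "s' n"] T.triangle[of l "s n" l']
      T.triangle[of "s n" "s' n" l'] T.commute assms by (smt (verit))
  moreover have "(\<lambda>n. d (s n) l + d (s' n) l') \<longlonglongrightarrow> 0"
    using tendsto_add[OF assms(1,2)[unfolded tends_def]] by simp
  ultimately have "(\<lambda>n. d (s n) (s' n) - d l l') \<longlonglongrightarrow> 0"
    by (intro Lim_null_comparison[of "\<lambda>n. d (s n) (s' n) - d l l'"] always_eventually) auto
  then show ?thesis
    by (simp add: LIM_zero_iff)
qed

lemma seq_compact_T:
  assumes "\<And>n. s n \<in> T"
  obtains l r where "l \<in> T" "strict_mono (r :: nat \<Rightarrow> nat)" "tends (\<lambda>n. s (r n)) l"
proof -
  have "\<forall>\<sigma>::nat \<Rightarrow> _. range \<sigma> \<subseteq> T \<longrightarrow>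
      (\<exists>l r. l \<in> T \<and> strict_mono r \<and> limitin T.mtopology (\<sigma> \<circ> r) l sequentially)"
    using compactification(1) unfolding T.compact_space_sequentially .
  moreover have "range s \<subseteq> T"
    using assms by blast
  ultimately obtain l and r :: "nat \<Rightarrow> nat"
    where lr: "l \<in> T" "strict_mono r" "limitin T.mtopology (s \<circ> r) l sequentially"
    by blast
  moreover have "range (s \<circ> r) \<subseteq> T"
    using assms by (simp add: image_subset_iff)
  ultimately have "tends (s \<circ> r) l"
    by (simp add: tends_iff_limitin)
  then show thesis
    using that[OF lr(1,2)] by (simp add: o_def)
qed

lemma tends_unique:
  assumes "tends s l" "tends s l'" "\<And>n. s n \<in> T" "l \<in> T" "l' \<in> T"
  shows "l = l'"
proof -
  have "(\<lambda>n. d (s n) (s n)) \<longlonglongrightarrow> d l l'"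
    using assms by (intro tends_dist)
  moreover have "d (s n) (s n) = 0" for n
    using assms(3) by simp
  ultimately have "d l l' = 0"
    by (simp add: LIMSEQ_const_iff)
  then show ?thesis
    using T.zero assms(4,5) by blast
qed

lemma tends_act:
  assumes "g \<in> \<Gamma>" "\<And>n. s n \<in> T" "l \<in> T" "tends s l"
  shows "tends (\<lambda>n. act g (s n)) (act g l)"
proof -
  have "continuous_map T.mtopology T.mtopology (act g)"
    using compactification(3)[OF assms(1)] by (rule homeomorphic_imp_continuous_map)
  moreover have "limitin T.mtopology s l sequentially"
    using assms by (subst tends_iff_limitin[symmetric]) (auto simp: image_subset_iff)
  ultimately have "limitin T.mtopology (act g \<circ> s) (act g l) sequentially"
    by (rule continuous_map_limit)
  moreover have "range (act g \<circ> s) \<subseteq> T" "act g l \<in> T"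
    using assms by (auto simp: image_subset_iff)
  ultimately show ?thesis
    using tends_iff_limitin by (metis comp_def fun_eq_iff)
qed

text \<open>The embedding \<open>Inr\<close> has a continuous inverse on its range. This lets the
  given topology of \<open>M\<close> and the compatible metric be exchanged freely.\<close>

lemma tends_Inr_iff: "tends (\<lambda>n. Inr (x n)) (Inr l) \<longleftrightarrow> x \<longlonglongrightarrow> l"
proof -
  have "homeomorphic_map euclidean (subtopology T.mtopology (range Inr)) (Inr :: 'm \<Rightarrow> _)"
    using compactification(2) by (simp add: embedding_map_def)
  then obtain f where f: "continuous_map euclidean (subtopology T.mtopology (range Inr)) (Inr :: 'm \<Rightarrow> _)"
    "continuous_map (subtopology T.mtopology (range Inr)) euclidean f" "\<And>y. f (Inr y) = y"
    by (auto simp: homeomorphic_map_maps homeomorphic_maps_def)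
  have "limitin (subtopology T.mtopology (range Inr)) (\<lambda>n. Inr (x n)) (Inr l) sequentially \<longleftrightarrow> x \<longlonglongrightarrow> l"
    using continuous_map_limit[OF f(1), of x l] continuous_map_limit[OF f(2), of "\<lambda>n. Inr (x n)" "Inr l"]
    by (auto simp: o_def f(3))
  then show ?thesis
    by (subst tends_iff_limitin) (auto simp: limitin_subtopology)
qed

lemma seq_compact_M:
  fixes x :: "nat \<Rightarrow> 'm"
  obtains l r where "strict_mono (r :: nat \<Rightarrow> nat)" "tends (\<lambda>n. Inr (x (r n))) (Inr l)"
proof -
  obtain l r where "strict_mono (r :: nat \<Rightarrow> nat)" "(x \<circ> r) \<longlonglongrightarrow> l"
    using compact_UNIV unfolding compact_def by blast
  then show thesis
    using that tends_Inr_iff by (simp add: o_def)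
qed

text \<open>Compactness of \<open>M\<close> makes it closed: some subsequence already converges in
  \<open>M\<close>, and limits are unique.\<close>

lemma closed_M:
  assumes "tends (\<lambda>n. Inr (x n)) l" "l \<in> T"
  obtains a where "l = Inr a"
proof -
  obtain a r where r: "strict_mono (r :: nat \<Rightarrow> nat)" "tends (\<lambda>n. Inr (x (r n))) (Inr a)"
    by (rule seq_compact_M)
  have "tends (\<lambda>n. Inr (x (r n))) l"
    using tends_subseq[OF assms(1) r(1)] .
  with r(2) have "l = Inr a"
    using assms(2) by (intro tends_unique[of "\<lambda>n. Inr (x (r n))"]) auto
  with that show thesis .
qed

lemma open_nhd:
  assumes "open U" "x \<in> U"
  shows "\<exists>e>0. \<forall>y. d (Inr y) (Inr x) < e \<longrightarrow> y \<in> U"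
proof (rule ccontr)
  assume "\<not> ?thesis"
  then have "\<exists>y. d (Inr y) (Inr x) < 1 / Suc n \<and> y \<notin> U" for n
    by (metis of_nat_0_less_iff zero_less_Suc zero_less_divide_1_iff)
  then obtain y where y: "\<And>n. d (Inr (y n)) (Inr x) < 1 / Suc n" "\<And>n. y n \<notin> U"
    by metis
  have "(\<lambda>n. d (Inr (y n)) (Inr x)) \<longlonglongrightarrow> 0"
    by (rule tendsto_sandwich[OF _ _ tendsto_const LIMSEQ_inverse_real_of_nat])
      (use y(1) in \<open>auto intro!: always_eventually less_imp_le simp: inverse_eq_divide simp del: of_nat_Suc\<close>)
  then have "y \<longlonglongrightarrow> x"
    using tends_Inr_iff by (simp add: tends_def)
  then have "\<forall>\<^sub>F n in sequentially. y n \<in> U"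
    using assms by (rule topological_tendstoD)
  with y(2) show False
    by simp
qed

lemma continuous_dist: "t \<in> T \<Longrightarrow> continuous_on UNIV (\<lambda>y. d (Inr y) t)"
  unfolding continuous_on_sequentially
  by (auto simp: o_def tends_Inr_iff[symmetric] intro!: tends_dist tends_const)

lemma open_dist_gt: "t \<in> T \<Longrightarrow> open {y. d (Inr y) t > e}"
  using continuous_dist by (intro open_Collect_less) (auto intro: continuous_intros)

text \<open>Otherwise points of \<open>M\<close> would converge to \<open>Inl g\<close>, against
  \<open>closed_M\<close>.\<close>

lemma group_point_isolated:
  assumes "g \<in> \<Gamma>"
  obtains e where "e > 0" "\<And>x. d (Inr x) (Inl g) \<ge> e"
proof (rule ccontr)
  assume "\<not> thesis"
  with that have "\<exists>x. d (Inr x) (Inl g) < 1 / Suc n" for n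
    by (metis of_nat_0_less_iff zero_less_Suc zero_less_divide_1_iff linorder_not_less)
  then obtain x where x: "\<And>n. d (Inr (x n)) (Inl g) < 1 / Suc n"
    by metis
  have "tends (\<lambda>n. Inr (x n)) (Inl g)"
    unfolding tends_def
    by (rule tendsto_sandwich[OF _ _ tendsto_const LIMSEQ_inverse_real_of_nat])
      (use x(1) in \<open>auto intro!: always_eventually less_imp_le simp: inverse_eq_divide simp del: of_nat_Suc\<close>)
  then show False
    using assms by (auto elim: closed_M)
qed

text \<open>Convergence is required on the whole compactification, not only on \<open>M\<close>; it is then
  symmetric: the inverses converge to \<open>b\<close> away from \<open>a\<close>.\<close>

definition conv :: "(nat \<Rightarrow> 'm \<Rightarrow> 'm) \<Rightarrow> 'm \<Rightarrow> 'm \<Rightarrow> bool" where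
  "conv g a b \<longleftrightarrow> range g \<subseteq> \<Gamma> \<and> (\<forall>e>0. \<forall>\<^sub>F n in sequentially.
     \<forall>t\<in>T. d t (Inr b) \<ge> e \<longrightarrow> d (act (g n) t) (Inr a) < e)"

lemma conv_in: "conv g a b \<Longrightarrow> g n \<in> \<Gamma>"
  unfolding conv_def by auto

lemma convD:
  assumes "conv g a b" "e > 0"
  shows "\<forall>\<^sub>F n in sequentially. \<forall>t\<in>T. d t (Inr b) \<ge> e \<longrightarrow> d (act (g n) t) (Inr a) < e"
  using assms unfolding conv_def by blast

lemma conv_subseq: "conv g a b \<Longrightarrow> strict_mono r \<Longrightarrow> conv (\<lambda>n. g (r n)) a b"
  unfolding conv_def using eventually_subseq by (auto simp: image_subset_iff)

lemma conv_tends: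
  assumes "conv g a b" "tends s t" "\<And>n. s n \<in> T" "t \<in> T" "t \<noteq> Inr b"
  shows "tends (\<lambda>n. act (g n) (s n)) (Inr a)"
proof (rule tends_I)
  fix e :: real assume "e > 0"
  define e' where "e' = min e (d t (Inr b) / 2)"
  have "d t (Inr b) > 0"
    using assms by (simp add: T.mdist_pos_eq)
  then have e': "e' > 0" "e' < d t (Inr b)"
    using \<open>e > 0\<close> by (auto simp: e'_def)
  have "(\<lambda>n. d (s n) (Inr b)) \<longlonglongrightarrow> d t (Inr b)"
    using assms by (intro tends_dist tends_const) auto
  then have "\<forall>\<^sub>F n in sequentially. d (s n) (Inr b) > e'"
    using e' by (auto dest: order_tendstoD)
  with convD[OF assms(1) e'(1)] show "\<forall>\<^sub>F n in sequentially. d (act (g n) (s n)) (Inr a) < e"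
  proof eventually_elim
    case (elim n)
    then have "d (act (g n) (s n)) (Inr a) < e'"
      using assms(3) by (meson less_imp_le)
    then show ?case
      by (simp add: e'_def)
  qed
qed

lemma conv_tends_Inr: "conv g a b \<Longrightarrow> x \<noteq> b \<Longrightarrow> tends (\<lambda>n. Inr (g n x)) (Inr a)"
  using conv_tends[of g a b "\<lambda>_. Inr x" "Inr x"] by (simp add: tends_const)

text \<open>The base point \<open>Inl id\<close> is never the repelling point \<open>Inr b\<close>,
  and \<open>g n\<close> carries it to \<open>Inl (g n)\<close>.\<close>

lemma conv_tends_Inl: "conv g a b \<Longrightarrow> tends (\<lambda>n. Inl (g n)) (Inr a)"
  using conv_tends[of g a b "\<lambda>_. Inl id" "Inl id"] by (simp add: tends_const)

text \<open>The same radius \<open>e\<close> at both points makes the definition of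
  \<open>conv\<close> self-dual: its contrapositive at \<open>act (ginv (g n)) t\<close> is the
  claim for the inverses.\<close>

lemma conv_ginv:
  assumes "conv g a b"
  shows "conv (\<lambda>n. ginv (g n)) b a"
  unfolding conv_def
proof (intro conjI allI impI)
  have g: "g n \<in> \<Gamma>" for n
    using assms by (rule conv_in)
  then show "range (\<lambda>n. ginv (g n)) \<subseteq> \<Gamma>"
    by auto
  fix e :: real assume "e > 0"
  from convD[OF assms this]
  show "\<forall>\<^sub>F n in sequentially. \<forall>t\<in>T. d t (Inr a) \<ge> e \<longrightarrow> d (act (ginv (g n)) t) (Inr b) < e"
  proof eventually_elim
    case (elim n)
    show ?case
    proof (intro ballI impI)
      fix t assume t: "t \<in> T" "d t (Inr a) \<ge> e"
      with elim g[of n] show "d (act (ginv (g n)) t) (Inr b) < e"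
        by (metis act_in act_ginv(2) ginv_in linorder_not_less)
    qed
  qed
qed

text \<open>A failure of uniformity selects one bad point \<open>t n\<close> for each index of a
  subsequence, so it suffices to test moving points along subsequences.\<close>

lemma conv_seqI:
  assumes "\<And>n. g n \<in> \<Gamma>"
    and "\<And>e r t. e > 0 \<Longrightarrow> strict_mono (r :: nat \<Rightarrow> nat) \<Longrightarrow> (\<And>n. t n \<in> T) \<Longrightarrow>
      (\<And>n. d (t n) (Inr b) \<ge> e) \<Longrightarrow> tends (\<lambda>n. act (g (r n)) (t n)) (Inr a)"
  shows "conv g a b"
proof (rule ccontr)
  assume "\<not> conv g a b"
  then obtain e where e: "e > 0" "\<not> (\<forall>\<^sub>F n in sequentially.
     \<forall>t\<in>T. d t (Inr b) \<ge> e \<longrightarrow> d (act (g n) t) (Inr a) < e)"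
    unfolding conv_def using assms(1) by blast
  obtain r :: "nat \<Rightarrow> nat" where r: "strict_mono r"
    "\<And>n. \<not> (\<forall>t\<in>T. d t (Inr b) \<ge> e \<longrightarrow> d (act (g (r n)) t) (Inr a) < e)"
    using not_eventually_sequentiallyD[OF e(2)] by blast
  then obtain t where t: "\<And>n. t n \<in> T" "\<And>n. d (t n) (Inr b) \<ge> e"
    "\<And>n. \<not> d (act (g (r n)) (t n)) (Inr a) < e"
    by metis
  have "tends (\<lambda>n. act (g (r n)) (t n)) (Inr a)"
    using assms(2)[OF e(1) r(1) t(1,2)] .
  from tends_D[OF this e(1)] t(3) show False
    by simp
qed

lemma conv_seqD:
  assumes "conv g a b" "e > 0" "\<And>n. t n \<in> T" "\<And>n. d (t n) (Inr b) \<ge> e"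
  shows "tends (\<lambda>n. act (g n) (t n)) (Inr a)"
proof (rule tends_I)
  fix e' :: real assume "e' > 0"
  then have "min e e' > 0"
    using assms(2) by simp
  from convD[OF assms(1) this] show "\<forall>\<^sub>F n in sequentially. d (act (g n) (t n)) (Inr a) < e'"
    by eventually_elim (use assms in \<open>meson min.strict_boundedE min.coboundedI1\<close>)
qed

lemma conv_comp_left:
  assumes "f \<in> \<Gamma>" "conv g a b"
  shows "conv (\<lambda>n. f \<circ> g n) (f a) b"
proof (rule conv_seqI)
  show "f \<circ> g n \<in> \<Gamma>" for n
    using assms conv_in by blast
  fix e r and t :: "nat \<Rightarrow> _"
  assume *: "e > (0::real)" "strict_mono (r :: nat \<Rightarrow> nat)" "\<And>n. t n \<in> T" "\<And>n. d (t n) (Inr b) \<ge> e"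
  have "tends (\<lambda>n. act (g (r n)) (t n)) (Inr a)"
    by (rule conv_seqD[OF conv_subseq[OF assms(2) *(2)] *(1,3,4)])
  then have "tends (\<lambda>n. act f (act (g (r n)) (t n))) (act f (Inr a))"
    using assms conv_in[OF assms(2)] * by (intro tends_act) auto
  then show "tends (\<lambda>n. act (f \<circ> g (r n)) (t n)) (Inr (f a))"
    by (simp add: act_comp)
qed

section \<open>The limit set and extraction of convergent subsequences\<close>

lemma limit_set_avoid:
  assumes "finite A" "card A \<le> 2"
  obtains x where "x \<in> limit_set \<Gamma>" "x \<notin> A"
proof -
  have "\<not> limit_set \<Gamma> \<subseteq> A"
  proof
    assume "limit_set \<Gamma> \<subseteq> A"
    then have "finite (limit_set \<Gamma>)" "card (limit_set \<Gamma>) \<le> 2"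
      using assms by (auto intro: finite_subset dest: card_mono)
    with non_elementary show False
      by (simp add: non_elementary_def)
  qed
  with that show thesis by blast
qed

lemma avoid2:
  obtains x :: 'm where "x \<in> limit_set \<Gamma>" "x \<noteq> a" "x \<noteq> b"
  by (rule limit_set_avoid[of "{a, b}"]) (auto simp: card_insert_if)

text \<open>The convergence property is only local on the complement of \<open>y\<close>;
  compactness of \<open>T\<close> makes it uniform at positive distance from \<open>y\<close>.
  Invariance and closedness of \<open>M\<close> then place both limit points in
  \<open>M\<close>.\<close>

lemma conv_extract:
  assumes "inj g" "\<And>n. g n \<in> \<Gamma>"
  obtains r a b where "strict_mono (r :: nat \<Rightarrow> nat)" "conv (\<lambda>n. g (r n)) a b"
proof -
  obtain x y r where xy: "x \<in> T" "y \<in> T" "strict_mono (r :: nat \<Rightarrow> nat)"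
    and lu: "loc_unif_to_const T.mtopology (\<lambda>j. act (g (r j))) y x"
    using compactification(4) assms unfolding convergence_property_def
    by (metis T.topspace_mtopology image_subsetI)
  define f where "f = (\<lambda>n. act (g (r n)))"
  have f_in: "f n t \<in> T" if "t \<in> T" for n t
    using that assms by (auto simp: f_def)
  have sub: "tends (\<lambda>n. f (q (q' n)) (t (q' n))) x"
    if q: "strict_mono (q :: nat \<Rightarrow> nat)" "strict_mono (q' :: nat \<Rightarrow> nat)"
      and t: "\<And>n. t n \<in> T" "\<And>n. t n \<noteq> y" and l: "tends (\<lambda>n. t (q' n)) l" "l \<in> T" "l \<noteq> y"
    for q q' t l
  proof (rule tends_I)
    fix e :: real assume "e > 0"
    have "l \<in> topspace T.mtopology - {y}"
      using l by simp
    from bspec[OF lu[unfolded loc_unif_to_const_def] this]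
    obtain W where W: "openin T.mtopology W" "l \<in> W"
      "\<And>U. openin T.mtopology U \<Longrightarrow> x \<in> U \<Longrightarrow> \<forall>\<^sub>F n in sequentially. f n ` (W - {y}) \<subseteq> U"
      unfolding f_def by blast
    have "\<forall>\<^sub>F n in sequentially. f n ` (W - {y}) \<subseteq> T.mball x e"
      using \<open>e > 0\<close> xy by (intro W(3)) auto
    then have "\<forall>\<^sub>F n in sequentially. f (q (q' n)) ` (W - {y}) \<subseteq> T.mball x e"
      using eventually_subseq[OF strict_mono_o[OF q]] by auto
    moreover have "\<forall>\<^sub>F n in sequentially. t (q' n) \<in> W"
      using l t(1) W(1,2) tends_iff_limitin[of "\<lambda>n. t (q' n)" l]
      by (auto simp: limitin_def image_subset_iff)
    ultimately show "\<forall>\<^sub>F n in sequentially. d (f (q (q' n)) (t (q' n))) x < e"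
      by eventually_elim (use t(2) in \<open>auto simp: T.commute image_subset_iff\<close>)
  qed
  \<comment> \<open>A failing sequence has a convergent subsequence, whose limit keeps distance at
    least \<open>e\<close> from \<open>y\<close>, so the local statement \<open>sub\<close> applies
    to it.\<close>
  have conv': "tends (\<lambda>n. f (q n) (t n)) x"
    if q: "strict_mono (q :: nat \<Rightarrow> nat)" and t: "\<And>n. t n \<in> T" "e > 0" "\<And>n. d (t n) y \<ge> e"
    for q t e
  proof (rule ccontr)
    assume "\<not> ?thesis"
    then obtain e' where e': "e' > 0" "\<not> (\<forall>\<^sub>F n in sequentially. d (f (q n) (t n)) x < e')"
      using tends_I[of "\<lambda>n. f (q n) (t n)" x] by auto
    then obtain p :: "nat \<Rightarrow> nat" where p: "strict_mono p" "\<And>n. \<not> d (f (q (p n)) (t (p n))) x < e'"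
      using not_eventually_sequentiallyD[OF e'(2)] by auto
    obtain l p' where l: "l \<in> T" "strict_mono p'" "tends (\<lambda>n. t (p (p' n))) l"
      using seq_compact_T[of "\<lambda>n. t (p n)"] t(1) by blast
    have "(\<lambda>n. d (t (p (p' n))) y) \<longlonglongrightarrow> d l y"
      using l xy t(1) by (intro tends_dist tends_const) auto
    then have "d l y \<ge> e"
      by (rule LIMSEQ_le_const) (use t(3) in auto)
    then have "l \<noteq> y"
      using \<open>e > 0\<close> xy by (auto)
    moreover have "t n \<noteq> y" for n
      using t(2) t(3)[of n] xy by (auto)
    ultimately have "tends (\<lambda>n. f (q (p (p' n))) (t (p (p' n)))) x"
      using sub[OF q strict_mono_o[OF p(1) l(2)], of t l] t(1) l by simp
    from tends_D[OF this e'(1)] p(2) show False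
      by simp
  qed
  obtain u v w :: 'm where uvw: "u \<noteq> v" "u \<noteq> w" "v \<noteq> w"
    by (metis avoid2)
  have lim: "tends (\<lambda>n. f (q n) t) x" if "t \<in> T" "t \<noteq> y" "strict_mono q" for t q
  proof (rule conv')
    show "d t y > 0"
      using that xy by (simp add: T.mdist_pos_eq)
  qed (use that in auto)
  obtain u' where "Inr u' \<noteq> y"
    using uvw by (metis sum.inject(2))
  then have "tends (\<lambda>n. f n (Inr u')) x"
    using lim[of "Inr u'" "\<lambda>n. n"] by (simp add: strict_mono_def)
  then obtain a where a: "x = Inr a"
    using closed_M[of "\<lambda>n. g (r n) u'" x] xy by (auto simp: f_def)
  have "\<exists>b. y = Inr b"
  proof (cases y)
    \<comment> \<open>If \<open>y\<close> were a group point, all of \<open>M\<close> would be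
      uniformly far from it, including the preimages of any \<open>c\<close> under the sequence.
      Their images are constantly \<open>c\<close>, forcing \<open>c = a\<close>.\<close>
    case (Inl h)
    obtain c where c: "c \<noteq> a"
      using avoid2 by metis
    have "h \<in> \<Gamma>"
      using xy Inl by auto
    then obtain e where e: "e > 0" "\<And>x. d (Inr x) (Inl h) \<ge> e"
      using group_point_isolated by blast
    have "tends (\<lambda>n. f n (Inr (ginv (g (r n)) c))) x"
      using conv'[of "\<lambda>n. n" "\<lambda>n. Inr (ginv (g (r n)) c)" e] e Inl by (auto simp: strict_mono_def)
    then have "tends (\<lambda>n. Inr c) (Inr a)"
      using assms by (simp add: f_def a)
    then have "Inr c = (Inr a :: ('m \<Rightarrow> 'm) + 'm)"
      by (intro tends_unique[of "\<lambda>_. Inr c" "Inr c" "Inr a"] tends_const) auto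
    with c show ?thesis by simp
  qed auto
  then obtain b where b: "y = Inr b" ..
  have "conv (\<lambda>n. g (r n)) a b"
    by (rule conv_seqI) (use conv' assms in \<open>auto simp: f_def a b\<close>)
  with xy(3) that show thesis by blast
qed

lemma loc_unif_tendsto:
  assumes "loc_unif_to_const euclidean g b a" "x \<noteq> b"
  shows "(\<lambda>n. g n x) \<longlonglongrightarrow> a"
proof -
  have "x \<in> topspace euclidean - {b}"
    using assms(2) by simp
  from bspec[OF assms(1)[unfolded loc_unif_to_const_def] this]
  obtain W where W: "x \<in> W"
    "\<forall>U. open U \<and> a \<in> U \<longrightarrow> (\<forall>\<^sub>F n in sequentially. g n ` (W - {b}) \<subseteq> U)"
    by auto
  show ?thesis
  proof (rule topological_tendstoI)
    fix U assume "open U" "a \<in> U"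
    with W(2) have "\<forall>\<^sub>F n in sequentially. g n ` (W - {b}) \<subseteq> U"
      by blast
    then show "\<forall>\<^sub>F n in sequentially. g n x \<in> U"
      by eventually_elim (use W(1) assms(2) in auto)
  qed
qed

lemma conv_limit_set_conv:
  assumes "loc_unif_to_const euclidean g b a" "conv (\<lambda>n. g (r n)) a' b'" "strict_mono (r :: nat \<Rightarrow> nat)"
  shows "a' = a"
proof -
  obtain x where x: "x \<noteq> b" "x \<noteq> b'"
    using avoid2 by metis
  then have "(\<lambda>n. g n x) \<longlonglongrightarrow> a"
    using assms(1) by (intro loc_unif_tendsto)
  then have "(\<lambda>n. g (r n) x) \<longlonglongrightarrow> a"
    using LIMSEQ_subseq_LIMSEQ[OF _ assms(3)] by (auto simp: o_def)
  moreover have "(\<lambda>n. g (r n) x) \<longlonglongrightarrow> a'"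
    using conv_tends_Inr[OF assms(2) x(2)] by (simp add: tends_Inr_iff)
  ultimately show ?thesis
    using LIMSEQ_unique by blast
qed

text \<open>The definition of the limit set allows repeated elements. A constant subsequence is
  impossible, since a bijection cannot send every point other than \<open>b\<close> to
  \<open>a\<close>; hence a subsequence is injective and \<open>conv_extract\<close>
  applies.\<close>

lemma limit_set_conv:
  assumes "a \<in> limit_set \<Gamma>"
  obtains g b where "inj g" "conv g a b"
proof -
  obtain b and g :: "nat \<Rightarrow> 'm \<Rightarrow> 'm" where g: "range g \<subseteq> \<Gamma>" "loc_unif_to_const euclidean g b a"
    using assms by (auto simp: limit_set_def)
  have "infinite (range g)"
  proof
    assume "finite (range g)"
    then obtain r c where r: "strict_mono (r :: nat \<Rightarrow> nat)" "\<And>n. g (r n) = c"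
      using finite_range_constant_subseq by blast
    have c: "c \<in> \<Gamma>"
      using g r by (metis rangeI subset_iff)
    have "c x = a" if x: "x \<noteq> b" for x
    proof -
      have "(\<lambda>n. g n x) \<longlonglongrightarrow> a"
        using g(2) x by (rule loc_unif_tendsto)
      then have "(\<lambda>n. g (r n) x) \<longlonglongrightarrow> a"
        using LIMSEQ_subseq_LIMSEQ[OF _ r(1)] by (auto simp: o_def)
      then show ?thesis
        using LIMSEQ_unique tendsto_const by (simp add: r(2)) blast
    qed
    moreover obtain u where u: "u \<noteq> b" by (metis avoid2)
    moreover obtain v where "v \<noteq> b" "v \<noteq> u" by (metis avoid2)
    ultimately show False
      using c by (metis eq_iff_\<Gamma>)
  qed
  then obtain r where r: "strict_mono (r :: nat \<Rightarrow> nat)" "inj (\<lambda>n. g (r n))"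
    by (rule infinite_range_inj_subseq)
  have "g (r n) \<in> \<Gamma>" for n
    using g(1) by auto
  then obtain q a' b' where q: "strict_mono (q :: nat \<Rightarrow> nat)" "conv (\<lambda>n. g (r (q n))) a' b'"
    using conv_extract[OF r(2)] by blast
  have "a' = a"
    using conv_limit_set_conv[OF g(2), of "r \<circ> q" a' b'] q strict_mono_o[OF r(1) q(1)] by (simp add: o_def)
  moreover have "inj (\<lambda>n. g (r (q n)))"
    using r(2) q(1) by (auto simp: inj_def dest: strict_mono_eq)
  ultimately show thesis
    using that q(2) by blast
qed

lemma conv_loc_unif:
  assumes "conv g a b"
  shows "loc_unif_to_const euclidean g b a"
  unfolding loc_unif_to_const_def
proof (intro ballI)
  fix z assume "z \<in> topspace euclidean - {b}"
  then have "Inr z \<noteq> (Inr b :: ('m \<Rightarrow> 'm) + 'm)" by simp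
  then have pos: "d (Inr z) (Inr b) > 0"
    by (simp add: T.mdist_pos_eq)
  define W where "W = {y. d (Inr y) (Inr b) > d (Inr z) (Inr b) / 2}"
  have "\<forall>\<^sub>F n in sequentially. g n ` (W - {b}) \<subseteq> U" if "open U" "a \<in> U" for U
  proof -
    obtain e where e: "e > 0" "\<And>y. d (Inr y) (Inr a) < e \<Longrightarrow> y \<in> U"
      using open_nhd \<open>open U\<close> \<open>a \<in> U\<close> by blast
    have "min e (d (Inr z) (Inr b) / 2) > 0"
      using e pos by simp
    from convD[OF assms this] show ?thesis
    proof eventually_elim
      case (elim n)
      have "g n y \<in> U" if "y \<in> W" for y
        using elim[rule_format, of "Inr y"] that by (intro e(2)) (auto simp: W_def)
      then show ?case by blast
    qed
  qed
  moreover have "open W" "z \<in> W"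
    using pos open_dist_gt[of "Inr b" "d (Inr z) (Inr b) / 2"] by (auto simp: W_def)
  ultimately show "\<exists>W. openin euclidean W \<and> z \<in> W \<and>
      (\<forall>U. openin euclidean U \<and> a \<in> U \<longrightarrow> (\<forall>\<^sub>F n in sequentially. g n ` (W - {b}) \<subseteq> U))"
    by (intro exI[of _ W]) simp
qed

lemma conv_in_limit_set: "conv g a b \<Longrightarrow> a \<in> limit_set \<Gamma>"
  unfolding limit_set_def using conv_loc_unif[of g a b] by (auto simp: conv_def)

lemma dist_Inr_pos: "d (Inr a) (Inr b) > 0 \<longleftrightarrow> a \<noteq> b"
  by (simp add: T.mdist_pos_eq)

section \<open>Loxodromic elements and fixed points\<close>

lemma conv_tends_Inl_comp: "conv g a b \<Longrightarrow> h \<in> \<Gamma> \<Longrightarrow> tends (\<lambda>n. Inl (g n \<circ> h)) (Inr a)"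
  using conv_tends[of g a b "\<lambda>_. Inl h" "Inl h"] by (simp add: tends_const)

text \<open>The group points \<open>f \<circ> h n\<close> converge to \<open>f x\<close> by
  continuity of \<open>f\<close>, and, rewritten as \<open>h n \<circ> f\<close>, to
  \<open>x\<close>, since \<open>h n\<close> attracts every group point.\<close>

lemma conv_commute_fixed:
  assumes "conv h x y" "f \<in> \<Gamma>" "\<And>n. f \<circ> h n = h n \<circ> f"
  shows "f x = x"
proof -
  have h: "h n \<in> \<Gamma>" for n
    using conv_in[OF assms(1)] .
  have "tends (\<lambda>n. act f (Inl (h n))) (act f (Inr x))"
    using assms h by (intro tends_act conv_tends_Inl) auto
  then have "tends (\<lambda>n. Inl (h n \<circ> f)) (Inr (f x))"
    by (simp add: assms(3))
  moreover have "tends (\<lambda>n. Inl (h n \<circ> f)) (Inr x)"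
    using assms by (intro conv_tends_Inl_comp)
  ultimately have "Inr (f x) = (Inr x :: ('m \<Rightarrow> 'm) + 'm)"
    using assms h by (intro tends_unique[of "\<lambda>n. Inl (h n \<circ> f)"]) auto
  then show ?thesis by simp
qed

lemma funpow_ginv: "f \<in> \<Gamma> \<Longrightarrow> ginv f ^^ n = ginv (f ^^ n)"
proof (induction n)
  case (Suc n)
  then have "ginv f ^^ Suc n = ginv (f ^^ n) \<circ> ginv f"
    by (simp add: funpow_Suc_right del: funpow.simps)
  also have "\<dots> = ginv (f ^^ Suc n)"
    using Suc.prems by (simp add: ginv_o)
  finally show ?case .
qed (simp add: inv_id)

lemma funpow_fixed: "f x = x \<Longrightarrow> (f ^^ n) x = x"
  by (induction n) auto

lemma ginv_fixed: "f \<in> \<Gamma> \<Longrightarrow> f x = x \<Longrightarrow> ginv f x = x"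
  by (metis ginv_app(1))

text \<open>The point \<^term>\<open>Inl id\<close> of the compactification serves as a base point off the two balls;
  it shows that the powers of \<^term>\<open>f\<close> are distinct.\<close>

lemma contracting_imp_conv_funpow:
  assumes f: "f \<in> \<Gamma>" and r: "r > 0" "2 * r < d (Inr a) (Inr b)"
    and base: "r \<le> d (Inl id) (Inr a)" "r \<le> d (Inl id) (Inr b)"
    and contract: "\<And>t. t \<in> T \<Longrightarrow> r \<le> d t (Inr b) \<Longrightarrow> d (act f t) (Inr a) < r"
  obtains p q where "p \<noteq> q" "d (Inr p) (Inr a) \<le> r" "d (Inr q) (Inr b) \<le> r"
    "f p = p" "f q = q" "conv (\<lambda>k. f ^^ k) p q"
proof -
  have away: "r \<le> d t (Inr b)" if "t \<in> T" "d t (Inr a) \<le> r" for t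
    using T.triangle[of "Inr a" t "Inr b"] T.commute[of t "Inr a"] that r by simp
  have pow: "d (act (f ^^ Suc k) t) (Inr a) < r" if t: "t \<in> T" "r \<le> d t (Inr b)" for k t
  proof (induction k)
    case 0
    then show ?case using contract[OF t] by simp
  next
    case (Suc k)
    have "act (f ^^ Suc k) t \<in> T"
      using f t by blast
    moreover have "act (f ^^ Suc (Suc k)) t = act f (act (f ^^ Suc k) t)"
      by (metis act_comp funpow.simps(2))
    ultimately show ?case
      using contract away Suc by (metis less_imp_le)
  qed
  have inv_pow: "d (act (ginv (f ^^ Suc k)) t) (Inr b) < r" if t: "t \<in> T" "r \<le> d t (Inr a)" for k t
  proof (rule ccontr)
    assume "\<not> ?thesis"
    then have "d (act (f ^^ Suc k) (act (ginv (f ^^ Suc k)) t)) (Inr a) < r"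
      using f t by (intro pow) (auto simp del: funpow.simps)
    moreover have "act (f ^^ Suc k) (act (ginv (f ^^ Suc k)) t) = t"
      using f by (intro act_ginv(2)) blast
    ultimately show False
      using t by simp
  qed
  have inj: "inj (\<lambda>k. f ^^ k)"
  proof (rule linorder_injI)
    fix i j :: nat assume "i < j"
    then obtain k where k: "j = i + Suc k"
      using less_imp_Suc_add by auto
    show "f ^^ i \<noteq> f ^^ j"
    proof
      assume "f ^^ i = f ^^ j"
      then have "(f ^^ i) x = (f ^^ i) ((f ^^ Suc k) x)" for x
        unfolding k funpow_add by (metis comp_apply)
      then have "f ^^ Suc k = id"
        using f by (metis eq_iff_\<Gamma> eq_id_iff pow_in)
      then show False
        using pow[of "Inl id" k] base by (simp del: funpow.simps)
    qed
  qed
  \<comment> \<open>Limit points of the powers and of their inverses are fixed because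
    \<open>f\<close> commutes with both; they stay in the closed balls because the images of
    \<open>Inl id\<close> do.\<close>
  have lim: "d (Inr x) (Inr a) \<le> r \<and> d (Inr y) (Inr b) \<le> r \<and> f x = x \<and> f y = y"
    if k: "strict_mono (k :: nat \<Rightarrow> nat)" "conv (\<lambda>n. f ^^ k n) x y" for k x y
  proof (intro conjI)
    \<comment> \<open>The index 0 is left out because \<open>k 0\<close> may be 0, and for the
      identity the ball estimates can fail.\<close>
    have "\<exists>i. k n = Suc i" if "n \<ge> 1" for n
      using seq_suble[OF k(1), of n] that by (metis Suc_le_D One_nat_def order.trans)
    then have ev: "\<forall>n\<ge>1. d (Inl (f ^^ k n)) (Inr a) \<le> r" "\<forall>n\<ge>1. d (Inl (ginv (f ^^ k n))) (Inr b) \<le> r"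
      using pow[of "Inl id"] inv_pow[of "Inl id"] base
      by (metis Inl_in act_Inl comp_id id_in less_imp_le)+
    have "(\<lambda>n. d (Inl (f ^^ k n)) (Inr a)) \<longlonglongrightarrow> d (Inr x) (Inr a)"
      using f by (intro tends_dist conv_tends_Inl[OF k(2)] tends_const) auto
    then show "d (Inr x) (Inr a) \<le> r"
      by (rule LIMSEQ_le_const2) (use ev in blast)
    have "(\<lambda>n. d (Inl (ginv (f ^^ k n))) (Inr b)) \<longlonglongrightarrow> d (Inr y) (Inr b)"
      using f by (intro tends_dist conv_tends_Inl[OF conv_ginv[OF k(2)]] tends_const) auto
    then show "d (Inr y) (Inr b) \<le> r"
      by (rule LIMSEQ_le_const2) (use ev in blast)
    have comm: "f \<circ> f ^^ i = f ^^ i \<circ> f" for i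
      by (metis funpow.simps(2) funpow_Suc_right)
    show "f x = x"
      using conv_commute_fixed[OF k(2) f comm] .
    have "f \<circ> ginv (f ^^ i) = ginv (f ^^ i) \<circ> f" for i
    proof -
      have fi: "f ^^ i \<in> \<Gamma>"
        using f by blast
      have "(f ^^ i) (f (ginv (f ^^ i) x)) = f ((f ^^ i) (ginv (f ^^ i) x))" for x
        using fun_cong[OF comm, of i "ginv (f ^^ i) x"] by simp
      then have "(f ^^ i) (f (ginv (f ^^ i) x)) = (f ^^ i) (ginv (f ^^ i) (f x))" for x
        using fi by simp
      then show ?thesis
        unfolding eq_iff_\<Gamma>[OF fi] by (simp add: fun_eq_iff)
    qed
    then show "f y = y"
      using conv_commute_fixed[OF conv_ginv[OF k(2)] f] by blast
  qed
  have far: "p \<noteq> q" if "d (Inr p) (Inr a) \<le> r" "d (Inr q) (Inr b) \<le> r" for p q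
    using that r T.triangle[of "Inr a" "Inr p" "Inr b"] T.commute[of "Inr a" "Inr p"] by auto
  obtain k x y where k: "strict_mono (k :: nat \<Rightarrow> nat)" "conv (\<lambda>n. f ^^ k n) x y"
    using conv_extract[OF inj] f by blast
  note xy = lim[OF k]
  \<comment> \<open>The fixed point \<open>x\<close> is not the repelling point \<open>y'\<close>,
    so the constant sequence of its images converges to \<open>x'\<close>; likewise for
    \<open>y\<close> under the inverses.\<close>
  have uniq: "x' = x \<and> y' = y" if k': "strict_mono (k' :: nat \<Rightarrow> nat)" "conv (\<lambda>n. f ^^ k' n) x' y'" for k' x' y'
  proof -
    note xy' = lim[OF k']
    have "tends (\<lambda>n. Inr ((f ^^ k' n) x)) (Inr x')"
      using far xy xy' by (intro conv_tends_Inr[OF k'(2)]) blast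
    moreover have "tends (\<lambda>n. Inr (ginv (f ^^ k' n) y)) (Inr y')"
      using far xy xy' by (intro conv_tends_Inr[OF conv_ginv[OF k'(2)]]) blast
    ultimately show ?thesis
      using xy f by (simp add: funpow_fixed ginv_fixed tends_Inr_iff LIMSEQ_const_iff)
  qed
  \<comment> \<open>Every subsequence of the powers has a further subsequence with the limit pair
    \<open>x\<close>, \<open>y\<close>, so the full sequence converges.\<close>
  have "conv (\<lambda>k. f ^^ k) x y"
  proof (rule conv_seqI)
    show "f ^^ n \<in> \<Gamma>" for n using f by blast
    fix e k' and t :: "nat \<Rightarrow> _" assume *: "e > (0 :: real)" "strict_mono (k' :: nat \<Rightarrow> nat)" "\<And>n. t n \<in> T"
      "\<And>n. d (t n) (Inr y) \<ge> e"
    show "tends (\<lambda>n. act (f ^^ k' n) (t n)) (Inr x)"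
    proof (rule ccontr)
      assume "\<not> ?thesis"
      then obtain e' where e': "e' > 0" "\<not> (\<forall>\<^sub>F n in sequentially. d (act (f ^^ k' n) (t n)) (Inr x) < e')"
        using tends_I[of "\<lambda>n. act (f ^^ k' n) (t n)" "Inr x"] by auto
      then obtain p :: "nat \<Rightarrow> nat" where
        p: "strict_mono p" "\<And>n. \<not> d (act (f ^^ k' (p n)) (t (p n))) (Inr x) < e'"
        using not_eventually_sequentiallyD[OF e'(2)] by auto
      have "inj (\<lambda>n. f ^^ k' (p n))"
        using inj_compose[OF inj inj_compose[OF strict_mono_imp_inj_on[OF *(2)] strict_mono_imp_inj_on[OF p(1)]]]
        by (simp add: o_def)
      then obtain p' x' y' where p': "strict_mono (p' :: nat \<Rightarrow> nat)"
        "conv (\<lambda>n. f ^^ k' (p (p' n))) x' y'"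
        using conv_extract[of "\<lambda>n. f ^^ k' (p n)"] f by blast
      have "strict_mono (\<lambda>n. k' (p (p' n)))"
        using *(2) p(1) p'(1) by (simp add: strict_mono_def)
      from uniq[OF this p'(2)] p'(2) have "conv (\<lambda>n. f ^^ k' (p (p' n))) x y"
        by simp
      then have "tends (\<lambda>n. act (f ^^ k' (p (p' n))) (t (p (p' n)))) (Inr x)"
        by (rule conv_seqD) (use * in auto)
      from tends_D[OF this e'(1)] p(2) show False
        by simp
    qed
  qed
  with that xy far show thesis by blast
qed

lemma conv_imp_eventually_conv_funpow:
  assumes "conv g a b" "a \<noteq> b" "e > 0"
  shows "\<forall>\<^sub>F n in sequentially. \<exists>p q. p \<noteq> q \<and> d (Inr p) (Inr a) \<le> e \<and> d (Inr q) (Inr b) \<le> e \<and>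
    g n p = p \<and> g n q = q \<and> conv (\<lambda>k. g n ^^ k) p q"
proof -
  \<comment> \<open>A third of the distance makes the two balls disjoint; the last two bounds keep
    the base point \<open>Inl id\<close> outside them.\<close>
  define r where "r = min e (min (d (Inr a) (Inr b) / 3) (min (d (Inl id) (Inr a)) (d (Inl id) (Inr b))))"
  have "d (Inr a) (Inr b) > 0" "d (Inl id) (Inr a) > 0" "d (Inl id) (Inr b) > 0"
    using assms by (simp_all add: T.mdist_pos_eq)
  then have r: "r > 0" "2 * r < d (Inr a) (Inr b)" "r \<le> d (Inl id) (Inr a)" "r \<le> d (Inl id) (Inr b)" "r \<le> e"
    using assms(3) unfolding r_def by linarith+
  from convD[OF assms(1) r(1)] show ?thesis
  proof eventually_elim
    case (elim n)
    show ?case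
      by (rule contracting_imp_conv_funpow[OF conv_in[OF assms(1), of n] r(1-4)])
        (use elim r(5) in \<open>auto intro: order.trans\<close>)
  qed
qed

lemma conv_funpow_loxodromic:
  assumes "f \<in> \<Gamma>" "p \<noteq> q" "f p = p" "f q = q" "conv (\<lambda>k. f ^^ k) p q"
  shows "loxodromic_with \<Gamma> f p q"
proof -
  have "conv (\<lambda>k. ginv f ^^ k) q p"
    using conv_ginv[OF assms(5)] assms(1) by (simp add: funpow_ginv)
  with assms show ?thesis
    unfolding loxodromic_with_def by (auto simp: m_inv_eq conv_loc_unif dest: conv_in_limit_set)
qed

text \<open>A global fixed point does not move, so it must be the repelling point of every sequence
  attracted to another point. The powers of a late term of a sequence attracted to \<open>x\<close>
  inherit this.\<close>

lemma conv_funpow_at_fixed_point: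
  assumes fixed: "\<And>f. f \<in> \<Gamma> \<Longrightarrow> f p = p" and x: "x \<in> limit_set \<Gamma>" "x \<noteq> p" and "e > 0"
  obtains g A where "g \<in> \<Gamma>" "conv (\<lambda>k. g ^^ k) A p" "d (Inr A) (Inr x) \<le> e" "A \<noteq> p" "g A = A"
proof -
  obtain g b where g: "conv g x b"
    using limit_set_conv[OF x(1)] .
  have eq: "b = p" if "conv h y b" "y \<noteq> p" for h y b
  proof (rule ccontr)
    assume "b \<noteq> p"
    then have "tends (\<lambda>n. Inr (h n p)) (Inr y)"
      using that by (intro conv_tends_Inr) auto
    then show False
      using fixed[OF conv_in[OF that(1)]] that(2) by (simp add: tends_Inr_iff LIMSEQ_const_iff)
  qed
  have "b = p"
    using eq g x by blast
  define e' where "e' = min e (d (Inr x) (Inr p) / 2)"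
  have e': "e' > 0" "e' < d (Inr x) (Inr p)"
    using \<open>e > 0\<close> x by (auto simp: e'_def T.mdist_pos_eq min_less_iff_disj)
  obtain n A q where A: "d (Inr A) (Inr x) \<le> e'" "conv (\<lambda>k. g n ^^ k) A q" "g n A = A"
    using eventually_happens[OF conv_imp_eventually_conv_funpow[OF g _ e'(1)]] x \<open>b = p\<close> by auto
  have "A \<noteq> p"
    using A(1) e'(2) T.commute[of "Inr p" "Inr x"] by auto
  moreover have "q = p"
    using eq[OF A(2)] \<open>A \<noteq> p\<close> .
  ultimately show thesis
    using that[of "g n" A] A conv_in[OF g] by (simp add: e'_def)
qed

text \<open>Two loxodromic elements \<^term>\<open>g\<close>, \<^term>\<open>h\<close> with a common repelling fixed point \<open>p\<close> and distinct
  attracting ones contradict discreteness: with the first exit time \<open>m\<^sub>n\<close> of the \<open>h\<close>-orbit of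
  \<open>g\<^sup>-\<^sup>n\<close> from a ball at \<open>p\<close>, the elements \<open>h^m\<^sub>n \<circ> g\<^sup>-\<^sup>n\<close> keep three points apart.\<close>

lemma no_global_fixed_point: "\<exists>f\<in>\<Gamma>. f p \<noteq> p"
proof (rule ccontr)
  assume "\<not> ?thesis"
  then have fixed: "f p = p" if "f \<in> \<Gamma>" for f
    using that by blast
  obtain x where x: "x \<in> limit_set \<Gamma>" "x \<noteq> p" by (metis avoid2)
  obtain x' where x': "x' \<in> limit_set \<Gamma>" "x' \<noteq> p" "x' \<noteq> x" by (metis avoid2)
  define e where "e = d (Inr x) (Inr x') / 3"
  have e: "e > 0"
    using x' by (simp add: e_def T.mdist_pos_eq)
  obtain g A where g: "g \<in> \<Gamma>" "conv (\<lambda>k. g ^^ k) A p" "d (Inr A) (Inr x) \<le> e" "A \<noteq> p" "g A = A"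
    by (rule conv_funpow_at_fixed_point[of p]) (use fixed x e in auto)
  obtain h A' where h: "h \<in> \<Gamma>" "conv (\<lambda>k. h ^^ k) A' p" "d (Inr A') (Inr x') \<le> e" "A' \<noteq> p" "h A' = A'"
    by (rule conv_funpow_at_fixed_point[of p]) (use fixed x' e in auto)
  have "A \<noteq> A'"
  proof
    assume "A = A'"
    then have "d (Inr x) (Inr x') \<le> e + e"
      using g(3) h(3) T.triangle[of "Inr x" "Inr A" "Inr x'"] T.commute[of "Inr x" "Inr A"] by simp
    then show False
      using e unfolding e_def by linarith
  qed
  define r where "r = d (Inr A') (Inr p) / 2"
  have r: "r > 0" "d (Inr A') (Inr p) = 2 * r"
    using h by (auto simp: r_def T.mdist_pos_eq)
  define \<psi> where "\<psi> = (\<lambda>m n. h ^^ m \<circ> ginv (g ^^ n))"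
  have \<psi>_in: "\<psi> m n \<in> \<Gamma>" for m n
    using g h by (auto simp: \<psi>_def)
  have ex: "\<exists>m. d (Inl (\<psi> m n)) (Inr p) \<ge> r" for n
  proof -
    have "tends (\<lambda>m. Inl (h ^^ m \<circ> ginv (g ^^ n))) (Inr A')"
      using g by (intro conv_tends_Inl_comp[OF h(2)]) auto
    then have "(\<lambda>m. d (Inl (\<psi> m n)) (Inr p)) \<longlonglongrightarrow> d (Inr A') (Inr p)"
      using \<psi>_in by (intro tends_dist tends_const) (auto simp: \<psi>_def)
    then have "\<forall>\<^sub>F m in sequentially. d (Inl (\<psi> m n)) (Inr p) > r"
      using r by (intro order_tendstoD) auto
    from eventually_happens[OF this] show ?thesis
      by (auto intro: less_imp_le)
  qed
  define m where "m = (\<lambda>n. LEAST m. d (Inl (\<psi> m n)) (Inr p) \<ge> r)"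
  have m: "d (Inl (\<psi> (m n) n)) (Inr p) \<ge> r" for n
    unfolding m_def using LeastI_ex[OF ex] .
  have m_less: "d (Inl (\<psi> k n)) (Inr p) < r" if "k < m n" for k n
    using not_less_Least[OF that[unfolded m_def]] by simp
  have small: "\<forall>\<^sub>F n in sequentially. d (Inl (\<psi> k n)) (Inr p) < r" for k
  proof -
    have "tends (\<lambda>n. act (h ^^ k) (Inl (ginv (g ^^ n)))) (act (h ^^ k) (Inr p))"
      using g h by (intro tends_act conv_tends_Inl[OF conv_ginv[OF g(2)]]) auto
    moreover have "(h ^^ k) p = p"
      using fixed h by blast
    ultimately have "tends (\<lambda>n. Inl (\<psi> k n)) (Inr p)"
      by (simp add: \<psi>_def)
    then show ?thesis
      using tends_D r by blast
  qed
  \<comment> \<open>For fixed \<open>k\<close>, the power \<open>h ^^ k\<close> fixes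
    \<open>p\<close> and the inverse powers of \<open>g\<close> tend to \<open>p\<close>, so exit at
    time \<open>k\<close> happens only for finitely many \<open>n\<close>.\<close>
  have m_top: "filterlim m at_top sequentially"
    unfolding filterlim_at_top
  proof (rule allI)
    fix K
    have "\<forall>\<^sub>F n in sequentially. \<forall>k\<in>{..K}. d (Inl (\<psi> k n)) (Inr p) < r"
      using small by (intro eventually_ball_finite) auto
    then show "\<forall>\<^sub>F n in sequentially. K \<le> m n"
      by eventually_elim (use m in \<open>meson atMost_iff linorder_not_less nle_le\<close>)
  qed
  define \<phi> where "\<phi> = (\<lambda>n. \<psi> (m n) n)"
  have \<phi>_in: "\<phi> n \<in> \<Gamma>" for n
    by (simp add: \<phi>_def \<psi>_in)
  have lim_A: "tends (\<lambda>n. Inr (\<phi> n A)) (Inr A')"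
  proof -
    have "tends (\<lambda>k. Inr ((h ^^ k) A)) (Inr A')"
      using h g by (intro conv_tends_Inr[OF h(2)]) auto
    then have "(\<lambda>n. (h ^^ m n) A) \<longlonglongrightarrow> A'"
      using m_top unfolding tends_Inr_iff by (rule filterlim_compose)
    moreover have "\<phi> n A = (h ^^ m n) A" for n
      using g by (simp add: \<phi>_def \<psi>_def ginv_fixed funpow_fixed)
    ultimately show ?thesis
      by (simp add: tends_Inr_iff)
  qed
  \<comment> \<open>One step before the exit the point is within \<open>r\<close> of
    \<open>p\<close>, hence its limit \<open>w\<close> is not \<open>A'\<close>, which lies at
    distance \<open>2 * r\<close>. Applying \<open>h\<close>, which fixes \<open>A'\<close>, gives a
    limit \<open>z\<close> that is neither \<open>A'\<close> nor \<open>p\<close>.\<close>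
  obtain w q where q: "w \<in> T" "strict_mono (q :: nat \<Rightarrow> nat)" "tends (\<lambda>n. Inl (\<psi> (m (q n) - 1) (q n))) w"
    using seq_compact_T[of "\<lambda>n. Inl (\<psi> (m n - 1) n)"] \<psi>_in by auto
  have m_pos: "\<forall>\<^sub>F n in sequentially. m (q n) > 0"
    using eventually_subseq[OF q(2)] m_top[unfolded filterlim_at_top, rule_format, of 1]
    by (auto simp: Suc_le_eq)
  have "(\<lambda>n. d (Inl (\<psi> (m (q n) - 1) (q n))) (Inr p)) \<longlonglongrightarrow> d w (Inr p)"
    using q \<psi>_in by (intro tends_dist tends_const) auto
  moreover have "\<forall>\<^sub>F n in sequentially. d (Inl (\<psi> (m (q n) - 1) (q n))) (Inr p) \<le> r"
    using m_pos by eventually_elim (auto intro!: less_imp_le m_less)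
  ultimately have "d w (Inr p) \<le> r"
    by (rule tendsto_upperbound) simp
  then have "w \<noteq> Inr A'"
    using r by auto
  define z where "z = act h w"
  have "z \<in> T"
    using q h by (auto simp: z_def)
  have "z \<noteq> Inr A'"
  proof
    assume "z = Inr A'"
    then have "act (ginv h) (act h w) = act (ginv h) (Inr A')"
      by (simp add: z_def)
    then show False
      using \<open>w \<noteq> Inr A'\<close> h by (simp add: ginv_fixed)
  qed
  have lim_z: "tends (\<lambda>n. Inl (\<phi> (q n))) z"
  proof -
    have "tends (\<lambda>n. act h (Inl (\<psi> (m (q n) - 1) (q n)))) (act h w)"
      using q \<psi>_in h by (intro tends_act) auto
    moreover have "\<forall>\<^sub>F n in sequentially. act h (Inl (\<psi> (m (q n) - 1) (q n))) = Inl (\<phi> (q n))"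
      using m_pos
    proof eventually_elim
      case (elim n)
      then obtain k where "m (q n) = Suc k"
        using gr0_implies_Suc by blast
      then show ?case
        by (simp add: \<phi>_def \<psi>_def o_assoc)
    qed
    ultimately show ?thesis
      unfolding tends_def z_def by (elim Lim_transform_eventually) (auto elim: eventually_mono)
  qed
  have "d z (Inr p) \<ge> r"
  proof (rule tendsto_lowerbound)
    show "(\<lambda>n. d (Inl (\<phi> (q n))) (Inr p)) \<longlonglongrightarrow> d z (Inr p)"
      using \<open>z \<in> T\<close> \<phi>_in by (intro tends_dist lim_z tends_const) auto
  qed (use m in \<open>auto simp: \<phi>_def\<close>)
  then have "z \<noteq> Inr p"
    using r by auto
  \<comment> \<open>Along \<open>q\<close> the elements \<open>\<phi>\<close> fix \<open>p\<close>,
    send \<open>A\<close> towards \<open>A'\<close> and the base point towards \<open>z\<close>. A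
    convergent subsequence must be repelled from \<open>p\<close> and attracted to \<open>z\<close>,
    but then \<open>A\<close> would tend to \<open>z\<close>; a repeated element would send
    \<open>A\<close> exactly to \<open>A'\<close>, already the image of \<open>A'\<close>.\<close>
  show False
  proof (cases "finite (range (\<lambda>n. \<phi> (q n)))")
    case True
    then obtain s c where s: "strict_mono (s :: nat \<Rightarrow> nat)" "\<And>n. \<phi> (q (s n)) = c"
      using finite_range_constant_subseq by blast
    have "tends (\<lambda>n. Inr (\<phi> (q (s n)) A)) (Inr A')"
      using tends_subseq[OF lim_A strict_mono_o[OF q(2) s(1)]] by (simp add: o_def)
    then have "\<phi> (q (s 0)) A = A'"
      by (simp add: s tends_Inr_iff LIMSEQ_const_iff)
    then have "(h ^^ m (q (s 0))) A = (h ^^ m (q (s 0))) A'"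
      using g h by (simp add: \<phi>_def \<psi>_def ginv_fixed funpow_fixed)
    then show False
      using \<open>A \<noteq> A'\<close> h by simp
  next
    case False
    then obtain s where s: "strict_mono (s :: nat \<Rightarrow> nat)" "inj (\<lambda>n. \<phi> (q (s n)))"
      by (rule infinite_range_inj_subseq)
    then obtain s' a b where s': "strict_mono (s' :: nat \<Rightarrow> nat)" "conv (\<lambda>n. \<phi> (q (s (s' n)))) a b"
      using conv_extract[of "\<lambda>n. \<phi> (q (s n))"] \<phi>_in by blast
    have sm: "strict_mono (\<lambda>n. s (s' n))" "strict_mono (\<lambda>n. q (s (s' n)))"
      using q(2) s(1) s'(1) by (simp_all add: strict_mono_def)
    have "tends (\<lambda>n. Inl (\<phi> (q (s (s' n))))) z"
      using tends_subseq[OF lim_z sm(1)] .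
    then have "Inr a = z"
      using conv_tends_Inl[OF s'(2)] \<open>z \<in> T\<close> \<phi>_in tends_unique by (metis Inl_in Inr_in)
    have "b = p"
    proof (rule ccontr)
      assume "b \<noteq> p"
      then have "tends (\<lambda>n. Inr (\<phi> (q (s (s' n))) p)) (Inr a)"
        by (intro conv_tends_Inr[OF s'(2)]) auto
      then show False
        using \<open>Inr a = z\<close>[symmetric] \<open>z \<noteq> Inr p\<close> fixed[OF \<phi>_in]
        by (auto simp: tends_Inr_iff LIMSEQ_const_iff)
    qed
    then have "tends (\<lambda>n. Inr (\<phi> (q (s (s' n))) A)) (Inr a)"
      using g by (intro conv_tends_Inr[OF s'(2)]) auto
    moreover have "tends (\<lambda>n. Inr (\<phi> (q (s (s' n))) A)) (Inr A')"
      using tends_subseq[OF lim_A sm(2)] .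
    ultimately have "a = A'"
      unfolding tends_Inr_iff by (rule LIMSEQ_unique)
    then show False
      using \<open>Inr a = z\<close> \<open>z \<noteq> Inr A'\<close> by simp
  qed
qed

text \<open>First move \<open>a\<close> off the repelling point of a sequence attracted to a limit
  point outside \<open>{b, c}\<close>; that sequence then carries it out of
  \<open>{b, c}\<close>.\<close>

lemma orbit_avoid: "\<exists>f\<in>\<Gamma>. f a \<noteq> b \<and> f a \<noteq> c"
proof (rule ccontr)
  assume "\<not> ?thesis"
  then have orb: "f a = b \<or> f a = c" if "f \<in> \<Gamma>" for f
    using that by blast
  obtain x where x: "x \<in> limit_set \<Gamma>" "x \<noteq> b" "x \<noteq> c" by (metis avoid2)
  obtain g y where g: "conv g x y"
    using limit_set_conv[OF x(1)] .
  obtain h where h: "h \<in> \<Gamma>" "h a \<noteq> y"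
    using no_global_fixed_point[of a] by (metis id_in id_apply)
  have "(\<lambda>n. g n (h a)) \<longlonglongrightarrow> x"
    using conv_tends_Inr[OF g h(2)] by (simp add: tends_Inr_iff)
  moreover have "open (- {b, c})" "x \<in> - {b, c}"
    using x by auto
  ultimately have "\<forall>\<^sub>F n in sequentially. g n (h a) \<in> - {b, c}"
    by (rule topological_tendstoD)
  from eventually_happens[OF this] obtain n where "g n (h a) \<notin> {b, c}"
    by auto
  then show False
    using orb[of "g n \<circ> h"] conv_in[OF g] h by auto
qed

text \<open>By compactness finitely many of the open sets of non-fixed points cover
  \<open>M\<close>, which settles \<open>b = c\<close>; the identity settles
  \<open>b \<noteq> c\<close>.\<close>

lemma finite_no_common_fixed:
  obtains F where "finite F" "F \<subseteq> \<Gamma>" "id \<in> F" "\<And>b c. \<exists>f\<in>F. f b \<noteq> c"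
proof -
  have "open {x. f x \<noteq> x}" if "f \<in> \<Gamma>" for f
    using continuous_\<Gamma>[OF that] by (intro open_Collect_neq continuous_on_id)
  moreover have "UNIV \<subseteq> (\<Union>f\<in>\<Gamma>. {x. f x \<noteq> x})"
    using no_global_fixed_point by auto
  ultimately obtain F where F: "F \<subseteq> \<Gamma>" "finite F" "UNIV \<subseteq> (\<Union>f\<in>F. {x. f x \<noteq> x})"
    using compactE_image[OF compact_UNIV, of \<Gamma> "\<lambda>f. {x. f x \<noteq> x}"] by auto
  show thesis
  proof (rule that[of "insert id F"])
    fix b c
    show "\<exists>f\<in>insert id F. f b \<noteq> c"
      using F(3) by (cases "b = c") auto
  qed (use F in auto)
qed

section \<open>Test points and connecting elements\<close>

lemma infinite_\<Gamma>: "infinite \<Gamma>"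
proof -
  obtain x where "x \<in> limit_set \<Gamma>"
    using avoid2 by metis
  then obtain g b where "inj g" "conv g x b"
    by (rule limit_set_conv)
  then show ?thesis
    by (metis conv_def finite_subset range_inj_infinite)
qed

lemma infinite_M: "infinite (UNIV :: 'm set)"
proof
  assume "finite (UNIV :: 'm set)"
  then have "finite ((UNIV :: 'm set) \<rightarrow>\<^sub>E (UNIV :: 'm set))"
    by (intro finite_PiE) auto
  then show False
    using infinite_\<Gamma> by (metis PiE_UNIV_domain Pi_UNIV finite_subset subset_UNIV)
qed

text \<open>Four points are taken so that one survives the three exclusions made in
  \<open>concatenation\<close>, each of which removes at most one.\<close>

lemma separated_points:
  obtains X :: "'m set" and e where "finite X" "card X = 4" "e > 0"
    "\<And>t. t \<in> T \<Longrightarrow> card {x\<in>X. d (Inr x) t \<le> e} \<le> 1"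
proof -
  obtain X :: "'m set" where X: "finite X" "card X = 4"
    using infinite_arbitrarily_large[OF infinite_M, of 4] by blast
  define D where "D = (\<lambda>(x, x'). d (Inr x) (Inr x')) ` {(x, x'). x \<in> X \<and> x' \<in> X \<and> x \<noteq> x'}"
  have "finite {(x, x'). x \<in> X \<and> x' \<in> X \<and> x \<noteq> x'}"
    by (rule finite_subset[of _ "X \<times> X"]) (use X in auto)
  then have fin: "finite (insert 1 D)"
    by (simp add: D_def)
  define e where "e = Min (insert 1 D) / 3"
  have "Min (insert 1 D) > 0"
    using fin by (subst Min_gr_iff) (auto simp: D_def T.mdist_pos_eq)
  then have e: "e > 0"
    by (simp add: e_def)
  have sep: "2 * e < d (Inr x) (Inr x')" if "x \<in> X" "x' \<in> X" "x \<noteq> x'" for x x'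
  proof -
    have "Min (insert 1 D) \<le> d (Inr x) (Inr x')"
      using that fin by (intro Min_le) (auto simp: D_def)
    then show ?thesis
      using e by (simp add: e_def)
  qed
  show thesis
  proof (rule that[OF X e])
    fix t assume t: "t \<in> T"
    have "x = x'" if "x \<in> X" "d (Inr x) t \<le> e" "x' \<in> X" "d (Inr x') t \<le> e" for x x'
      using sep[of x x'] T.triangle[of "Inr x" t "Inr x'"] T.commute[of t "Inr x'"] t that by fastforce
    then show "card {x\<in>X. d (Inr x) t \<le> e} \<le> 1"
      using X(1) by (intro card_le_Suc0_iff_eq[THEN iffD2, folded One_nat_def]) auto
  qed
qed

lemma far_point:
  obtains e where "e > 0" "\<And>t1 t2. t1 \<in> T \<Longrightarrow> t2 \<in> T \<Longrightarrow> \<exists>x. d (Inr x) t1 > e \<and> d (Inr x) t2 > e"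
proof -
  obtain X :: "'m set" and e where X: "finite X" "card X = 4" "e > 0"
    "\<And>t. t \<in> T \<Longrightarrow> card {x\<in>X. d (Inr x) t \<le> e} \<le> 1"
    using separated_points by blast
  show thesis
  proof (rule that[OF X(3)])
    fix t1 t2 assume t: "t1 \<in> T" "t2 \<in> T"
    have "card ({x\<in>X. d (Inr x) t1 \<le> e} \<union> {x\<in>X. d (Inr x) t2 \<le> e}) \<le> 1 + 1"
      by (rule order.trans[OF card_Un_le add_mono]) (use X(4) t in auto)
    then have "\<not> X \<subseteq> {x\<in>X. d (Inr x) t1 \<le> e} \<union> {x\<in>X. d (Inr x) t2 \<le> e}"
      using card_mono[of "{x\<in>X. d (Inr x) t1 \<le> e} \<union> {x\<in>X. d (Inr x) t2 \<le> e}" X] X(1,2) by auto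
    then show "\<exists>x. d (Inr x) t1 > e \<and> d (Inr x) t2 > e"
      by (auto simp: not_le)
  qed
qed

text \<open>For a suitable connecting element \<open>f\<close>, the point \<open>f (\<beta> x)\<close> stays away from \<open>\<alpha>\<^sup>-\<^sup>1\<close> for all
  but one \<open>x\<close>: otherwise, along a sequence \<open>\<beta>\<^sub>n\<close> with attracting point \<open>c\<close>, the points
  \<open>\<alpha>\<^sub>n\<^sup>-\<^sup>1\<close> tend to \<open>f c\<close> for all \<open>f \<in> F\<close>, and \<open>c\<close> is a common fixed point.\<close>

lemma connecting_elements:
  assumes F: "finite F" "F \<subseteq> \<Gamma>" "id \<in> F" "\<And>b c. \<exists>f\<in>F. f b \<noteq> c" and X: "finite X"
  obtains e where "e > 0"
    "\<And>\<alpha> \<beta>. \<alpha> \<in> \<Gamma> \<Longrightarrow> \<beta> \<in> \<Gamma> \<Longrightarrow> \<exists>f\<in>F. card {x\<in>X. d (Inr (f (\<beta> x))) (Inl (ginv \<alpha>)) \<le> e} \<le> 1"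
proof (rule ccontr)
  define bad where "bad = (\<lambda>n \<alpha> \<beta>. \<forall>f\<in>F. \<exists>x\<in>X. \<exists>x'\<in>X. x \<noteq> x' \<and>
    d (Inr (f (\<beta> x))) (Inl (ginv \<alpha>)) \<le> 1 / Suc n \<and> d (Inr (f (\<beta> x'))) (Inl (ginv \<alpha>)) \<le> 1 / Suc n)"
  assume "\<not> thesis"
  have "\<exists>\<alpha> \<beta>. \<alpha> \<in> \<Gamma> \<and> \<beta> \<in> \<Gamma> \<and> bad n \<alpha> \<beta>" for n
  proof (rule ccontr)
    assume *: "\<nexists>\<alpha> \<beta>. \<alpha> \<in> \<Gamma> \<and> \<beta> \<in> \<Gamma> \<and> bad n \<alpha> \<beta>"
    have thesis
    proof (rule that)
      show "1 / real (Suc n) > 0" by simp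
      fix \<alpha> \<beta> assume "\<alpha> \<in> \<Gamma>" "\<beta> \<in> \<Gamma>"
      with * have "\<not> bad n \<alpha> \<beta>" by blast
      then obtain f where "f \<in> F" "\<And>x x'. x \<in> X \<Longrightarrow> x' \<in> X \<Longrightarrow>
          d (Inr (f (\<beta> x))) (Inl (ginv \<alpha>)) \<le> 1 / Suc n \<Longrightarrow>
          d (Inr (f (\<beta> x'))) (Inl (ginv \<alpha>)) \<le> 1 / Suc n \<Longrightarrow> x = x'"
        unfolding bad_def by blast
      moreover from this(2) have "card {x\<in>X. d (Inr (f (\<beta> x))) (Inl (ginv \<alpha>)) \<le> 1 / Suc n} \<le> Suc 0"
        by (subst card_le_Suc0_iff_eq) (use X in auto)
      ultimately show "\<exists>f\<in>F. card {x\<in>X. d (Inr (f (\<beta> x))) (Inl (ginv \<alpha>)) \<le> 1 / Suc n} \<le> 1"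
        by auto
    qed
    with \<open>\<not> thesis\<close> show False ..
  qed
  then obtain \<alpha> \<beta> where ab: "\<And>n. \<alpha> n \<in> \<Gamma>" "\<And>n. \<beta> n \<in> \<Gamma>" "\<And>n. bad n (\<alpha> n) (\<beta> n)"
    by metis
  have bad_mono: "bad m a b" if "bad n a b" "m \<le> n" for m n a b
  proof -
    have "1 / Suc n \<le> 1 / real (Suc m)"
      using that(2) by (simp add: frac_le)
    then show ?thesis
      using that(1) unfolding bad_def by (meson order.trans)
  qed
  show False
  \<comment> \<open>If \<open>\<beta>\<close> is constantly \<open>c\<close> on a subsequence, the
    choice \<open>f = id\<close> already fails: the images of \<open>X\<close> under
    \<open>c\<close> are distinct, so two of them cannot be arbitrarily close to the same
    point.\<close>
  proof (cases "finite (range \<beta>)")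
    case True
    then obtain r c where r: "strict_mono (r :: nat \<Rightarrow> nat)" "\<And>n. \<beta> (r n) = c"
      using finite_range_constant_subseq by blast
    have c: "c \<in> \<Gamma>"
      using ab r by metis
    define D where "D = insert 1 ((\<lambda>(x, x'). d (Inr (c x)) (Inr (c x'))) ` {(x, x'). x \<in> X \<and> x' \<in> X \<and> x \<noteq> x'})"
    have "finite {(x, x'). x \<in> X \<and> x' \<in> X \<and> x \<noteq> x'}"
      by (rule finite_subset[of _ "X \<times> X"]) (use X in auto)
    then have fin: "finite D"
      by (simp add: D_def)
    have pos: "Min D > 0"
      using fin c by (subst Min_gr_iff) (auto simp: D_def T.mdist_pos_eq)
    obtain n where n: "1 / real (Suc n) < Min D / 2"
      using nat_approx_posE[of "Min D / 2"] pos by auto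
    have "bad n (\<alpha> (r n)) c"
      using bad_mono[OF ab(3), of n "r n"] seq_suble[OF r(1)] r(2) by metis
    then obtain x x' where x: "x \<in> X" "x' \<in> X" "x \<noteq> x'"
      "d (Inr (c x)) (Inl (ginv (\<alpha> (r n)))) \<le> 1 / Suc n"
      "d (Inr (c x')) (Inl (ginv (\<alpha> (r n)))) \<le> 1 / Suc n"
      using F(3) unfolding bad_def by fastforce
    have "d (Inr (c x)) (Inr (c x')) < Min D"
      using T.triangle[of "Inr (c x)" "Inl (ginv (\<alpha> (r n)))" "Inr (c x')"] ab(1) x(4,5) n
        T.commute[of "Inr (c x')"] by simp
    moreover have "Min D \<le> d (Inr (c x)) (Inr (c x'))"
      using x fin by (intro Min_le) (auto simp: D_def)
    ultimately show False by simp
  next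
    case False
    then obtain q where q: "strict_mono (q :: nat \<Rightarrow> nat)" "inj (\<lambda>n. \<beta> (q n))"
      by (rule infinite_range_inj_subseq)
    then obtain q' c b where q': "strict_mono (q' :: nat \<Rightarrow> nat)" "conv (\<lambda>n. \<beta> (q (q' n))) c b"
      using conv_extract[of "\<lambda>n. \<beta> (q n)"] ab(2) by blast
    define r where "r = (\<lambda>n. q (q' n))"
    have r: "strict_mono r" "conv (\<lambda>n. \<beta> (r n)) c b"
      using q q' by (simp_all add: r_def strict_mono_def)
    have bad: "bad n (\<alpha> (r n)) (\<beta> (r n))" for n
      using bad_mono[OF ab(3) seq_suble[OF r(1)]] .
    have lim: "tends (\<lambda>n. Inl (ginv (\<alpha> (r n)))) (Inr (f c))" if f: "f \<in> F" for f
    proof (rule tends_I)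
      fix e :: real assume "e > 0"
      have "tends (\<lambda>n. Inr (f (\<beta> (r n) x))) (Inr (f c))" if "x \<noteq> b" for x
        using tends_act[OF subsetD[OF F(2) f] _ _ conv_tends_Inr[OF r(2) that]] by simp
      then have "\<forall>\<^sub>F n in sequentially. \<forall>x\<in>X - {b}. d (Inr (f (\<beta> (r n) x))) (Inr (f c)) < e / 2"
        using X \<open>e > 0\<close> by (intro eventually_ball_finite ballI tends_D) auto
      moreover have "\<forall>\<^sub>F n in sequentially. 1 / real (Suc n) < e / 2"
        using order_tendstoD(2)[OF LIMSEQ_inverse_real_of_nat, of "e / 2"] \<open>e > 0\<close>
        by (simp add: inverse_eq_divide del: of_nat_Suc)
      ultimately show "\<forall>\<^sub>F n in sequentially. d (Inl (ginv (\<alpha> (r n)))) (Inr (f c)) < e"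
      proof eventually_elim
        case (elim n)
        \<comment> \<open>Of two distinct bad points at most one is the repelling point
          \<open>b\<close>.\<close>
        obtain x where x: "x \<in> X" "x \<noteq> b" "d (Inr (f (\<beta> (r n) x))) (Inl (ginv (\<alpha> (r n)))) \<le> 1 / Suc n"
          using bad[of n] f unfolding bad_def by metis
        have "d (Inl (ginv (\<alpha> (r n)))) (Inr (f c)) \<le>
            d (Inl (ginv (\<alpha> (r n)))) (Inr (f (\<beta> (r n) x))) + d (Inr (f (\<beta> (r n) x))) (Inr (f c))"
          using ab(1) by (intro T.triangle) auto
        moreover have "d (Inr (f (\<beta> (r n) x))) (Inr (f c)) < e / 2"
          using elim(1) x by blast
        ultimately show ?case
          using elim(2) x(3) unfolding T.commute[of "Inl (ginv (\<alpha> (r n)))"] by linarith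
      qed
    qed
    have "Inr (f c) = (Inr c :: ('m \<Rightarrow> 'm) + 'm)" if "f \<in> F" for f
      using lim[OF that] lim[OF F(3)] ab(1) by (intro tends_unique[of "\<lambda>n. Inl (ginv (\<alpha> (r n)))"]) auto
    then show False
      using F(4)[of c c] by auto
  qed
qed

end

section \<open>Expanding coarse-cocycles\<close>

locale expanding_cocycle = compactified_convergence_group \<Gamma> d
  for \<Gamma> :: "('m::metric_space \<Rightarrow> 'm) set" and d +
  fixes \<sigma> :: "('m \<Rightarrow> 'm) \<Rightarrow> 'm \<Rightarrow> real" and N :: "('m \<Rightarrow> 'm) \<Rightarrow> real"
  assumes expanding: "expanding_coarse_cocycle \<Gamma> d \<sigma>"
    and magnitude: "magnitude_function \<Gamma> d \<sigma> N"
begin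

lemma coarse_cocycle:
  obtains \<kappa> where "\<And>f g x. f \<in> \<Gamma> \<Longrightarrow> g \<in> \<Gamma> \<Longrightarrow> \<bar>\<sigma> (f \<circ> g) x - (\<sigma> f (g x) + \<sigma> g x)\<bar> \<le> \<kappa>"
  using expanding unfolding expanding_coarse_cocycle_def coarse_cocycle_def kappa_coarse_cocycle_def
  by blast

lemma magnitude_bound:
  assumes "e > 0"
  obtains C where "\<And>g x. g \<in> \<Gamma> \<Longrightarrow> d (Inr x) (Inl (ginv g)) > e \<Longrightarrow> \<bar>\<sigma> g x - N g\<bar> \<le> C"
proof -
  obtain C where C: "\<forall>x. \<forall>g\<in>\<Gamma>. d (Inr x) (Inl (inv\<^bsub>homeo_group\<^esub> g)) > e \<longrightarrow>
      N g - C \<le> \<sigma> g x \<and> \<sigma> g x \<le> N g + C"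
    using magnitude assms unfolding magnitude_function_def by blast
  show thesis
  proof (rule that)
    fix g x assume "g \<in> \<Gamma>" "d (Inr x) (Inl (ginv g)) > e"
    then have "N g - C \<le> \<sigma> g x \<and> \<sigma> g x \<le> N g + C"
      using C by (simp add: m_inv_eq)
    then show "\<bar>\<sigma> g x - N g\<bar> \<le> C"
      by linarith
  qed
qed

text \<open>For a single \<open>g\<close> the point \<open>Inl (ginv g)\<close> has positive
  distance from \<open>M\<close>, so the magnitude estimate holds on all of
  \<open>M\<close>.\<close>

lemma \<sigma>_bounded:
  assumes "g \<in> \<Gamma>"
  obtains C where "\<And>x. \<bar>\<sigma> g x\<bar> \<le> C"
proof -
  obtain e where e: "e > 0" "\<And>x. d (Inr x) (Inl (ginv g)) \<ge> e"
    using group_point_isolated[of "ginv g"] assms by auto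
  obtain C where C: "\<And>f x. f \<in> \<Gamma> \<Longrightarrow> d (Inr x) (Inl (ginv f)) > e / 2 \<Longrightarrow> \<bar>\<sigma> f x - N f\<bar> \<le> C"
    using magnitude_bound[OF half_gt_zero[OF e(1)]] by metis
  have *: "\<bar>\<sigma> g x - N g\<bar> \<le> C" for x
    using e(1) e(2)[of x] by (intro C[OF assms]) simp
  have "\<bar>\<sigma> g x\<bar> \<le> \<bar>N g\<bar> + C" for x
    using *[of x] by linarith
  then show thesis by (rule that)
qed

text \<open>Both magnitudes are read off at one point \<open>x\<close> far from the two inverses;
  there the cocycle values differ by the bounded term \<open>\<sigma> f (g x)\<close> and the
  cocycle defect.\<close>

lemma N_comp_left:
  assumes "f \<in> \<Gamma>"
  obtains C where "\<And>g. g \<in> \<Gamma> \<Longrightarrow> \<bar>N (f \<circ> g) - N g\<bar> \<le> C"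
proof -
  obtain \<kappa> where \<kappa>: "\<And>f g x. f \<in> \<Gamma> \<Longrightarrow> g \<in> \<Gamma> \<Longrightarrow> \<bar>\<sigma> (f \<circ> g) x - (\<sigma> f (g x) + \<sigma> g x)\<bar> \<le> \<kappa>"
    using coarse_cocycle by metis
  obtain B where B: "\<And>x. \<bar>\<sigma> f x\<bar> \<le> B"
    using \<sigma>_bounded[OF assms] by metis
  obtain e where e: "e > 0" "\<And>t1 t2. t1 \<in> T \<Longrightarrow> t2 \<in> T \<Longrightarrow> \<exists>x. d (Inr x) t1 > e \<and> d (Inr x) t2 > e"
    using far_point by metis
  obtain C where C: "\<And>g x. g \<in> \<Gamma> \<Longrightarrow> d (Inr x) (Inl (ginv g)) > e \<Longrightarrow> \<bar>\<sigma> g x - N g\<bar> \<le> C"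
    using magnitude_bound[OF e(1)] by metis
  show thesis
  proof (rule that)
    fix g assume g: "g \<in> \<Gamma>"
    obtain x where x: "d (Inr x) (Inl (ginv g)) > e" "d (Inr x) (Inl (ginv (f \<circ> g))) > e"
      using e(2)[of "Inl (ginv g)" "Inl (ginv (f \<circ> g))"] g assms by auto
    show "\<bar>N (f \<circ> g) - N g\<bar> \<le> 2 * C + B + \<kappa>"
      using C[OF g x(1)] C[OF comp_in[OF assms g] x(2)] B[of "g x"] \<kappa>[OF assms g, of x] by linarith
  qed
qed

section \<open>Consequences of properness\<close>

lemma proper:
  assumes "inj g" "\<And>n. loxodromic_with \<Gamma> (g n) (p n) (q n)" "c > 0" "\<And>n. d (Inr (q n)) (Inr (p n)) \<ge> c"
  shows "filterlim (\<lambda>n. \<sigma> (g n) (p n)) at_top sequentially"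
proof -
  have "ereal c \<le> liminf (\<lambda>n. ereal (d (Inr (q n)) (Inr (p n))))"
    using assms(4) by (intro Liminf_bounded) auto
  then have "0 < liminf (\<lambda>n. ereal (d (Inr (q n)) (Inr (p n))))"
    using assms(3) by (meson ereal_less(2) less_le_trans)
  then show ?thesis
    using expanding assms(1,2) unfolding expanding_coarse_cocycle_def proper_cocycle_def by blast
qed

text \<open>Infinitely many elements of bounded magnitude would produce distinct loxodromic elements
  with separated fixed points and with \<open>\<sigma>\<close> bounded at the attracting ones,
  against properness.\<close>

lemma finite_sublevel: "finite {g\<in>\<Gamma>. N g \<le> R}"
proof (rule ccontr)
  assume "infinite {g\<in>\<Gamma>. N g \<le> R}"
  then obtain g0 :: "nat \<Rightarrow> _" where "inj g0" "range g0 \<subseteq> {g\<in>\<Gamma>. N g \<le> R}"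
    using infinite_countable_subset by blast
  then have g0: "inj g0" "\<And>n. g0 n \<in> \<Gamma>" "\<And>n. N (g0 n) \<le> R"
    by auto
  obtain r a b where r: "strict_mono (r :: nat \<Rightarrow> nat)" "conv (\<lambda>n. g0 (r n)) a b"
    using conv_extract[OF g0(1,2)] by blast
  \<comment> \<open>Left multiplication by \<open>f\<close> separates attracting and repelling point
    and changes magnitudes by a bounded amount only.\<close>
  obtain f where f: "f \<in> \<Gamma>" "f a \<noteq> b"
    using orbit_avoid by blast
  obtain Cf where Cf: "\<And>g. g \<in> \<Gamma> \<Longrightarrow> \<bar>N (f \<circ> g) - N g\<bar> \<le> Cf"
    using N_comp_left[OF f(1)] by metis
  define g where "g = (\<lambda>n. f \<circ> g0 (r n))"
  have g: "conv g (f a) b"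
    unfolding g_def using conv_comp_left[OF f(1) r(2)] .
  have "inj (\<lambda>n. g0 (r n))"
    using inj_compose[OF g0(1) strict_mono_imp_inj_on[OF r(1)]] by (simp add: o_def)
  then have inj: "inj g"
    unfolding g_def inj_def using f by (simp add: fun_eq_iff)
  have N: "N (g n) \<le> R + Cf" for n
    using Cf[OF g0(2), of "r n"] g0(3)[of "r n"] unfolding g_def by linarith
  \<comment> \<open>With a quarter of the distance, \<open>p\<close> stays at distance
    \<open>3 * e\<close> from \<open>b\<close>, hence at least \<open>2 * e\<close> from
    \<open>q\<close> and more than \<open>e\<close> from the inverse of \<open>g n\<close>.\<close>
  define e where "e = d (Inr (f a)) (Inr b) / 4"
  have e: "e > 0" "d (Inr (f a)) (Inr b) = 4 * e"
    using f by (auto simp: e_def T.mdist_pos_eq)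
  obtain C where C: "\<And>g x. g \<in> \<Gamma> \<Longrightarrow> d (Inr x) (Inl (ginv g)) > e \<Longrightarrow> \<bar>\<sigma> g x - N g\<bar> \<le> C"
    using magnitude_bound[OF e(1)] by metis
  have "\<forall>\<^sub>F n in sequentially. \<exists>p q. loxodromic_with \<Gamma> (g n) p q \<and> d (Inr q) (Inr p) \<ge> 2 * e \<and>
      \<sigma> (g n) p \<le> R + Cf + C"
    using conv_imp_eventually_conv_funpow[OF g f(2) e(1)]
      tends_D[OF conv_tends_Inl[OF conv_ginv[OF g]] e(1)]
  proof eventually_elim
    case (elim n)
    then obtain p q where pq: "p \<noteq> q" "d (Inr p) (Inr (f a)) \<le> e" "d (Inr q) (Inr b) \<le> e"
      "g n p = p" "g n q = q" "conv (\<lambda>k. g n ^^ k) p q" by blast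
    have gn: "g n \<in> \<Gamma>"
      using conv_in[OF g] .
    have lox: "loxodromic_with \<Gamma> (g n) p q"
      using pq gn by (intro conv_funpow_loxodromic)
    have *: "3 * e \<le> d (Inr p) (Inr b)"
      using T.triangle[of "Inr (f a)" "Inr p" "Inr b"] T.commute[of "Inr (f a)" "Inr p"] pq(2) e by simp
    have "2 * e \<le> d (Inr q) (Inr p)"
      using T.triangle[of "Inr p" "Inr q" "Inr b"] T.commute[of "Inr p" "Inr q"] pq(3) * by simp
    moreover have "d (Inr p) (Inl (ginv (g n))) > e"
      using T.triangle[of "Inr p" "Inl (ginv (g n))" "Inr b"] * elim(2) gn e by simp
    then have "\<bar>\<sigma> (g n) p - N (g n)\<bar> \<le> C"
      by (rule C[OF gn])
    then have "\<sigma> (g n) p \<le> R + Cf + C"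
      using N[of n] by linarith
    ultimately show ?case
      using lox by blast
  qed
  then obtain n0 where "\<forall>n\<ge>n0. \<exists>p q. loxodromic_with \<Gamma> (g n) p q \<and> d (Inr q) (Inr p) \<ge> 2 * e \<and>
      \<sigma> (g n) p \<le> R + Cf + C"
    unfolding eventually_sequentially by blast
  then have "\<exists>p q. loxodromic_with \<Gamma> (g (n + n0)) p q \<and> d (Inr q) (Inr p) \<ge> 2 * e \<and>
      \<sigma> (g (n + n0)) p \<le> R + Cf + C" for n
    by simp
  then obtain p q where pq: "\<And>n. loxodromic_with \<Gamma> (g (n + n0)) (p n) (q n)"
    "\<And>n. d (Inr (q n)) (Inr (p n)) \<ge> 2 * e" "\<And>n. \<sigma> (g (n + n0)) (p n) \<le> R + Cf + C"
    by metis
  have "inj (\<lambda>n. g (n + n0))"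
    using inj_compose[OF inj, of "\<lambda>n. n + n0"] by (simp add: o_def)
  then have "filterlim (\<lambda>n. \<sigma> (g (n + n0)) (p n)) at_top sequentially"
    using pq(1,2) e by (intro proper[of _ p q "2 * e"]) auto
  then have "\<forall>\<^sub>F n in sequentially. R + Cf + C < \<sigma> (g (n + n0)) (p n)"
    by (simp add: filterlim_at_top_dense)
  from eventually_happens[OF this] pq(3) show False
    by (auto simp: not_less[symmetric])
qed

lemma N_bounded_below:
  obtains c where "\<And>g. g \<in> \<Gamma> \<Longrightarrow> c \<le> N g"
proof (rule that)
  fix g assume "g \<in> \<Gamma>"
  then show "Min (insert 0 (N ` {g\<in>\<Gamma>. N g \<le> 0})) \<le> N g"
    using finite_sublevel[of 0] by (cases "N g \<le> 0") (auto intro: Min_le simp: Min_le_iff)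
qed

lemma eventually_N_greater:
  assumes "inj g" "\<And>n. g n \<in> \<Gamma>"
  shows "\<forall>\<^sub>F n in sequentially. N (g n) > R"
proof -
  have "finite (g -` {h\<in>\<Gamma>. N h \<le> R})"
    using finite_sublevel assms(1) by (rule finite_vimageI)
  then have "finite {n. \<not> N (g n) > R}"
    by (rule rev_finite_subset) (use assms in auto)
  then show ?thesis
    by (simp add: cofinite_eq_sequentially[symmetric] eventually_cofinite)
qed

text \<open>The magnitudes of the \<open>g n\<close> tend to infinity, so a bounded cocycle value is
  possible only near \<open>Inl (ginv (g n))\<close>, and these points tend to
  \<open>b\<close>.\<close>

lemma bounded_cocycle_tends_repelling:
  assumes "conv g a b" "inj g" "\<And>n. \<bar>\<sigma> (g n) (y n)\<bar> \<le> B"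
  shows "tends (\<lambda>n. Inr (y n)) (Inr b)"
proof (rule tends_I)
  fix e :: real assume "e > 0"
  then have "e / 2 > 0" by simp
  then obtain C where C: "\<And>g x. g \<in> \<Gamma> \<Longrightarrow> d (Inr x) (Inl (ginv g)) > e / 2 \<Longrightarrow> \<bar>\<sigma> g x - N g\<bar> \<le> C"
    using magnitude_bound by metis
  have g: "g n \<in> \<Gamma>" for n
    using conv_in[OF assms(1)] .
  have "\<forall>\<^sub>F n in sequentially. N (g n) > B + C"
    using eventually_N_greater[OF assms(2) g] .
  moreover have "\<forall>\<^sub>F n in sequentially. d (Inl (ginv (g n))) (Inr b) < e / 2"
    using \<open>e > 0\<close> by (intro tends_D[OF conv_tends_Inl[OF conv_ginv[OF assms(1)]]]) simp
  ultimately show "\<forall>\<^sub>F n in sequentially. d (Inr (y n)) (Inr b) < e"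
  proof eventually_elim
    case (elim n)
    have "d (Inr (y n)) (Inl (ginv (g n))) \<le> e / 2"
    proof (rule ccontr)
      assume "\<not> ?thesis"
      then have "\<bar>\<sigma> (g n) (y n) - N (g n)\<bar> \<le> C"
        by (intro C[OF g]) simp
      then show False
        using assms(3)[of n] elim(1) by linarith
    qed
    then show ?case
      using T.triangle[of "Inr (y n)" "Inl (ginv (g n))" "Inr b"] elim(2) g by simp
  qed
qed

text \<open>With \<open>h = ginv g1 \<circ> g2\<close>, the two preimages of \<open>z\<close> are
  exchanged by \<open>h\<close> with bounded cocycle. For infinitely many \<open>h\<close> they
  would converge to the two limit points of \<open>h\<close>, which conflicts with their distance
  from the inverses of \<open>g1\<close> and \<open>g2\<close>.\<close>

lemma shadow_multiplicity:
  assumes "e > 0"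
  obtains E where "finite E"
    "\<And>g1 g2 z. g1 \<in> \<Gamma> \<Longrightarrow> g2 \<in> \<Gamma> \<Longrightarrow> d (Inr (ginv g1 z)) (Inl (ginv g1)) > e \<Longrightarrow>
       d (Inr (ginv g2 z)) (Inl (ginv g2)) > e \<Longrightarrow> \<bar>N g1 - N g2\<bar> \<le> R \<Longrightarrow> ginv g1 \<circ> g2 \<in> E"
proof -
  define P where "P = (\<lambda>h g1 g2 z. g1 \<in> \<Gamma> \<and> g2 \<in> \<Gamma> \<and> h = ginv g1 \<circ> g2 \<and> d (Inr (ginv g1 z)) (Inl (ginv g1)) > e \<and>
    d (Inr (ginv g2 z)) (Inl (ginv g2)) > e \<and> \<bar>N g1 - N g2\<bar> \<le> R)"
  define E where "E = {h. \<exists>g1 g2 z. P h g1 g2 z}"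
  obtain \<kappa> where \<kappa>: "\<And>f g x. f \<in> \<Gamma> \<Longrightarrow> g \<in> \<Gamma> \<Longrightarrow> \<bar>\<sigma> (f \<circ> g) x - (\<sigma> f (g x) + \<sigma> g x)\<bar> \<le> \<kappa>"
    using coarse_cocycle by metis
  obtain C where C: "\<And>g x. g \<in> \<Gamma> \<Longrightarrow> d (Inr x) (Inl (ginv g)) > e \<Longrightarrow> \<bar>\<sigma> g x - N g\<bar> \<le> C"
    using magnitude_bound[OF assms] by metis
  have "finite E"
  proof (rule ccontr)
    assume "infinite E"
    then obtain h0 :: "nat \<Rightarrow> _" where "inj h0" "range h0 \<subseteq> E"
      using infinite_countable_subset by blast
    then have h0: "inj h0" "\<And>n. h0 n \<in> E"
      by auto
    have "h0 n \<in> \<Gamma>" for n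
      using h0(2)[of n] by (auto simp: E_def P_def)
    then obtain r a b where r: "strict_mono (r :: nat \<Rightarrow> nat)" "conv (\<lambda>n. h0 (r n)) a b"
      using conv_extract[OF h0(1)] by blast
    define h where "h = (\<lambda>n. h0 (r n))"
    have h: "conv h a b" "inj h"
      using r inj_compose[OF h0(1) strict_mono_imp_inj_on[OF r(1)]] by (simp_all add: h_def o_def)
    have "\<exists>g1 g2 z. P (h n) g1 g2 z" for n
      using h0(2)[of "r n"] by (simp add: h_def E_def)
    then obtain g1 g2 z where P: "\<And>n. P (h n) (g1 n) (g2 n) (z n)"
      by metis
    have g: "g1 n \<in> \<Gamma>" "g2 n \<in> \<Gamma>" and hg: "h n = ginv (g1 n) \<circ> g2 n" and N12: "\<bar>N (g1 n) - N (g2 n)\<bar> \<le> R" for n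
      using P[of n] by (auto simp: P_def)
    define y1 where "y1 = (\<lambda>n. ginv (g1 n) (z n))"
    define y2 where "y2 = (\<lambda>n. ginv (g2 n) (z n))"
    have y: "d (Inr (y1 n)) (Inl (ginv (g1 n))) > e" "d (Inr (y2 n)) (Inl (ginv (g2 n))) > e" for n
      using P[of n] by (auto simp: P_def y1_def y2_def)
    have h_in: "h n \<in> \<Gamma>" for n
      using g hg by simp
    have hy: "h n (y2 n) = y1 n" for n
      using g by (simp add: hg y1_def y2_def)
    have g2: "g2 n = g1 n \<circ> h n" for n
      using g by (simp add: hg fun_eq_iff)
    have *: "\<bar>\<sigma> (h n) (y2 n)\<bar> \<le> 2 * C + R + \<kappa>" for n
      using C[OF g(1) y(1)[of n]] C[OF g(2) y(2)[of n]] N12[of n] \<kappa>[OF g(1) h_in, of n n "y2 n"]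
      unfolding hy g2[symmetric] by linarith
    have y2_lim: "tends (\<lambda>n. Inr (y2 n)) (Inr b)"
      using bounded_cocycle_tends_repelling[OF h *] .
    \<comment> \<open>The cocycle identity at \<open>id \<circ> id\<close> bounds
      \<open>\<sigma> id\<close>; at \<open>ginv (h n) \<circ> h n\<close> it transfers the bound to
      the inverse.\<close>
    have "\<bar>\<sigma> (ginv (h n)) (y1 n)\<bar> \<le> 2 * C + R + 3 * \<kappa>" for n
    proof -
      have "\<bar>\<sigma> id (y2 n)\<bar> \<le> \<kappa>"
        using \<kappa>[OF id_in id_in, of "y2 n"] by simp
      then show ?thesis
        using *[of n] \<kappa>[OF ginv_in[OF h_in] h_in, of n n "y2 n"] h_in unfolding hy by simp
    qed
    moreover have "inj (\<lambda>n. ginv (h n))"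
      using h(2) h_in by (simp add: inj_def)
    ultimately have y1_lim: "tends (\<lambda>n. Inr (y1 n)) (Inr a)"
      by (intro bounded_cocycle_tends_repelling[OF conv_ginv[OF h(1)]])
    have e2: "e / 2 > 0"
      using assms by simp
    have "\<forall>\<^sub>F n in sequentially. False"
      using tends_D[OF y1_lim e2] tends_D[OF y2_lim e2] convD[OF conv_ginv[OF h(1)] e2]
    proof eventually_elim
      case (elim n)
      \<comment> \<open>The inverse of \<open>g1\<close> is far from \<open>y1\<close>, hence from
        \<open>a\<close>, so the inverse of \<open>h\<close> moves it near \<open>b\<close>. Its
        image is the inverse of \<open>g2\<close>, now too close to \<open>y2\<close>.\<close>
      have "d (Inl (ginv (g1 n))) (Inr a) \<ge> e / 2"
        using T.triangle[of "Inr (y1 n)" "Inr a" "Inl (ginv (g1 n))"] T.commute[of "Inr a" "Inl (ginv (g1 n))"]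
          y(1)[of n] elim(1) g by simp
      moreover have "act (ginv (h n)) (Inl (ginv (g1 n))) = Inl (ginv (g2 n))"
        using g h_in by (simp add: g2 ginv_o)
      ultimately have "d (Inl (ginv (g2 n))) (Inr b) < e / 2"
        using elim(3) g by (metis Inl_in ginv_in)
      then show False
        using T.triangle[of "Inr (y2 n)" "Inr b" "Inl (ginv (g2 n))"] T.commute[of "Inr b" "Inl (ginv (g2 n))"]
          y(2)[of n] elim(2) g by simp
    qed
    then show False by simp
  qed
  then show thesis
    by (rule that) (auto simp: E_def P_def)
qed

text \<open>At a test point \<open>x\<close> far from all three relevant inverses the cocycle
  computes all three magnitudes at once. The separate distance conclusion places
  \<open>\<alpha> (f (\<beta> x))\<close> in the shadow of \<open>\<alpha>\<close>, as needed for
  counting products.\<close>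

lemma concatenation:
  obtains F X e C where "finite F" "F \<subseteq> \<Gamma>" "finite X" "e > 0"
    "\<And>\<alpha> \<beta>. \<alpha> \<in> \<Gamma> \<Longrightarrow> \<beta> \<in> \<Gamma> \<Longrightarrow> \<exists>f\<in>F. \<exists>x\<in>X. d (Inr (f (\<beta> x))) (Inl (ginv \<alpha>)) > e \<and>
       \<bar>N (\<alpha> \<circ> f \<circ> \<beta>) - N \<alpha> - N \<beta>\<bar> \<le> C"
proof -
  obtain F where F: "finite F" "F \<subseteq> \<Gamma>" "id \<in> F" "\<And>b c. \<exists>f\<in>F. f b \<noteq> c"
    using finite_no_common_fixed by metis
  obtain X :: "'m set" and e0 where X: "finite X" "card X = 4" "e0 > 0"
    "\<And>t. t \<in> T \<Longrightarrow> card {x\<in>X. d (Inr x) t \<le> e0} \<le> 1"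
    using separated_points by blast
  obtain e1 where e1: "e1 > 0"
    "\<And>\<alpha> \<beta>. \<alpha> \<in> \<Gamma> \<Longrightarrow> \<beta> \<in> \<Gamma> \<Longrightarrow> \<exists>f\<in>F. card {x\<in>X. d (Inr (f (\<beta> x))) (Inl (ginv \<alpha>)) \<le> e1} \<le> 1"
    using connecting_elements[OF F X(1)] by blast
  define e where "e = min e0 e1"
  have e: "e > 0" "e \<le> e0" "e \<le> e1"
    using X(3) e1(1) by (auto simp: e_def)
  obtain \<kappa> where \<kappa>: "\<And>f g x. f \<in> \<Gamma> \<Longrightarrow> g \<in> \<Gamma> \<Longrightarrow> \<bar>\<sigma> (f \<circ> g) x - (\<sigma> f (g x) + \<sigma> g x)\<bar> \<le> \<kappa>"
    using coarse_cocycle by metis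
  obtain C where C: "\<And>g x. g \<in> \<Gamma> \<Longrightarrow> d (Inr x) (Inl (ginv g)) > e \<Longrightarrow> \<bar>\<sigma> g x - N g\<bar> \<le> C"
    using magnitude_bound[OF e(1)] by metis
  have "\<exists>B. \<forall>x. \<bar>\<sigma> f x\<bar> \<le> B" if "f \<in> F" for f
    using \<sigma>_bounded[of f] F(2) that by blast
  then obtain B where B: "\<And>f x. f \<in> F \<Longrightarrow> \<bar>\<sigma> f x\<bar> \<le> B f"
    by metis
  define B' where "B' = Max (B ` F)"
  have B': "\<bar>\<sigma> f x\<bar> \<le> B'" if "f \<in> F" for f x
    unfolding B'_def using F(1) that by (intro order.trans[OF B Max_ge]) auto
  show thesis
  proof (rule that[OF F(1,2) X(1) e(1)])
    fix \<alpha> \<beta> assume ab: "\<alpha> \<in> \<Gamma>" "\<beta> \<in> \<Gamma>"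
    then obtain f where f: "f \<in> F" "card {x\<in>X. d (Inr (f (\<beta> x))) (Inl (ginv \<alpha>)) \<le> e1} \<le> 1"
      using e1(2) by blast
    have f_in: "f \<in> \<Gamma>"
      using f F by blast
    define S where "S = {x\<in>X. d (Inr (f (\<beta> x))) (Inl (ginv \<alpha>)) \<le> e1} \<union> {x\<in>X. d (Inr x) (Inl (ginv \<beta>)) \<le> e0} \<union>
      {x\<in>X. d (Inr x) (Inl (ginv (\<alpha> \<circ> f \<circ> \<beta>))) \<le> e0}"
    have "card S \<le> 1 + 1 + 1"
      unfolding S_def
      by (rule order.trans[OF card_Un_le add_mono[OF order.trans[OF card_Un_le add_mono]]])
        (use X(4) f f_in ab in auto)
    moreover have "finite S"
      using X(1) by (auto simp: S_def)
    ultimately have "\<not> X \<subseteq> S"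
      using card_mono[of S X] X(2) by auto
    then obtain x where "x \<in> X" "x \<notin> S"
      by blast
    then have x: "x \<in> X" "d (Inr (f (\<beta> x))) (Inl (ginv \<alpha>)) > e" "d (Inr x) (Inl (ginv \<beta>)) > e"
      "d (Inr x) (Inl (ginv (\<alpha> \<circ> f \<circ> \<beta>))) > e"
      using e by (auto simp: S_def)
    have "\<bar>N (\<alpha> \<circ> f \<circ> \<beta>) - N \<alpha> - N \<beta>\<bar> \<le> 3 * C + B' + 2 * \<kappa>"
      using C[OF ab(1) x(2)] C[OF ab(2) x(3)] C[OF _ x(4)] B'[OF f(1), of "\<beta> x"]
        \<kappa>[OF ab(1) comp_in[OF f_in ab(2)], of x] \<kappa>[OF f_in ab(2), of x] ab f_in
      by (simp add: o_assoc)
    with f(1) x(1,2) show "\<exists>f\<in>F. \<exists>x\<in>X. d (Inr (f (\<beta> x))) (Inl (ginv \<alpha>)) > e \<and>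
       \<bar>N (\<alpha> \<circ> f \<circ> \<beta>) - N \<alpha> - N \<beta>\<bar> \<le> 3 * C + B' + 2 * \<kappa>" by blast
  qed
qed

section \<open>Growth of the group\<close>

text \<open>The part of the series over \<open>S n\<close> is, up to a constant factor, at least
  \<open>(q * exp (- s * L)) ^ n\<close>. It is bounded by the whole sum for every \<open>n\<close>,
  so the base cannot exceed 1.\<close>

lemma exponential_growth_rate:
  assumes "s > 0" "(\<lambda>g. exp (- s * N g)) summable_on \<Gamma>" "q \<ge> 0"
    and S: "\<And>n. finite (S n)" "\<And>n. S n \<subseteq> \<Gamma>" "\<And>n g. g \<in> S n \<Longrightarrow> N g \<le> real n * L + c"
    and card: "\<And>n. q ^ n \<le> real (card (S n))"
  shows "q \<le> exp (s * L)"
proof (rule ccontr)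
  assume "\<not> ?thesis"
  then have "1 < q * exp (- s * L)"
    by (simp add: exp_minus field_simps)
  define B where "B = infsum (\<lambda>g. exp (- s * N g)) \<Gamma>"
  have "(q * exp (- s * L)) ^ n \<le> exp (s * c) * B" for n
  proof -
    have "q ^ n * exp (- s * (real n * L + c)) \<le> real (card (S n)) * exp (- s * (real n * L + c))"
      using card by (intro mult_right_mono) auto
    also have "\<dots> = (\<Sum>g\<in>S n. exp (- s * (real n * L + c)))"
      by simp
    also have "\<dots> \<le> (\<Sum>g\<in>S n. exp (- s * N g))"
      using S(3) assms(1) by (intro sum_mono) simp
    also have "\<dots> \<le> B"
      unfolding B_def using assms(2) S(1,2) by (intro finite_sum_le_infsum) auto
    finally have "exp (s * c) * (q ^ n * exp (- s * (real n * L + c))) \<le> exp (s * c) * B"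
      by simp
    also have "exp (s * c) * (q ^ n * exp (- s * (real n * L + c))) = q ^ n * exp (real n * (- s * L))"
      by (simp add: exp_add[symmetric] algebra_simps)
    finally show ?thesis
      by (simp add: exp_of_nat_mult[symmetric] power_mult_distrib)
  qed
  moreover obtain n where "exp (s * c) * B < (q * exp (- s * L)) ^ n"
    using real_arch_pow[OF \<open>1 < q * exp (- s * L)\<close>] by blast
  ultimately show False
    by (meson not_less)
qed

text \<open>Ping-pong: two elements with a common repelling neighbourhood and disjoint attracting
  neighbourhoods generate a free semigroup.\<close>

lemma free_semigroup_growth:
  obtains S L where "L > 0" "\<And>n. finite (S n)" "\<And>n. S n \<subseteq> \<Gamma>"
    "\<And>n g. g \<in> S n \<Longrightarrow> N g \<le> real n * L + N id" "\<And>n. card (S n) = 2 ^ n"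
proof -
  obtain h :: "nat \<Rightarrow> _" where "inj h" "range h \<subseteq> \<Gamma>"
    using infinite_countable_subset[OF infinite_\<Gamma>] by blast
  then obtain r a b where r: "strict_mono (r :: nat \<Rightarrow> nat)" "conv (\<lambda>n. h (r n)) a b"
    using conv_extract[of h] by blast
  obtain f1 where f1: "f1 \<in> \<Gamma>" "f1 a \<noteq> b"
    using orbit_avoid by blast
  obtain f2 where f2: "f2 \<in> \<Gamma>" "f2 a \<noteq> b" "f2 a \<noteq> f1 a"
    using orbit_avoid by blast
  define R where "R = min (min (d (Inr (f1 a)) (Inr b)) (d (Inr (f2 a)) (Inr b)))
    (min (d (Inr (f1 a)) (Inr (f2 a))) (d (Inl id) (Inr b))) / 2"
  have "d (Inr (f1 a)) (Inr b) > 0" "d (Inr (f2 a)) (Inr b) > 0" "d (Inr (f1 a)) (Inr (f2 a)) > 0"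
    "d (Inl id) (Inr b) > 0"
    using f1 f2 by (simp_all add: T.mdist_pos_eq)
  then have R: "R > 0" "2 * R \<le> d (Inr (f1 a)) (Inr b)" "2 * R \<le> d (Inr (f2 a)) (Inr b)"
    "2 * R \<le> d (Inr (f1 a)) (Inr (f2 a))" "R \<le> d (Inl id) (Inr b)"
    unfolding R_def by linarith+
  obtain n where n: "\<forall>t\<in>T. d t (Inr b) \<ge> R \<longrightarrow> d (act (f1 \<circ> h (r n)) t) (Inr (f1 a)) < R"
    "\<forall>t\<in>T. d t (Inr b) \<ge> R \<longrightarrow> d (act (f2 \<circ> h (r n)) t) (Inr (f2 a)) < R"
    using eventually_happens[OF eventually_conj[OF
        convD[OF conv_comp_left[OF f1(1) r(2)] R(1)] convD[OF conv_comp_left[OF f2(1) r(2)] R(1)]]]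
    by auto
  define u where "u = f1 \<circ> h (r n)"
  define v where "v = f2 \<circ> h (r n)"
  have uv: "u \<in> \<Gamma>" "v \<in> \<Gamma>"
    using f1 f2 conv_in[OF r(2)] by (auto simp: u_def v_def)
  have u: "d (act u t) (Inr (f1 a)) < R" and v: "d (act v t) (Inr (f2 a)) < R"
    if "t \<in> T" "d t (Inr b) \<ge> R" for t
    using n that by (auto simp: u_def v_def)
  have away: "d t (Inr b) \<ge> R" if "t \<in> T" "2 * R \<le> d (Inr y) (Inr b)" "d t (Inr y) < R" for t y
    using T.triangle[of "Inr y" t "Inr b"] T.commute[of "Inr y" t] that by simp
  obtain Cu where Cu: "\<And>g. g \<in> \<Gamma> \<Longrightarrow> \<bar>N (u \<circ> g) - N g\<bar> \<le> Cu"
    using N_comp_left[OF uv(1)] by metis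
  obtain Cv where Cv: "\<And>g. g \<in> \<Gamma> \<Longrightarrow> \<bar>N (v \<circ> g) - N g\<bar> \<le> Cv"
    using N_comp_left[OF uv(2)] by metis
  \<comment> \<open>Each letter raises the magnitude by at most \<open>L\<close>; the entry 1
    guarantees positivity.\<close>
  define L where "L = max 1 (max Cu Cv)"
  \<comment> \<open>The products of \<open>n\<close> factors from \<open>u\<close> and
    \<open>v\<close>, built by left multiplication so that the first letter decides which attracting
    ball contains the group point.\<close>
  define S where "S = (\<lambda>n. ((\<lambda>A. (\<circ>) u ` A \<union> (\<circ>) v ` A) ^^ n) {id})"
  have S_Suc: "S (Suc n) = (\<circ>) u ` S n \<union> (\<circ>) v ` S n" for n
    by (simp add: S_def)
  have S: "finite (S n) \<and> S n \<subseteq> \<Gamma> \<and> (\<forall>g\<in>S n. d (Inl g) (Inr b) \<ge> R \<and> N g \<le> real n * L + N id) \<and>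
    card (S n) = 2 ^ n" for n
  proof (induction n)
    case 0
    then show ?case using R id_in by (simp add: S_def id_def)
  next
    case (Suc n)
    then have IH: "finite (S n)" "S n \<subseteq> \<Gamma>" "card (S n) = 2 ^ n"
      and IH': "g \<in> S n \<Longrightarrow> g \<in> \<Gamma> \<and> d (Inl g) (Inr b) \<ge> R \<and> N g \<le> real n * L + N id" for g
      by blast+
    have near: "d (Inl (u \<circ> g)) (Inr (f1 a)) < R" "d (Inl (v \<circ> g)) (Inr (f2 a)) < R" if "g \<in> S n" for g
      using u[of "Inl g"] v[of "Inl g"] IH'[OF that] by simp_all
    have *: "d (Inl g) (Inr b) \<ge> R \<and> N g \<le> real (Suc n) * L + N id" if g: "g \<in> S (Suc n)" for g
    proof -
      from g consider w where "w \<in> S n" "g = u \<circ> w" | w where "w \<in> S n" "g = v \<circ> w"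
        by (auto simp: S_Suc)
      then show ?thesis
      proof cases
        case 1
        have "N g \<le> N w + L"
          using Cu[of w] IH'[OF 1(1)] unfolding 1(2) L_def by linarith
        then show ?thesis
          using away[OF _ R(2) near(1)[OF 1(1)]] IH'[OF 1(1)] uv 1(2) by (simp add: algebra_simps)
      next
        case 2
        have "N g \<le> N w + L"
          using Cv[of w] IH'[OF 2(1)] unfolding 2(2) L_def by linarith
        then show ?thesis
          using away[OF _ R(3) near(2)[OF 2(1)]] IH'[OF 2(1)] uv 2(2) by (simp add: algebra_simps)
      qed
    qed
    have "u \<circ> w \<noteq> v \<circ> w'" if "w \<in> S n" "w' \<in> S n" for w w'
    proof
      assume "u \<circ> w = v \<circ> w'"
      then show False
        using near(1)[OF that(1)] near(2)[OF that(2)] R(4) uv IH'[OF that(1)] IH'[OF that(2)]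
          T.triangle[of "Inr (f1 a)" "Inl (u \<circ> w)" "Inr (f2 a)"] T.commute[of "Inr (f1 a)" "Inl (u \<circ> w)"]
        by simp
    qed
    then have "(\<circ>) u ` S n \<inter> (\<circ>) v ` S n = {}"
      by auto
    moreover have "inj_on ((\<circ>) f) (S n)" if "f \<in> \<Gamma>" for f
      using that by (auto intro!: inj_onI simp: fun_eq_iff)
    ultimately have "card (S (Suc n)) = 2 ^ Suc n"
      using IH uv by (simp add: S_Suc card_Un_disjoint card_image)
    moreover have "finite (S (Suc n))" "S (Suc n) \<subseteq> \<Gamma>"
      using IH uv by (auto simp: S_Suc)
    ultimately show ?case
      using * by blast
  qed
  show thesis
    by (rule that[of L S]) (use S in \<open>auto simp: L_def\<close>)
qed

text \<open>The concatenations \<open>\<alpha> \<circ> f \<circ> \<beta>\<close> have bounded multiplicity: all \<open>\<alpha>\<close> occurring in the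
  same product with the same \<open>f\<close> and \<open>x\<close> have the image of \<open>x\<close> in their shadows.\<close>

lemma concatenated_set:
  obtains K :: nat and C where "K > 0"
    "\<And>A B. finite A \<Longrightarrow> A \<subseteq> \<Gamma> \<Longrightarrow> (\<And>g h. g \<in> A \<Longrightarrow> h \<in> A \<Longrightarrow> \<bar>N g - N h\<bar> \<le> 1) \<Longrightarrow> finite B \<Longrightarrow> B \<subseteq> \<Gamma> \<Longrightarrow>
      \<exists>S. finite S \<and> S \<subseteq> \<Gamma> \<and> card A * card B \<le> K * card S \<and>
        (\<forall>g\<in>S. \<exists>\<alpha>\<in>A. \<exists>\<beta>\<in>B. N g \<le> N \<alpha> + N \<beta> + C)"
proof -
  obtain F and X :: "'m set" and e C where FX: "finite F" "F \<subseteq> \<Gamma>" "finite X" "e > 0"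
    and cat: "\<And>\<alpha> \<beta>. \<alpha> \<in> \<Gamma> \<Longrightarrow> \<beta> \<in> \<Gamma> \<Longrightarrow> \<exists>f\<in>F. \<exists>x\<in>X. d (Inr (f (\<beta> x))) (Inl (ginv \<alpha>)) > e \<and>
       \<bar>N (\<alpha> \<circ> f \<circ> \<beta>) - N \<alpha> - N \<beta>\<bar> \<le> C"
    using concatenation by metis
  obtain E where E: "finite E"
    "\<And>g1 g2 z. g1 \<in> \<Gamma> \<Longrightarrow> g2 \<in> \<Gamma> \<Longrightarrow> d (Inr (ginv g1 z)) (Inl (ginv g1)) > e \<Longrightarrow>
       d (Inr (ginv g2 z)) (Inl (ginv g2)) > e \<Longrightarrow> \<bar>N g1 - N g2\<bar> \<le> 1 \<Longrightarrow> ginv g1 \<circ> g2 \<in> E"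
    using shadow_multiplicity[OF FX(4), of 1] by metis
  have "\<forall>\<alpha> \<beta>. \<exists>f x. \<alpha> \<in> \<Gamma> \<and> \<beta> \<in> \<Gamma> \<longrightarrow> f \<in> F \<and> x \<in> X \<and> d (Inr (f (\<beta> x))) (Inl (ginv \<alpha>)) > e \<and>
       \<bar>N (\<alpha> \<circ> f \<circ> \<beta>) - N \<alpha> - N \<beta>\<bar> \<le> C"
    using cat by metis
  then obtain \<phi> \<xi> where \<phi>: "\<And>\<alpha> \<beta>. \<alpha> \<in> \<Gamma> \<Longrightarrow> \<beta> \<in> \<Gamma> \<Longrightarrow> \<phi> \<alpha> \<beta> \<in> F \<and> \<xi> \<alpha> \<beta> \<in> X \<and>
      d (Inr (\<phi> \<alpha> \<beta> (\<beta> (\<xi> \<alpha> \<beta>)))) (Inl (ginv \<alpha>)) > e \<and> \<bar>N (\<alpha> \<circ> \<phi> \<alpha> \<beta> \<circ> \<beta>) - N \<alpha> - N \<beta>\<bar> \<le> C"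
    by metis
  have \<phi>_in: "\<phi> \<alpha> \<beta> \<in> \<Gamma>" if "\<alpha> \<in> \<Gamma>" "\<beta> \<in> \<Gamma>" for \<alpha> \<beta>
    using \<phi>[OF that] FX(2) by blast
  define \<Phi> where "\<Phi> = (\<lambda>(\<alpha>, \<beta>). (\<alpha> \<circ> \<phi> \<alpha> \<beta> \<circ> \<beta>, \<phi> \<alpha> \<beta>, \<xi> \<alpha> \<beta>))"
  define K where "K = Suc (card E * (card F * card X))"
  show thesis
  proof (rule that[of K C])
    show "K > 0" by (simp add: K_def)
    fix A B assume A: "finite A" "A \<subseteq> \<Gamma>" "\<And>g h. g \<in> A \<Longrightarrow> h \<in> A \<Longrightarrow> \<bar>N g - N h\<bar> \<le> 1"
      and B: "finite B" "B \<subseteq> \<Gamma>"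
    define S where "S = (\<lambda>(\<alpha>, \<beta>). \<alpha> \<circ> \<phi> \<alpha> \<beta> \<circ> \<beta>) ` (A \<times> B)"
    have fiber: "card {p\<in>A \<times> B. \<Phi> p = y} \<le> card E" if "y \<in> \<Phi> ` (A \<times> B)" for y
    proof -
      obtain \<alpha>0 \<beta>0 where p0: "\<alpha>0 \<in> A" "\<beta>0 \<in> B" "y = \<Phi> (\<alpha>0, \<beta>0)"
        using \<open>y \<in> \<Phi> ` (A \<times> B)\<close> by auto
      have p0_in: "\<alpha>0 \<in> \<Gamma>" "\<beta>0 \<in> \<Gamma>"
        using p0 A(2) B(2) by auto
      show ?thesis
      \<comment> \<open>Within a fibre the connecting element and test point agree, so
        \<open>\<alpha>\<close> determines \<open>\<beta>\<close> by cancellation, and the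
        translates of \<open>\<alpha>\<close> by the inverse of \<open>\<alpha>0\<close> lie in the
        finite set \<open>E\<close>.\<close>
      proof (rule card_inj_on_le[where f = "\<lambda>(\<alpha>, \<beta>). ginv \<alpha>0 \<circ> \<alpha>"])
        show "inj_on (\<lambda>(\<alpha>, \<beta>). ginv \<alpha>0 \<circ> \<alpha>) {p \<in> A \<times> B. \<Phi> p = y}"
        proof (rule inj_onI; clarify)
          fix \<alpha> \<beta> \<alpha>' \<beta>'
          assume *: "\<alpha> \<in> A" "\<beta> \<in> B" "\<alpha>' \<in> A" "\<beta>' \<in> B" "\<Phi> (\<alpha>', \<beta>') = \<Phi> (\<alpha>, \<beta>)"
            "ginv \<alpha>0 \<circ> \<alpha> = ginv \<alpha>0 \<circ> \<alpha>'"
          have in_\<Gamma>: "\<alpha> \<in> \<Gamma>" "\<beta> \<in> \<Gamma>" "\<alpha>' \<in> \<Gamma>" "\<beta>' \<in> \<Gamma>"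
            using * A(2) B(2) by auto
          have "\<alpha> = \<alpha>'"
            using *(6) p0_in by (auto simp: fun_eq_iff)
          moreover from *(5) have "\<alpha> (\<phi> \<alpha> \<beta> (\<beta>' x)) = \<alpha> (\<phi> \<alpha> \<beta> (\<beta> x))" for x
            unfolding \<open>\<alpha> = \<alpha>'\<close> by (auto simp: \<Phi>_def fun_eq_iff)
          ultimately show "\<alpha> = \<alpha>' \<and> \<beta> = \<beta>'"
            using in_\<Gamma> \<phi>_in by (simp add: fun_eq_iff)
        qed
        show "(\<lambda>(\<alpha>, \<beta>). ginv \<alpha>0 \<circ> \<alpha>) ` {p \<in> A \<times> B. \<Phi> p = y} \<subseteq> E"
        proof
          fix h assume "h \<in> (\<lambda>(\<alpha>, \<beta>). ginv \<alpha>0 \<circ> \<alpha>) ` {p \<in> A \<times> B. \<Phi> p = y}"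
          then obtain \<alpha> \<beta> where *: "\<alpha> \<in> A" "\<beta> \<in> B" "\<Phi> (\<alpha>, \<beta>) = y" "h = ginv \<alpha>0 \<circ> \<alpha>"
            by (auto simp del: o_apply)
          have in_\<Gamma>: "\<alpha> \<in> \<Gamma>" "\<beta> \<in> \<Gamma>"
            using * A(2) B(2) by auto
          define z where "z = \<alpha>0 (\<phi> \<alpha>0 \<beta>0 (\<beta>0 (\<xi> \<alpha>0 \<beta>0)))"
          have eq: "\<alpha> \<circ> \<phi> \<alpha> \<beta> \<circ> \<beta> = \<alpha>0 \<circ> \<phi> \<alpha>0 \<beta>0 \<circ> \<beta>0" "\<xi> \<alpha> \<beta> = \<xi> \<alpha>0 \<beta>0"
            using trans[OF *(3) p0(3)] unfolding \<Phi>_def case_prod_conv prod.inject by blast+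
          have z: "z = \<alpha> (\<phi> \<alpha> \<beta> (\<beta> (\<xi> \<alpha> \<beta>)))"
            using fun_cong[OF eq(1), of "\<xi> \<alpha>0 \<beta>0"] by (simp add: z_def eq(2))
          show "h \<in> E"
            unfolding *(4)
          proof (rule E(2)[OF p0_in(1) in_\<Gamma>(1)])
            show "e < d (Inr (ginv \<alpha>0 z)) (Inl (ginv \<alpha>0))"
              using \<phi>[OF p0_in] p0_in by (simp add: z_def)
            show "e < d (Inr (ginv \<alpha> z)) (Inl (ginv \<alpha>))"
              using \<phi>[OF in_\<Gamma>] in_\<Gamma> by (simp add: z)
            show "\<bar>N \<alpha>0 - N \<alpha>\<bar> \<le> 1"
              using A(3) p0(1) *(1) .
          qed
        qed
      qed (rule E(1))
    qed
    have "\<Phi> ` (A \<times> B) \<subseteq> S \<times> F \<times> X"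
    proof
      fix y assume "y \<in> \<Phi> ` (A \<times> B)"
      then obtain \<alpha> \<beta> where ab: "\<alpha> \<in> A" "\<beta> \<in> B" "y = \<Phi> (\<alpha>, \<beta>)"
        by auto
      then have "\<alpha> \<circ> \<phi> \<alpha> \<beta> \<circ> \<beta> \<in> S"
        unfolding S_def by (intro image_eqI[of _ _ "(\<alpha>, \<beta>)"]) auto
      then show "y \<in> S \<times> F \<times> X"
        using \<phi>[of \<alpha> \<beta>] A(2) B(2) ab by (auto simp: \<Phi>_def)
    qed
    then have "card (\<Phi> ` (A \<times> B)) \<le> card (S \<times> F \<times> X)"
      using A B FX by (intro card_mono) (auto simp: S_def)
    then have le: "card (\<Phi> ` (A \<times> B)) \<le> card S * (card F * card X)"
      by (simp add: card_cartesian_product)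
    have "card A * card B = card (A \<times> B)"
      by (simp add: card_cartesian_product)
    also have "\<dots> \<le> card E * card (\<Phi> ` (A \<times> B))"
      using A B fiber by (intro card_le_mult_card_image) auto
    also have "\<dots> \<le> card E * (card S * (card F * card X))"
      using le by simp
    also have "\<dots> \<le> K * card S"
      by (simp add: K_def algebra_simps)
    finally have "card A * card B \<le> K * card S" .
    moreover have "\<forall>g\<in>S. \<exists>\<alpha>\<in>A. \<exists>\<beta>\<in>B. N g \<le> N \<alpha> + N \<beta> + C"
    proof
      fix g assume "g \<in> S"
      then obtain \<alpha> \<beta> where ab: "\<alpha> \<in> A" "\<beta> \<in> B" "g = \<alpha> \<circ> \<phi> \<alpha> \<beta> \<circ> \<beta>"
        by (auto simp: S_def)
      then have "\<bar>N g - N \<alpha> - N \<beta>\<bar> \<le> C"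
        using \<phi>[of \<alpha> \<beta>] A(2) B(2) by auto
      then have "N g \<le> N \<alpha> + N \<beta> + C" by linarith
      with ab show "\<exists>\<alpha>\<in>A. \<exists>\<beta>\<in>B. N g \<le> N \<alpha> + N \<beta> + C" by blast
    qed
    moreover have "finite S" "S \<subseteq> \<Gamma>"
      using A B \<phi>_in subsetD[OF A(2)] subsetD[OF B(2)] by (simp_all add: S_def image_subset_iff)
    ultimately show "\<exists>S. finite S \<and> S \<subseteq> \<Gamma> \<and> card A * card B \<le> K * card S \<and>
        (\<forall>g\<in>S. \<exists>\<alpha>\<in>A. \<exists>\<beta>\<in>B. N g \<le> N \<alpha> + N \<beta> + C)" by blast
  qed
qed

section \<open>Annuli and the critical exponent\<close>

definition annulus :: "real \<Rightarrow> ('m \<Rightarrow> 'm) set" where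
  "annulus m = {g\<in>\<Gamma>. m \<le> N g \<and> N g < m + 1}"

lemma finite_annulus: "finite (annulus m)"
  by (rule finite_subset[OF _ finite_sublevel[of "m + 1"]]) (auto simp: annulus_def)

text \<open>Iterating \<open>concatenated_set\<close> with one annulus \<open>A\<close> yields at
  least \<open>(card A / K) ^ n\<close> elements whose magnitude grows linearly in \<open>n\<close>,
  to which \<open>exponential_growth_rate\<close> applies. The constants are independent of
  \<open>s\<close>, so that \<open>s\<close> may later tend to the critical exponent.\<close>

lemma card_annulus_le_of_summable:
  obtains K L where "K > 0"
    "\<And>m s. s > 0 \<Longrightarrow> (\<lambda>g. exp (- s * N g)) summable_on \<Gamma> \<Longrightarrow>
      real (card (annulus m)) \<le> K * exp (s * (m + L))"
proof -
  obtain K :: nat and C where K: "K > 0" and cat: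
    "\<And>A B. finite A \<Longrightarrow> A \<subseteq> \<Gamma> \<Longrightarrow> (\<And>g h. g \<in> A \<Longrightarrow> h \<in> A \<Longrightarrow> \<bar>N g - N h\<bar> \<le> 1) \<Longrightarrow> finite B \<Longrightarrow> B \<subseteq> \<Gamma> \<Longrightarrow>
      \<exists>S. finite S \<and> S \<subseteq> \<Gamma> \<and> card A * card B \<le> K * card S \<and>
        (\<forall>g\<in>S. \<exists>\<alpha>\<in>A. \<exists>\<beta>\<in>B. N g \<le> N \<alpha> + N \<beta> + C)"
    using concatenated_set by metis
  show thesis
  proof (rule that[of "real K" "1 + C"])
    show "real K > 0" using K by simp
    fix m s :: real assume s: "s > 0" "(\<lambda>g. exp (- s * N g)) summable_on \<Gamma>"
    define A where "A = annulus m"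
    have A: "finite A" "A \<subseteq> \<Gamma>" "\<And>g h. g \<in> A \<Longrightarrow> h \<in> A \<Longrightarrow> \<bar>N g - N h\<bar> \<le> 1"
      using finite_annulus by (auto simp: A_def annulus_def)
    define P where "P = (\<lambda>n S. finite S \<and> S \<subseteq> \<Gamma> \<and> card A ^ n \<le> K ^ n * card S \<and>
      (\<forall>g\<in>S. N g \<le> real n * (m + (1 + C)) + N id))"
    have "\<exists>S. \<forall>n. P n (S n) \<and> True"
    proof (rule dependent_nat_choice)
      show "\<exists>S. P 0 S"
        by (rule exI[of _ "{id}"]) (simp add: P_def)
      fix B n assume B: "P n B"
      then obtain S where S: "finite S" "S \<subseteq> \<Gamma>" "card A * card B \<le> K * card S"
        "\<forall>g\<in>S. \<exists>\<alpha>\<in>A. \<exists>\<beta>\<in>B. N g \<le> N \<alpha> + N \<beta> + C"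
        using cat[OF A, of B] unfolding P_def by blast
      have "card A ^ Suc n \<le> card A * (K ^ n * card B)"
        using B by (simp add: P_def)
      also have "\<dots> = K ^ n * (card A * card B)"
        by simp
      also have "\<dots> \<le> K ^ n * (K * card S)"
        using S(3) by simp
      finally have "card A ^ Suc n \<le> K ^ Suc n * card S"
        by (simp add: mult.assoc mult.left_commute)
      moreover have "N g \<le> real (Suc n) * (m + (1 + C)) + N id" if g: "g \<in> S" for g
      proof -
        obtain \<alpha> \<beta> where ab: "\<alpha> \<in> A" "\<beta> \<in> B" "N g \<le> N \<alpha> + N \<beta> + C"
          using S(4) g by blast
        then have "N \<alpha> < m + 1" "N \<beta> \<le> real n * (m + (1 + C)) + N id"
          using B by (auto simp: A_def annulus_def P_def)
        with ab(3) show ?thesis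
          by (simp add: algebra_simps)
      qed
      ultimately show "\<exists>S. P (Suc n) S \<and> True"
        using S unfolding P_def by blast
    qed
    then obtain S where S: "\<And>n. P n (S n)" by blast
    have "real (card A) / real K \<le> exp (s * (m + (1 + C)))"
    proof (rule exponential_growth_rate[OF s])
      fix n
      have "real (card A ^ n) \<le> real (K ^ n * card (S n))"
        using S[of n] unfolding P_def of_nat_le_iff by blast
      then show "(real (card A) / real K) ^ n \<le> real (card (S n))"
        using K by (simp add: power_divide divide_le_eq mult.commute)
    qed (use S in \<open>auto simp: P_def\<close>)
    then show "real (card (annulus m)) \<le> real K * exp (s * (m + (1 + C)))"
      using K by (simp add: A_def divide_le_eq mult.commute)
  qed
qed

text \<open>Magnitudes may be negative, so the comparison carries a constant factor coming from
  their lower bound.\<close>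

lemma summable_mono:
  assumes "(\<lambda>g. exp (- s * N g)) summable_on \<Gamma>" "s \<le> s'"
  shows "(\<lambda>g. exp (- s' * N g)) summable_on \<Gamma>"
proof -
  obtain c where c: "\<And>g. g \<in> \<Gamma> \<Longrightarrow> c \<le> N g"
    using N_bounded_below by metis
  show ?thesis
  proof (rule summable_on_comparison_test)
    show "(\<lambda>g. exp (- (s' - s) * c) * exp (- s * N g)) summable_on \<Gamma>"
      using assms(1) by (intro summable_on_cmult_right)
    fix g assume "g \<in> \<Gamma>"
    then have "(s' - s) * c \<le> (s' - s) * N g"
      using c assms(2) by (intro mult_left_mono) auto
    then show "exp (- s' * N g) \<le> exp (- (s' - s) * c) * exp (- s * N g)"
      by (simp add: exp_add[symmetric] algebra_simps)
  qed auto
qed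

lemma summable_of_critical_exponent_less:
  assumes "critical_exponent \<Gamma> N < ereal s"
  shows "(\<lambda>g. exp (- s * N g)) summable_on \<Gamma>"
proof -
  obtain s' where "s' < s" "(\<lambda>g. exp (- s' * N g)) summable_on \<Gamma>"
    using assms unfolding critical_exponent_def Inf_less_iff by auto
  then show ?thesis
    by (intro summable_mono[of s' s]) auto
qed

lemma critical_exponent_le:
  "s > 0 \<Longrightarrow> (\<lambda>g. exp (- s * N g)) summable_on \<Gamma> \<Longrightarrow> critical_exponent \<Gamma> N \<le> ereal s"
  unfolding critical_exponent_def by (intro Inf_lower) auto

text \<open>A free semigroup has \<open>2 ^ n\<close> elements of magnitude at most
  \<open>n * L\<close> plus a constant, so convergence at \<open>s\<close> forces
  \<open>2 \<le> exp (s * L)\<close>.\<close>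

lemma critical_exponent_pos: "critical_exponent \<Gamma> N > 0"
proof -
  obtain S and L :: real where S: "L > 0" "\<And>n. finite (S n)" "\<And>n. S n \<subseteq> \<Gamma>"
    "\<And>n g. g \<in> S n \<Longrightarrow> N g \<le> real n * L + N id" "\<And>n. card (S n) = 2 ^ n"
    using free_semigroup_growth by metis
  have "ereal (ln 2 / L) \<le> critical_exponent \<Gamma> N"
    unfolding critical_exponent_def
  proof (rule Inf_greatest, clarify)
    fix s :: real assume s: "s > 0" "(\<lambda>g. exp (- s * N g)) summable_on \<Gamma>"
    have "2 \<le> exp (s * L)"
      by (rule exponential_growth_rate[OF s _ S(2,3,4)]) (auto simp: S(5))
    then have "ln 2 \<le> s * L"
      by (simp add: ln_ge_iff[symmetric] ln_le_cancel_iff[of 2 "exp (s * L)", symmetric] del: ln_le_cancel_iff)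
    then show "ereal (ln 2 / L) \<le> ereal s"
      using S(1) by (simp add: divide_le_eq)
  qed
  moreover have "0 < ereal (ln 2 / L)"
    using S(1) by simp
  ultimately show ?thesis
    by (rule less_le_trans[rotated])
qed

text \<open>The series may diverge at \<open>\<delta>\<close> itself, so the bound is taken at
  \<open>s > \<delta>\<close>, where the constants do not depend on \<open>s\<close>, and
  \<open>s\<close> decreases to \<open>\<delta>\<close>.\<close>

lemma card_annulus_le:
  assumes "critical_exponent \<Gamma> N = ereal \<delta>"
  obtains c where "c > 0" "\<And>m. real (card (annulus m)) \<le> c * exp (\<delta> * m)"
proof -
  obtain K L :: real where K: "K > 0" and le: "\<And>m s. s > 0 \<Longrightarrow> (\<lambda>g. exp (- s * N g)) summable_on \<Gamma> \<Longrightarrow>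
      real (card (annulus m)) \<le> K * exp (s * (m + L))"
    using card_annulus_le_of_summable by metis
  have "\<delta> > 0"
    using critical_exponent_pos assms by simp
  have "real (card (annulus m)) \<le> K * exp (\<delta> * (m + L))" for m
  proof (rule tendsto_lowerbound)
    show "((\<lambda>s. K * exp (s * (m + L))) \<longlongrightarrow> K * exp (\<delta> * (m + L))) (at_right \<delta>)"
      by (intro tendsto_intros)
    show "\<forall>\<^sub>F s in at_right \<delta>. real (card (annulus m)) \<le> K * exp (s * (m + L))"
      unfolding eventually_at_right_field
      using assms \<open>\<delta> > 0\<close> by (intro exI[of _ "\<delta> + 1"]) (auto intro!: le summable_of_critical_exponent_less)
  qed simp
  moreover have "K * exp (\<delta> * (m + L)) = K * exp (\<delta> * L) * exp (\<delta> * m)" for m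
    by (simp add: distrib_left exp_add)
  ultimately have "real (card (annulus m)) \<le> K * exp (\<delta> * L) * exp (\<delta> * m)" for m
    by metis
  moreover have "K * exp (\<delta> * L) > 0"
    using K by simp
  ultimately show thesis
    using that by metis
qed

lemma level_index:
  assumes "c \<le> N g" "g \<in> \<Gamma>"
  shows "g \<in> annulus (c + real (nat \<lfloor>N g - c\<rfloor>))"
  using assms by (auto simp: annulus_def) linarith+

text \<open>The annulus bounds form a geometric sum, which is dominated by its last term because
  \<open>\<delta> > 0\<close>.\<close>

lemma card_sublevel_le:
  assumes "critical_exponent \<Gamma> N = ereal \<delta>"
  obtains C where "C > 0" "\<And>R. real (card {g\<in>\<Gamma>. N g \<le> R}) \<le> C * exp (\<delta> * R)"
proof -
  have "\<delta> > 0"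
    using critical_exponent_pos assms by simp
  obtain c where c: "c > 0" "\<And>m. real (card (annulus m)) \<le> c * exp (\<delta> * m)"
    using card_annulus_le[OF assms] by metis
  obtain b where b: "\<And>g. g \<in> \<Gamma> \<Longrightarrow> b \<le> N g"
    using N_bounded_below by metis
  define q where "q = exp \<delta>"
  have "q > 1"
    using \<open>\<delta> > 0\<close> by (simp add: q_def)
  have le: "real (card {g\<in>\<Gamma>. N g \<le> R}) \<le> c * q / (q - 1) * exp (\<delta> * R)" for R
  proof (cases "b \<le> R")
    case True
    define J where "J = nat \<lfloor>R - b\<rfloor>"
    have J: "b + real J \<le> R"
      using True unfolding J_def by linarith
    have "{g\<in>\<Gamma>. N g \<le> R} \<subseteq> (\<Union>j\<le>J. annulus (b + real j))"
    proof clarify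
      fix g assume g: "g \<in> \<Gamma>" "N g \<le> R"
      then have "nat \<lfloor>N g - b\<rfloor> \<le> J"
        unfolding J_def by (intro nat_mono floor_mono) simp
      then show "g \<in> (\<Union>j\<le>J. annulus (b + real j))"
        using level_index[OF b[OF g(1)] g(1)] by blast
    qed
    then have "card {g\<in>\<Gamma>. N g \<le> R} \<le> card (\<Union>j\<le>J. annulus (b + real j))"
      using finite_annulus by (intro card_mono) auto
    also have "\<dots> \<le> (\<Sum>j\<le>J. card (annulus (b + real j)))"
      by (intro card_UN_le) simp
    finally have "real (card {g\<in>\<Gamma>. N g \<le> R}) \<le> (\<Sum>j\<le>J. real (card (annulus (b + real j))))"
      unfolding of_nat_sum[symmetric] of_nat_le_iff .
    also have "\<dots> \<le> (\<Sum>j\<le>J. c * exp (\<delta> * (b + real j)))"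
      using c by (intro sum_mono)
    also have "\<dots> = c * exp (\<delta> * b) * (\<Sum>j\<le>J. q ^ j)"
      unfolding sum_distrib_left
      by (intro sum.cong) (auto simp: q_def exp_of_nat_mult[symmetric] exp_add[symmetric] algebra_simps)
    also have "(\<Sum>j\<le>J. q ^ j) = (q ^ Suc J - 1) / (q - 1)"
      using \<open>q > 1\<close> geometric_sum[of q "Suc J"] by (simp add: lessThan_Suc_atMost)
    also have "c * exp (\<delta> * b) * ((q ^ Suc J - 1) / (q - 1)) \<le> c * exp (\<delta> * b) * (q ^ Suc J / (q - 1))"
      using c(1) \<open>q > 1\<close> by (intro mult_left_mono divide_right_mono) auto
    also have "\<dots> = c * q / (q - 1) * exp (\<delta> * (b + real J))"
      by (simp add: q_def exp_of_nat_mult[symmetric] exp_add[symmetric] algebra_simps)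
    also have "\<dots> \<le> c * q / (q - 1) * exp (\<delta> * R)"
      using J c(1) \<open>q > 1\<close> \<open>\<delta> > 0\<close> by (intro mult_left_mono) auto
    finally show ?thesis .
  next
    case False
    then have empty: "{g\<in>\<Gamma>. N g \<le> R} = {}"
      using b by fastforce
    show ?thesis
      unfolding empty using c(1) \<open>q > 1\<close> by simp
  qed
  show thesis
    by (rule that[OF _ le]) (use c(1) \<open>q > 1\<close> in simp)
qed

text \<open>Grouped by annuli, the series is dominated by a geometric one of ratio
  \<open>exp (b - s)\<close>.\<close>

lemma summable_of_card_annulus_le:
  assumes "\<And>m. real (card (annulus m)) \<le> c * exp (b * m)" "b < s" "0 < s"
  shows "(\<lambda>g. exp (- s * N g)) summable_on \<Gamma>"
proof -
  obtain a where a: "\<And>g. g \<in> \<Gamma> \<Longrightarrow> a \<le> N g"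
    using N_bounded_below by metis
  define q where "q = exp (b - s)"
  have q: "0 < q" "q < 1"
    using assms(2) by (simp_all add: q_def)
  have "0 \<le> c"
    using order.trans[OF of_nat_0_le_iff assms(1)[of 0]] by simp
  define idx where "idx = (\<lambda>g. nat \<lfloor>N g - a\<rfloor>)"
  have bound: "(\<Sum>g\<in>G. exp (- s * N g)) \<le> c * exp ((b - s) * a) * (1 / (1 - q))" if G: "G \<subseteq> \<Gamma>" "finite G" for G
  proof -
    have "(\<Sum>g\<in>G. exp (- s * N g)) = (\<Sum>j\<in>idx ` G. \<Sum>g\<in>{g\<in>G. idx g = j}. exp (- s * N g))"
      using G by (intro sum.group[symmetric]) auto
    also have "\<dots> \<le> (\<Sum>j\<in>idx ` G. c * exp ((b - s) * a) * q ^ j)"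
    proof (rule sum_mono)
      fix j
      have sub: "{g\<in>G. idx g = j} \<subseteq> annulus (a + real j)"
        using G level_index a by (auto simp: idx_def)
      have "(\<Sum>g\<in>{g\<in>G. idx g = j}. exp (- s * N g)) \<le> (\<Sum>g\<in>{g\<in>G. idx g = j}. exp (- s * (a + real j)))"
        using sub assms(3) by (intro sum_mono) (auto simp: annulus_def)
      also have "\<dots> = real (card {g\<in>G. idx g = j}) * exp (- s * (a + real j))"
        by simp
      also have "\<dots> \<le> c * exp (b * (a + real j)) * exp (- s * (a + real j))"
        using card_mono[OF finite_annulus sub] assms(1)[of "a + real j"] by (intro mult_right_mono) auto
      also have "\<dots> = c * exp ((b - s) * a) * q ^ j"
        by (simp add: q_def exp_of_nat_mult[symmetric] exp_add[symmetric] algebra_simps)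
      finally show "(\<Sum>g\<in>{g\<in>G. idx g = j}. exp (- s * N g)) \<le> c * exp ((b - s) * a) * q ^ j" .
    qed
    also have "\<dots> = c * exp ((b - s) * a) * (\<Sum>j\<in>idx ` G. q ^ j)"
      by (simp add: sum_distrib_left)
    also have "\<dots> \<le> c * exp ((b - s) * a) * (\<Sum>j. q ^ j)"
      using q G \<open>0 \<le> c\<close> by (intro mult_left_mono sum_le_suminf summable_geometric) auto
    finally show ?thesis
      using q by (simp add: suminf_geometric)
  qed
  show ?thesis
    by (rule nonneg_bdd_above_summable_on) (use bound in \<open>auto intro!: bdd_aboveI2\<close>)
qed

section \<open>Shadows and conical limit points\<close>

text \<open>The preimage form makes membership and openness immediate;
  \<open>shadow_eq_image\<close> gives the usual description as an image.\<close>

definition shadow :: "real \<Rightarrow> ('m \<Rightarrow> 'm) \<Rightarrow> 'm set" where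
  "shadow e g = {x. d (Inr (ginv g x)) (Inl (ginv g)) > e}"

lemma shadow_eq_image: "g \<in> \<Gamma> \<Longrightarrow> shadow e g = g ` {z. d (Inr z) (Inl (ginv g)) > e}"
  unfolding shadow_def by (auto simp: image_iff) (metis ginv_app(2))

lemma open_shadow: "g \<in> \<Gamma> \<Longrightarrow> open (shadow e g)"
  using open_vimage[OF open_dist_gt[of "Inl (ginv g)" e] continuous_\<Gamma>[of "ginv g"]]
  by (simp add: shadow_def vimage_def)

text \<open>Conicality gives only pointwise limits and allows repetitions, which injectivity
  excludes. The repelling point of an extracted subsequence must be \<open>y\<close>, because
  \<open>y\<close> alone fails to tend to \<open>b\<close>.\<close>

lemma conical_sequence:
  assumes "y \<in> conical_limit_set \<Gamma>"
  obtains h a b where "conv h b y" "inj h" "a \<noteq> b" "(\<lambda>n. h n y) \<longlonglongrightarrow> a"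
proof -
  obtain a b and \<gamma> :: "nat \<Rightarrow> _" where \<gamma>: "a \<noteq> b" "range \<gamma> \<subseteq> \<Gamma>" "(\<lambda>n. \<gamma> n y) \<longlonglongrightarrow> a"
    "\<And>z. z \<noteq> y \<Longrightarrow> (\<lambda>n. \<gamma> n z) \<longlonglongrightarrow> b"
    using assms unfolding conical_limit_set_def by blast
  have "infinite (range \<gamma>)"
  proof
    assume "finite (range \<gamma>)"
    then obtain r c where r: "strict_mono (r :: nat \<Rightarrow> nat)" "\<And>n. \<gamma> (r n) = c"
      using finite_range_constant_subseq by blast
    have "c \<in> \<Gamma>"
      using r(2)[of 0] \<gamma>(2) by auto
    have "c z = b" if "z \<noteq> y" for z
      using LIMSEQ_subseq_LIMSEQ[OF \<gamma>(4)[OF that] r(1)] by (simp add: o_def r(2) LIMSEQ_const_iff)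
    moreover obtain u where u: "u \<noteq> y" by (metis avoid2)
    moreover obtain v where "v \<noteq> y" "v \<noteq> u" by (metis avoid2)
    ultimately show False
      using \<open>c \<in> \<Gamma>\<close> by (metis eq_iff_\<Gamma>)
  qed
  then obtain r where r: "strict_mono (r :: nat \<Rightarrow> nat)" "inj (\<lambda>n. \<gamma> (r n))"
    by (rule infinite_range_inj_subseq)
  moreover have "\<gamma> (r n) \<in> \<Gamma>" for n
    using \<gamma>(2) by auto
  ultimately obtain q a' b' where q: "strict_mono (q :: nat \<Rightarrow> nat)" "conv (\<lambda>n. \<gamma> (r (q n))) a' b'"
    using conv_extract[of "\<lambda>n. \<gamma> (r n)"] by blast
  define h where "h = (\<lambda>n. \<gamma> (r (q n)))"
  have sub: "(\<lambda>n. h n z) \<longlonglongrightarrow> l" if "(\<lambda>n. \<gamma> n z) \<longlonglongrightarrow> l" for z l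
    using LIMSEQ_subseq_LIMSEQ[OF that strict_mono_o[OF r(1) q(1)]] by (simp add: o_def h_def)
  have lim: "(\<lambda>n. h n z) \<longlonglongrightarrow> a'" if "z \<noteq> b'" for z
    using conv_tends_Inr[OF q(2) that] by (simp add: tends_Inr_iff h_def)
  obtain z where z: "z \<noteq> y" "z \<noteq> b'" by (metis avoid2)
  have "a' = b"
    using LIMSEQ_unique[OF lim[OF z(2)] sub[OF \<gamma>(4)[OF z(1)]]] .
  moreover have "y = b'"
  proof (rule ccontr)
    assume "y \<noteq> b'"
    from LIMSEQ_unique[OF lim[OF this] sub[OF \<gamma>(3)]] \<open>a' = b\<close> \<gamma>(1) show False by simp
  qed
  moreover have "inj h"
    using inj_compose[OF r(2) strict_mono_imp_inj_on[OF q(1)]] by (simp add: o_def h_def)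
  ultimately show thesis
    using that[of h b a] q(2) sub[OF \<gamma>(3)] \<gamma>(1) by (simp add: h_def)
qed

text \<open>For \<open>h\<close> contracting to \<open>b\<close>, the distance from
  \<open>h n y\<close> to the group point \<open>h n\<close> tends to the distance of the limit of
  \<open>h n y\<close> from \<open>b\<close>. Thus conicality of \<open>y\<close> amounts to
  \<open>y\<close> lying in shadows, of one parameter, of infinitely many inverses; large magnitude
  expresses infinitely many.\<close>

lemma conical_limit_set_eq:
  "conical_limit_set \<Gamma> = (\<Union>k. \<Inter>R::nat. \<Union>g\<in>{g\<in>\<Gamma>. N g > real R}. shadow (1 / real (Suc k)) g)"
proof (intro Set.set_eqI iffI)
  fix y assume "y \<in> conical_limit_set \<Gamma>"
  then obtain h a b where h: "conv h b y" "inj h" "a \<noteq> b" "(\<lambda>n. h n y) \<longlonglongrightarrow> a"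
    by (rule conical_sequence)
  have h_in: "h n \<in> \<Gamma>" for n
    using conv_in[OF h(1)] .
  have "d (Inr a) (Inr b) > 0"
    using h(3) by (simp add: dist_Inr_pos)
  then obtain k where k: "1 / real (Suc k) < d (Inr a) (Inr b)"
    using nat_approx_posE by blast
  have "(\<lambda>n. d (Inr (h n y)) (Inl (h n))) \<longlonglongrightarrow> d (Inr a) (Inr b)"
    using h h_in by (intro tends_dist conv_tends_Inl) (auto simp: tends_Inr_iff)
  then have ev: "\<forall>\<^sub>F n in sequentially. d (Inr (h n y)) (Inl (h n)) > 1 / real (Suc k)"
    using k by (rule order_tendstoD)
  have inj: "inj (\<lambda>n. ginv (h n))"
    using h(2) h_in by (simp add: inj_def)
  have "\<exists>g\<in>{g\<in>\<Gamma>. N g > real R}. y \<in> shadow (1 / real (Suc k)) g" for R :: nat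
  proof -
    have "\<forall>\<^sub>F n in sequentially. N (ginv (h n)) > real R"
      using h_in by (intro eventually_N_greater inj) auto
    from eventually_happens[OF eventually_conj[OF ev this]]
    obtain n where "d (Inr (h n y)) (Inl (h n)) > 1 / real (Suc k)" "N (ginv (h n)) > real R"
      by auto
    then show ?thesis
      using h_in by (intro bexI[of _ "ginv (h n)"]) (auto simp: shadow_def)
  qed
  then show "y \<in> (\<Union>k. \<Inter>R::nat. \<Union>g\<in>{g\<in>\<Gamma>. N g > real R}. shadow (1 / real (Suc k)) g)"
    by blast
next
  fix y assume "y \<in> (\<Union>k. \<Inter>R::nat. \<Union>g\<in>{g\<in>\<Gamma>. N g > real R}. shadow (1 / real (Suc k)) g)"
  then obtain k where k: "y \<in> (\<Inter>R::nat. \<Union>g\<in>{g\<in>\<Gamma>. N g > real R}. shadow (1 / real (Suc k)) g)"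
    by (rule UN_E)
  have "\<exists>g. g \<in> \<Gamma> \<and> N g > real R \<and> d (Inr (ginv g y)) (Inl (ginv g)) > 1 / real (Suc k)" for R :: nat
    using INT_D[OF k, of R] by (auto simp: shadow_def)
  then obtain g where g: "\<And>R. g R \<in> \<Gamma>" "\<And>R. N (g R) > real R"
    "\<And>R. d (Inr (ginv (g R) y)) (Inl (ginv (g R))) > 1 / real (Suc k)"
    by metis
  have "infinite (range g)"
  proof
    assume fin: "finite (range g)"
    obtain R :: nat where R: "Max (N ` range g) < real R"
      using reals_Archimedean2 by blast
    have "N (g R) \<le> Max (N ` range g)"
      using fin by (intro Max_ge) auto
    with R g(2)[of R] show False by simp
  qed
  then obtain r where r: "strict_mono (r :: nat \<Rightarrow> nat)" "inj (\<lambda>n. g (r n))"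
    by (rule infinite_range_inj_subseq)
  have "inj (\<lambda>n. ginv (g (r n)))"
    using r(2) g(1) by (simp add: inj_def)
  then obtain q b y' where q: "strict_mono (q :: nat \<Rightarrow> nat)" "conv (\<lambda>n. ginv (g (r (q n)))) b y'"
    using conv_extract[of "\<lambda>n. ginv (g (r n))"] g(1) by blast
  obtain a p where p: "strict_mono (p :: nat \<Rightarrow> nat)" "tends (\<lambda>n. Inr (ginv (g (r (q (p n)))) y)) (Inr a)"
    by (rule seq_compact_M)
  define h where "h = (\<lambda>n. ginv (g (r (q (p n)))))"
  have h: "conv h b y'"
    unfolding h_def using conv_subseq[OF q(2) p(1)] .
  have h_in: "h n \<in> \<Gamma>" for n
    using conv_in[OF h] .
  have ha: "tends (\<lambda>n. Inr (h n y)) (Inr a)"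
    using p(2) by (simp add: h_def)
  have "(\<lambda>n. d (Inr (h n y)) (Inl (h n))) \<longlonglongrightarrow> d (Inr a) (Inr b)"
    using h_in by (intro tends_dist conv_tends_Inl[OF h] ha) auto
  then have "1 / real (Suc k) \<le> d (Inr a) (Inr b)"
    by (rule LIMSEQ_le_const) (use g(3) in \<open>auto simp: h_def intro: less_imp_le\<close>)
  then have "d (Inr a) (Inr b) > 0"
    by (rule less_le_trans[rotated]) simp
  then have "a \<noteq> b"
    by (simp add: dist_Inr_pos)
  have "y' = y"
  proof (rule ccontr)
    assume "y' \<noteq> y"
    then have "(\<lambda>n. h n y) \<longlonglongrightarrow> b"
      using conv_tends_Inr[OF h, of y] by (simp add: tends_Inr_iff)
    with ha \<open>a \<noteq> b\<close> show False
      using LIMSEQ_unique by (auto simp: tends_Inr_iff)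
  qed
  have "(\<lambda>n. h n z) \<longlonglongrightarrow> b" if "z \<noteq> y" for z
    using conv_tends_Inr[OF h, of z] that \<open>y' = y\<close> by (simp add: tends_Inr_iff)
  moreover have "y \<in> limit_set \<Gamma>"
    using conv_in_limit_set[OF conv_ginv[OF h]] \<open>y' = y\<close> by simp
  moreover have "range h \<subseteq> \<Gamma>"
    using h_in by auto
  ultimately show "y \<in> conical_limit_set \<Gamma>"
    using ha \<open>a \<noteq> b\<close> unfolding conical_limit_set_def tends_Inr_iff by blast
qed

lemma countable_\<Gamma>: "countable \<Gamma>"
proof -
  have eq: "(\<Union>n::nat. {g\<in>\<Gamma>. N g \<le> real n}) = \<Gamma>"
    using real_arch_simple by blast
  have "countable (\<Union>n::nat. {g\<in>\<Gamma>. N g \<le> real n})"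
    by (intro countable_UN countableI_type countable_finite finite_sublevel)
  then show ?thesis
    unfolding eq .
qed

end

section \<open>Patterson--Sullivan measures\<close>

locale patterson_sullivan = expanding_cocycle \<Gamma> d \<sigma> N
  for \<Gamma> :: "('m::metric_space \<Rightarrow> 'm) set" and d \<sigma> N +
  fixes \<beta> :: real and \<mu> :: "'m measure"
  assumes PS: "coarse_PS_measure \<Gamma> \<sigma> \<beta> \<mu>"
begin

sublocale prob_space \<mu>
  using PS by (auto simp: coarse_PS_measure_def PS_measure_def)

lemma sets_\<mu> [measurable_cong, simp]: "sets \<mu> = sets borel"
  using PS by (auto simp: coarse_PS_measure_def PS_measure_def)

lemma space_\<mu> [simp]: "space \<mu> = UNIV"
  using sets_eq_imp_space_eq[OF sets_\<mu>] by simp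

lemma measurable_\<Gamma>: "g \<in> \<Gamma> \<Longrightarrow> g \<in> measurable \<mu> borel"
  using borel_measurable_continuous_onI[OF continuous_\<Gamma>] measurable_cong_sets[OF sets_\<mu> refl] by blast

text \<open>Pushing \<open>\<mu>\<close> forward by \<open>ginv g\<close> gives \<open>A\<close> the
  mass of its image under \<open>g\<close>, with density governed by \<open>\<sigma> g\<close>; on
  \<open>A\<close> this is \<open>N g\<close> up to \<open>B\<close>. The absolute value of
  \<open>\<beta>\<close> enters because its sign is not yet known.\<close>

lemma emeasure_image:
  obtains C where "\<And>g A B. g \<in> \<Gamma> \<Longrightarrow> A \<in> sets borel \<Longrightarrow> (\<And>z. z \<in> A \<Longrightarrow> \<bar>\<sigma> g z - N g\<bar> \<le> B) \<Longrightarrow>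
    ennreal (exp (- C - \<bar>\<beta>\<bar> * B) * exp (- \<beta> * N g)) * emeasure \<mu> A \<le> emeasure \<mu> (g ` A) \<and>
    emeasure \<mu> (g ` A) \<le> ennreal (exp (C + \<bar>\<beta>\<bar> * B) * exp (- \<beta> * N g)) * emeasure \<mu> A"
proof -
  obtain C where C: "PS_measure C \<Gamma> \<sigma> \<beta> \<mu>"
    using PS by (auto simp: coarse_PS_measure_def)
  show thesis
  proof (rule that)
    fix g A and B :: real assume g: "g \<in> \<Gamma>" and A: "A \<in> sets borel"
      and B: "\<And>z. z \<in> A \<Longrightarrow> \<bar>\<sigma> g z - N g\<bar> \<le> B"
    have A': "A \<in> sets \<mu>"
      using A by simp
    define \<nu> where "\<nu> = distr \<mu> borel (ginv g)"
    have inv_inv: "inv\<^bsub>homeo_group\<^esub> (ginv g) = g"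
      using g by (simp add: m_inv_eq)
    have ac: "absolutely_continuous \<mu> \<nu>" and bd: "AE x in \<mu>.
        ennreal (exp (- C - \<beta> * \<sigma> g x)) \<le> RN_deriv \<mu> \<nu> x \<and>
        RN_deriv \<mu> \<nu> x \<le> ennreal (exp (C - \<beta> * \<sigma> g x))"
      using bspec[OF C[unfolded PS_measure_def, THEN conjunct2, THEN conjunct2] ginv_in[OF g]]
      unfolding inv_inv \<nu>_def by blast+
    have "density \<mu> (RN_deriv \<mu> \<nu>) = \<nu>"
      using ac by (intro density_RN_deriv) (simp_all add: \<nu>_def)
    then have "emeasure \<nu> A = (\<integral>\<^sup>+x. RN_deriv \<mu> \<nu> x * indicator A x \<partial>\<mu>)"
      using A' by (metis emeasure_density borel_measurable_RN_deriv)
    moreover have "emeasure \<nu> A = emeasure \<mu> (g ` A)"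
    proof -
      have "ginv g -` A = g ` A"
        using g by (auto simp: image_iff) (metis ginv_app(2))
      then show ?thesis
        using A g by (simp add: \<nu>_def emeasure_distr measurable_\<Gamma>)
    qed
    ultimately have eq: "emeasure \<mu> (g ` A) = (\<integral>\<^sup>+x. RN_deriv \<mu> \<nu> x * indicator A x \<partial>\<mu>)"
      by simp
    have \<beta>B: "\<bar>\<beta> * \<sigma> g x - \<beta> * N g\<bar> \<le> \<bar>\<beta>\<bar> * B" if "x \<in> A" for x
      using mult_left_mono[OF B[OF that], of "\<bar>\<beta>\<bar>"] by (simp add: abs_mult[symmetric] right_diff_distrib)
    have "ennreal (exp (- C - \<bar>\<beta>\<bar> * B) * exp (- \<beta> * N g)) * emeasure \<mu> A =
        (\<integral>\<^sup>+x. ennreal (exp (- C - \<bar>\<beta>\<bar> * B) * exp (- \<beta> * N g)) * indicator A x \<partial>\<mu>)"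
      using A' by (rule nn_integral_cmult_indicator[symmetric])
    also have "\<dots> \<le> (\<integral>\<^sup>+x. RN_deriv \<mu> \<nu> x * indicator A x \<partial>\<mu>)"
    proof (rule nn_integral_mono_AE)
      show "AE x in \<mu>. ennreal (exp (- C - \<bar>\<beta>\<bar> * B) * exp (- \<beta> * N g)) * indicator A x
          \<le> RN_deriv \<mu> \<nu> x * indicator A x"
        using bd
      proof eventually_elim
        case (elim x)
        show ?case
        proof (cases "x \<in> A")
          case True
          have "exp (- C - \<bar>\<beta>\<bar> * B) * exp (- \<beta> * N g) \<le> exp (- C - \<beta> * \<sigma> g x)"
            using \<beta>B[OF True] by (simp add: exp_add[symmetric])
          then show ?thesis
            using elim True by (auto intro: order.trans[OF ennreal_leI])
        qed simp
      qed
    qed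
    finally have lower: "ennreal (exp (- C - \<bar>\<beta>\<bar> * B) * exp (- \<beta> * N g)) * emeasure \<mu> A \<le> emeasure \<mu> (g ` A)"
      unfolding eq .
    have "(\<integral>\<^sup>+x. RN_deriv \<mu> \<nu> x * indicator A x \<partial>\<mu>) \<le>
        (\<integral>\<^sup>+x. ennreal (exp (C + \<bar>\<beta>\<bar> * B) * exp (- \<beta> * N g)) * indicator A x \<partial>\<mu>)"
    proof (rule nn_integral_mono_AE)
      show "AE x in \<mu>. RN_deriv \<mu> \<nu> x * indicator A x
          \<le> ennreal (exp (C + \<bar>\<beta>\<bar> * B) * exp (- \<beta> * N g)) * indicator A x"
        using bd
      proof eventually_elim
        case (elim x)
        show ?case
        proof (cases "x \<in> A")
          case True
          have "exp (C - \<beta> * \<sigma> g x) \<le> exp (C + \<bar>\<beta>\<bar> * B) * exp (- \<beta> * N g)"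
            using \<beta>B[OF True] by (simp add: exp_add[symmetric])
          then show ?thesis
            using elim True by (auto intro: order.trans[OF _ ennreal_leI])
        qed simp
      qed
    qed
    also have "\<dots> = ennreal (exp (C + \<bar>\<beta>\<bar> * B) * exp (- \<beta> * N g)) * emeasure \<mu> A"
      using A' by (rule nn_integral_cmult_indicator)
    finally show "ennreal (exp (- C - \<bar>\<beta>\<bar> * B) * exp (- \<beta> * N g)) * emeasure \<mu> A \<le> emeasure \<mu> (g ` A) \<and>
        emeasure \<mu> (g ` A) \<le> ennreal (exp (C + \<bar>\<beta>\<bar> * B) * exp (- \<beta> * N g)) * emeasure \<mu> A"
      using lower unfolding eq by blast
  qed
qed

text \<open>This is \<open>emeasure_image\<close> for the set of points far from
  \<open>ginv g\<close>. The mass of that set stays in the lower bound;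
  \<open>measure_far_from_point\<close> controls it for a suitable \<open>e\<close>.\<close>

lemma measure_shadow:
  assumes "e > 0"
  obtains c c' where "c > 0" "c' > 0"
    "\<And>g. g \<in> \<Gamma> \<Longrightarrow> c * measure \<mu> {z. d (Inr z) (Inl (ginv g)) > e} * exp (- \<beta> * N g) \<le> measure \<mu> (shadow e g)"
    "\<And>g. g \<in> \<Gamma> \<Longrightarrow> measure \<mu> (shadow e g) \<le> c' * exp (- \<beta> * N g)"
proof -
  obtain B where B: "\<And>g x. g \<in> \<Gamma> \<Longrightarrow> d (Inr x) (Inl (ginv g)) > e \<Longrightarrow> \<bar>\<sigma> g x - N g\<bar> \<le> B"
    using magnitude_bound[OF assms] by metis
  obtain C where C: "\<And>g A B. g \<in> \<Gamma> \<Longrightarrow> A \<in> sets borel \<Longrightarrow> (\<And>z. z \<in> A \<Longrightarrow> \<bar>\<sigma> g z - N g\<bar> \<le> B) \<Longrightarrow>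
    ennreal (exp (- C - \<bar>\<beta>\<bar> * B) * exp (- \<beta> * N g)) * emeasure \<mu> A \<le> emeasure \<mu> (g ` A) \<and>
    emeasure \<mu> (g ` A) \<le> ennreal (exp (C + \<bar>\<beta>\<bar> * B) * exp (- \<beta> * N g)) * emeasure \<mu> A"
    using emeasure_image by metis
  have *: "exp (- C - \<bar>\<beta>\<bar> * B) * exp (- \<beta> * N g) * measure \<mu> {z. d (Inr z) (Inl (ginv g)) > e}
      \<le> measure \<mu> (shadow e g) \<and>
    measure \<mu> (shadow e g) \<le> exp (C + \<bar>\<beta>\<bar> * B) * exp (- \<beta> * N g) * measure \<mu> {z. d (Inr z) (Inl (ginv g)) > e}"
    if g: "g \<in> \<Gamma>" for g
  proof -
    have "{z. d (Inr z) (Inl (ginv g)) > e} \<in> sets borel"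
      using g by (intro borel_open open_dist_gt) simp
    from C[OF g this B[OF g]] show ?thesis
      unfolding shadow_eq_image[OF g, symmetric] emeasure_eq_measure
      by (simp add: ennreal_mult[symmetric] del: ennreal_mult_le_mult_iff)
  qed
  show thesis
  proof (rule that)
    fix g assume g: "g \<in> \<Gamma>"
    show "exp (- C - \<bar>\<beta>\<bar> * B) * measure \<mu> {z. d (Inr z) (Inl (ginv g)) > e} * exp (- \<beta> * N g) \<le> measure \<mu> (shadow e g)"
      using *[OF g] by (simp add: mult_ac)
    have "exp (C + \<bar>\<beta>\<bar> * B) * exp (- \<beta> * N g) * measure \<mu> {z. d (Inr z) (Inl (ginv g)) > e} \<le>
        exp (C + \<bar>\<beta>\<bar> * B) * exp (- \<beta> * N g) * 1"
      by (intro mult_left_mono prob_le_1) simp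
    then show "measure \<mu> (shadow e g) \<le> exp (C + \<bar>\<beta>\<bar> * B) * exp (- \<beta> * N g)"
      using *[OF g] by linarith
  qed simp_all
qed

text \<open>Quasi-invariance under an element moving \<open>p\<close> makes the preimage of the null
  set \<open>- {p}\<close> null as well, and the two sets cover \<open>M\<close>.\<close>

lemma not_concentrated_at_point: "- {p} \<notin> null_sets \<mu>"
proof
  assume null: "- {p} \<in> null_sets \<mu>"
  obtain f where f: "f \<in> \<Gamma>" "f p \<noteq> p"
    using no_global_fixed_point by blast
  have "absolutely_continuous \<mu> (distr \<mu> borel f)"
    using PS f(1) by (auto simp: coarse_PS_measure_def PS_measure_def)
  then have "- {p} \<in> null_sets (distr \<mu> borel f)"
    using null by (auto simp: absolutely_continuous_def)
  then have "f -` (- {p}) \<in> null_sets \<mu>"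
    using f(1) by (simp add: null_sets_distr_iff measurable_\<Gamma>)
  then have "f -` (- {p}) \<union> - {p} \<in> null_sets \<mu>"
    using null by blast
  moreover have "f -` (- {p}) \<union> - {p} = space \<mu>"
    using f by auto
  ultimately show False
    using emeasure_space_1 by (metis null_setsD1 zero_neq_one)
qed

text \<open>Otherwise centres with ever smaller far mass accumulate at some \<open>l\<close> in the
  compactification, and every set at positive distance from \<open>l\<close> is null. Then
  \<open>\<mu>\<close> is either zero or concentrated at one point of \<open>M\<close>.\<close>

lemma measure_far_from_point:
  obtains e c where "e > 0" "c > 0" "\<And>t. t \<in> T \<Longrightarrow> c \<le> measure \<mu> {z. d (Inr z) t > e}"
proof (rule ccontr)
  assume not: "\<not> thesis"
  have "\<exists>t\<in>T. measure \<mu> {z. d (Inr z) t > 1 / real (Suc n)} < 1 / real (Suc n)" for n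
  proof (rule ccontr)
    assume "\<not> ?thesis"
    then have "thesis"
      by (intro that[of "1 / real (Suc n)" "1 / real (Suc n)"]) (auto simp: not_less)
    with not show False ..
  qed
  then obtain t where t: "\<And>n. t n \<in> T" "\<And>n. measure \<mu> {z. d (Inr z) (t n) > 1 / real (Suc n)} < 1 / real (Suc n)"
    by metis
  obtain l r where l: "l \<in> T" "strict_mono (r :: nat \<Rightarrow> nat)" "tends (\<lambda>n. t (r n)) l"
    using seq_compact_T[of t] t(1) by blast
  have small: "1 / real (Suc (r n)) \<le> 1 / real (Suc n)" for n
    using seq_suble[OF l(2), of n] by (simp add: frac_le)
  have inv: "(\<lambda>n. 1 / real (Suc n)) \<longlonglongrightarrow> 0"
    using LIMSEQ_inverse_real_of_nat by (simp add: inverse_eq_divide)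
  have null: "{z. d (Inr z) l > e} \<in> null_sets \<mu>" if "e > 0" for e
  proof -
    have "measure \<mu> {z. d (Inr z) l > e} \<le> 0"
    proof (rule tendsto_lowerbound[OF inv])
      have "\<forall>\<^sub>F n in sequentially. d (t (r n)) l < e / 2"
        using that by (intro tends_D[OF l(3)]) simp
      moreover have "\<forall>\<^sub>F n in sequentially. 1 / real (Suc n) < e / 2"
        using that by (intro order_tendstoD(2)[OF inv]) simp
      ultimately show "\<forall>\<^sub>F n in sequentially. measure \<mu> {z. d (Inr z) l > e} \<le> 1 / real (Suc n)"
      proof eventually_elim
        case (elim n)
        have "d (Inr z) (t (r n)) > 1 / real (Suc (r n))" if "d (Inr z) l > e" for z
          using T.triangle[of "Inr z" "t (r n)" l] t(1)[of "r n"] l(1) elim small[of n] that by simp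
        then have "measure \<mu> {z. d (Inr z) l > e} \<le> measure \<mu> {z. d (Inr z) (t (r n)) > 1 / real (Suc (r n))}"
          using t(1)[of "r n"] by (intro finite_measure_mono) (auto intro: borel_open open_dist_gt)
        also have "\<dots> \<le> 1 / real (Suc n)"
          using t(2)[of "r n"] small[of n] by simp
        finally show ?case .
      qed
    qed simp
    then show ?thesis
      using l(1) by (intro null_setsI) (auto simp: emeasure_eq_measure measure_le_0_iff intro: borel_open open_dist_gt)
  qed
  have "{z. Inr z \<noteq> l} = (\<Union>k. {z. d (Inr z) l > 1 / real (Suc k)})"
  proof (intro Set.set_eqI iffI)
    fix z assume "z \<in> {z. Inr z \<noteq> l}"
    then have "d (Inr z) l > 0"
      using l(1) by (simp add: T.mdist_pos_eq)
    then show "z \<in> (\<Union>k. {z. d (Inr z) l > 1 / real (Suc k)})"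
      using nat_approx_posE by blast
  next
    fix z assume "z \<in> (\<Union>k. {z. d (Inr z) l > 1 / real (Suc k)})"
    then obtain k where "d (Inr z) l > 1 / real (Suc k)" by blast
    then have "d (Inr z) l > 0"
      by (rule less_trans[rotated]) simp
    then show "z \<in> {z. Inr z \<noteq> l}"
      using l(1) by (auto simp: T.mdist_pos_eq)
  qed
  then have *: "{z. Inr z \<noteq> l} \<in> null_sets \<mu>"
    using null by (simp add: null_sets_UN)
  show False
  proof (cases l)
    case (Inl g)
    then have "space \<mu> \<in> null_sets \<mu>"
      using * by simp
    then show False
      using emeasure_space_1 by (metis null_setsD1 zero_neq_one)
  next
    case (Inr p)
    then show False
      using * not_concentrated_at_point[of p] by (simp add: Compl_eq)
  qed
qed

text \<open>Shadows over one annulus have mass at least a multiple of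
  \<open>exp (- \<beta> * m)\<close> and overlap at most \<open>card E\<close> times, while the
  total mass is 1.\<close>

lemma card_annulus_le_PS:
  obtains c where "c > 0" "\<And>m. real (card (annulus m)) \<le> c * exp (\<beta> * m)"
proof -
  obtain e c0 where e: "e > 0" "c0 > 0" "\<And>t. t \<in> T \<Longrightarrow> c0 \<le> measure \<mu> {z. d (Inr z) t > e}"
    using measure_far_from_point by metis
  obtain c1 where c1: "c1 > 0"
    "\<And>g. g \<in> \<Gamma> \<Longrightarrow> c1 * measure \<mu> {z. d (Inr z) (Inl (ginv g)) > e} * exp (- \<beta> * N g) \<le> measure \<mu> (shadow e g)"
    using measure_shadow[OF e(1)] by metis
  obtain E where E: "finite E"
    "\<And>g1 g2 z. g1 \<in> \<Gamma> \<Longrightarrow> g2 \<in> \<Gamma> \<Longrightarrow> d (Inr (ginv g1 z)) (Inl (ginv g1)) > e \<Longrightarrow>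
       d (Inr (ginv g2 z)) (Inl (ginv g2)) > e \<Longrightarrow> \<bar>N g1 - N g2\<bar> \<le> 1 \<Longrightarrow> ginv g1 \<circ> g2 \<in> E"
    using shadow_multiplicity[OF e(1), of 1] by metis
  have lower: "c1 * c0 * exp (- \<bar>\<beta>\<bar>) * exp (- \<beta> * m) \<le> measure \<mu> (shadow e g)" if g: "g \<in> annulus m" for g m
  proof -
    have g': "g \<in> \<Gamma>" "m \<le> N g" "N g < m + 1"
      using g by (auto simp: annulus_def)
    have "\<bar>\<beta> * (N g - m)\<bar> \<le> \<bar>\<beta>\<bar> * 1"
      unfolding abs_mult using g' by (intro mult_left_mono) auto
    then have "exp (- \<bar>\<beta>\<bar>) * exp (- \<beta> * m) \<le> exp (- \<beta> * N g)"
      by (simp add: exp_add[symmetric] algebra_simps)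
    moreover have "c1 * c0 \<le> c1 * measure \<mu> {z. d (Inr z) (Inl (ginv g)) > e}"
      using e(3)[of "Inl (ginv g)"] c1(1) g' by simp
    ultimately have "(c1 * c0) * (exp (- \<bar>\<beta>\<bar>) * exp (- \<beta> * m)) \<le>
        c1 * measure \<mu> {z. d (Inr z) (Inl (ginv g)) > e} * exp (- \<beta> * N g)"
      using c1(1) e(2) by (intro mult_mono) auto
    with c1(2)[OF g'(1)] show ?thesis
      by (simp add: mult.assoc)
  qed
  have upper: "(\<Sum>g\<in>annulus m. measure \<mu> (shadow e g)) \<le> real (card E)" for m
  proof -
    have meas: "shadow e g \<in> sets \<mu>" if "g \<in> annulus m" for g
      using that open_shadow by (auto simp: annulus_def)
    have "(\<Sum>g\<in>annulus m. measure \<mu> (shadow e g)) = (\<Sum>g\<in>annulus m. \<integral>x. indicator (shadow e g) x \<partial>\<mu>)"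
      using meas by (intro sum.cong) auto
    also have "\<dots> = (\<integral>x. (\<Sum>g\<in>annulus m. indicator (shadow e g) x) \<partial>\<mu>)"
      using meas by (intro Bochner_Integration.integral_sum[symmetric]) (auto simp: emeasure_eq_measure)
    also have "\<dots> \<le> (\<integral>x. real (card E) \<partial>\<mu>)"
    proof (rule integral_mono)
      show "integrable \<mu> (\<lambda>x. \<Sum>g\<in>annulus m. indicator (shadow e g) x :: real)"
        using meas by (intro Bochner_Integration.integrable_sum) (auto simp: emeasure_eq_measure)
      fix x
      have "(\<Sum>g\<in>annulus m. indicator (shadow e g) x :: real) = real (card {g\<in>annulus m. x \<in> shadow e g})"
        using finite_annulus by (simp add: indicator_def sum.If_cases Int_def)
      also have "card {g\<in>annulus m. x \<in> shadow e g} \<le> card E"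
      proof (cases "{g\<in>annulus m. x \<in> shadow e g} = {}")
        case False
        then obtain g0 where g0: "g0 \<in> annulus m" "x \<in> shadow e g0"
          by blast
        show ?thesis
        proof (rule card_inj_on_le[where f = "\<lambda>g. ginv g0 \<circ> g"])
          show "inj_on (\<lambda>g. ginv g0 \<circ> g) {g\<in>annulus m. x \<in> shadow e g}"
            using g0 by (auto intro!: inj_onI simp: annulus_def fun_eq_iff)
          show "(\<lambda>g. ginv g0 \<circ> g) ` {g\<in>annulus m. x \<in> shadow e g} \<subseteq> E"
          proof (rule image_subsetI)
            fix g assume "g \<in> {g\<in>annulus m. x \<in> shadow e g}"
            with g0 show "ginv g0 \<circ> g \<in> E"
              by (intro E(2)[of g0 g x]) (auto simp: annulus_def shadow_def)
          qed
        qed (rule E(1))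
      next
        case True
        show ?thesis
          unfolding True by simp
      qed
      finally show "(\<Sum>g\<in>annulus m. indicator (shadow e g) x :: real) \<le> real (card E)"
        by simp
    qed simp
    finally show ?thesis
      using prob_space by simp
  qed
  define K where "K = c1 * c0 * exp (- \<bar>\<beta>\<bar>)"
  have "K > 0"
    using c1 e by (simp add: K_def)
  have "real (card (annulus m)) \<le> real (Suc (card E)) / K * exp (\<beta> * m)" for m
  proof -
    have "real (card (annulus m)) * (K * exp (- \<beta> * m)) = (\<Sum>g\<in>annulus m. K * exp (- \<beta> * m))"
      by simp
    also have "\<dots> \<le> (\<Sum>g\<in>annulus m. measure \<mu> (shadow e g))"
      using lower by (intro sum_mono) (simp add: K_def)
    also have "\<dots> \<le> real (Suc (card E))"
      using upper[of m] by simp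
    finally show ?thesis
      using \<open>K > 0\<close> by (simp add: field_simps exp_minus)
  qed
  moreover have "real (Suc (card E)) / K > 0"
    using \<open>K > 0\<close> by simp
  ultimately show thesis
    using that by blast
qed

text \<open>Only positive exponents enter the critical exponent, so the bound is first obtained for
  \<open>max \<beta> 0\<close>; positivity of the critical exponent then excludes
  \<open>\<beta> \<le> 0\<close>.\<close>

lemma critical_exponent_le_dimension: "critical_exponent \<Gamma> N \<le> ereal \<beta>"
proof -
  obtain c where c: "\<And>m. real (card (annulus m)) \<le> c * exp (\<beta> * m)"
    using card_annulus_le_PS by metis
  have *: "critical_exponent \<Gamma> N \<le> ereal s" if "s > max \<beta> 0" for s
    using that by (intro critical_exponent_le summable_of_card_annulus_le[OF c]) auto
  have le: "critical_exponent \<Gamma> N \<le> ereal (max \<beta> 0)"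
  proof (rule dense_ge)
    fix z assume z: "ereal (max \<beta> 0) < z"
    show "critical_exponent \<Gamma> N \<le> z"
    proof (cases z)
      case (real s)
      then have "s > max \<beta> 0"
        using z by (simp only: less_ereal.simps)
      then show ?thesis
        unfolding real by (rule *)
    qed (use z in auto)
  qed
  have "ereal (max \<beta> 0) > 0"
    using critical_exponent_pos le by (rule less_le_trans)
  then have "max \<beta> 0 > 0"
    by (simp only: zero_ereal_def less_ereal.simps)
  then have "max \<beta> 0 = \<beta>"
    by linarith
  with le show ?thesis
    by simp
qed

lemma dimension_pos: "\<beta> > 0"
  using less_le_trans[OF critical_exponent_pos critical_exponent_le_dimension] by simp

text \<open>The point lies in shadows of elements of arbitrarily large magnitude, whose masses tend
  to 0 since \<open>\<beta> > 0\<close>.\<close>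

lemma conical_point_null:
  assumes "y \<in> conical_limit_set \<Gamma>"
  shows "measure \<mu> {y} = 0"
proof -
  obtain k where k: "y \<in> (\<Inter>R::nat. \<Union>g\<in>{g\<in>\<Gamma>. N g > real R}. shadow (1 / real (Suc k)) g)"
    using assms unfolding conical_limit_set_eq by (rule UN_E)
  have "1 / real (Suc k) > 0" by simp
  then obtain c where c: "c > 0" "\<And>g. g \<in> \<Gamma> \<Longrightarrow> measure \<mu> (shadow (1 / real (Suc k)) g) \<le> c * exp (- \<beta> * N g)"
    using measure_shadow by metis
  have "measure \<mu> {y} \<le> c * exp (- \<beta>) ^ R" for R :: nat
  proof -
    obtain g where g: "g \<in> \<Gamma>" "N g > real R" "y \<in> shadow (1 / real (Suc k)) g"
      using INT_D[OF k, of R] by auto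
    have "measure \<mu> {y} \<le> measure \<mu> (shadow (1 / real (Suc k)) g)"
      using g open_shadow by (intro finite_measure_mono) auto
    also have "\<dots> \<le> c * exp (- \<beta> * N g)"
      using c g by blast
    also have "\<dots> \<le> c * exp (real R * (- \<beta>))"
      using g(2) c(1) dimension_pos by simp
    finally show ?thesis
      by (simp only: exp_of_nat_mult)
  qed
  moreover have "(\<lambda>R. c * exp (- \<beta>) ^ R) \<longlonglongrightarrow> c * 0"
    using dimension_pos by (intro tendsto_mult_left LIMSEQ_power_zero) simp
  ultimately have "measure \<mu> {y} \<le> 0"
    by (intro LIMSEQ_le_const[of "\<lambda>R. c * exp (- \<beta>) ^ R"]) auto
  then show ?thesis
    by (simp add: measure_le_0_iff)
qed

text \<open>For each shadow parameter the masses are summable, so Borel--Cantelli applies along an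
  enumeration of \<open>\<Gamma>\<close>.\<close>

lemma conical_limit_set_null:
  assumes "(\<lambda>g. exp (- \<beta> * N g)) summable_on \<Gamma>"
  shows "conical_limit_set \<Gamma> \<in> null_sets \<mu>"
  unfolding conical_limit_set_eq
proof (rule null_sets_UN)
  fix k :: nat
  define e where "e = 1 / real (Suc k)"
  have "e > 0" by (simp add: e_def)
  then obtain c where c: "c > 0" "\<And>g. g \<in> \<Gamma> \<Longrightarrow> measure \<mu> (shadow e g) \<le> c * exp (- \<beta> * N g)"
    using measure_shadow by metis
  define h where "h = from_nat_into \<Gamma>"
  have h: "bij_betw h UNIV \<Gamma>"
    unfolding h_def using countable_\<Gamma> infinite_\<Gamma> by (rule bij_betw_from_nat_into)
  have h_in: "h n \<in> \<Gamma>" for n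
    using bij_betw_apply[OF h] by simp
  have "(\<lambda>n. exp (- \<beta> * N (h n))) summable_on UNIV"
    using assms summable_on_reindex_bij_betw[OF h, of "\<lambda>g. exp (- \<beta> * N g)"] by simp
  then have "summable (\<lambda>n. c * exp (- \<beta> * N (h n)))"
    by (intro summable_mult summable_on_imp_summable)
  then have "summable (\<lambda>n. measure \<mu> (shadow e (h n)))"
    by (rule summable_comparison_test') (use c h_in in auto)
  then have null: "limsup (\<lambda>n. shadow e (h n)) \<in> null_sets \<mu>"
    using h_in open_shadow by (intro borel_cantelli_limsup1) (auto simp: emeasure_eq_measure)
  have sub: "(\<Inter>R::nat. \<Union>g\<in>{g\<in>\<Gamma>. N g > real R}. shadow e g) \<subseteq> limsup (\<lambda>n. shadow e (h n))"
  proof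
    fix x assume x: "x \<in> (\<Inter>R::nat. \<Union>g\<in>{g\<in>\<Gamma>. N g > real R}. shadow e g)"
    have "\<exists>m\<ge>n. x \<in> shadow e (h m)" for n
    proof -
      \<comment> \<open>Beyond the magnitudes of the first \<open>n\<close> elements, so that any
        \<open>g\<close> with \<open>N g > R\<close> has index at least \<open>n\<close>.\<close>
      obtain R :: nat where R: "Max (insert 0 (N ` h ` {..<n})) < real R"
        using reals_Archimedean2 by blast
      obtain g where g: "g \<in> \<Gamma>" "N g > real R" "x \<in> shadow e g"
        using INT_D[OF x, of R] by auto
      obtain m where m: "g = h m"
        using h g(1) by (metis bij_betw_imp_surj_on imageE)
      have "m \<ge> n"
      proof (rule ccontr)
        assume "\<not> m \<ge> n"
        then have "N g \<le> Max (insert 0 (N ` h ` {..<n}))"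
          unfolding m by (intro Max_ge) auto
        with R g(2) show False by linarith
      qed
      with g(3) m show ?thesis by blast
    qed
    then show "x \<in> limsup (\<lambda>n. shadow e (h n))"
      unfolding limsup_INF_SUP by auto
  qed
  have "(\<Union>g\<in>{g\<in>\<Gamma>. N g > real R}. shadow e g) \<in> sets \<mu>" for R :: nat
    using open_shadow by (auto intro!: borel_open)
  then have meas: "(\<Inter>R::nat. \<Union>g\<in>{g\<in>\<Gamma>. N g > real R}. shadow e g) \<in> sets \<mu>"
    by (intro sets.countable_INT) auto
  show "(\<Inter>R::nat. \<Union>g\<in>{g\<in>\<Gamma>. N g > real R}. shadow (1 / real (Suc k)) g) \<in> null_sets \<mu>"
    unfolding e_def[symmetric] by (rule null_sets_subset[OF null meas sub])
qed

text \<open>The critical exponent is positive and at most \<open>\<beta>\<close>, hence finite, and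
  \<open>real_of_ereal\<close> returns its true value.\<close>

lemma orbit_counting_bound:
  "\<exists>C>0. \<forall>R. real (card {g\<in>\<Gamma>. N g \<le> R}) \<le> C * exp (real_of_ereal (critical_exponent \<Gamma> N) * R)"
proof -
  have "critical_exponent \<Gamma> N = ereal (real_of_ereal (critical_exponent \<Gamma> N))"
    using critical_exponent_pos critical_exponent_le_dimension by (cases "critical_exponent \<Gamma> N") auto
  then show ?thesis
    using card_sublevel_le by metis
qed

end

theorem proposition6p3:
  fixes \<Gamma> :: "('m::metric_space \<Rightarrow> 'm) set"
    and d :: "('m \<Rightarrow> 'm) + 'm \<Rightarrow> ('m \<Rightarrow> 'm) + 'm \<Rightarrow> real"
    and \<sigma> :: "('m \<Rightarrow> 'm) \<Rightarrow> 'm \<Rightarrow> real"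
    and N :: "('m \<Rightarrow> 'm) \<Rightarrow> real"
    and \<mu> :: "'m measure"
    and \<beta> :: real
  assumes "compact (UNIV :: 'm set)"
    and "convergence_group \<Gamma>"
    and "non_elementary \<Gamma>"
    and "compatible_metric \<Gamma> d"
    and "expanding_coarse_cocycle \<Gamma> d \<sigma>"
    and "magnitude_function \<Gamma> d \<sigma> N"
    and "coarse_PS_measure \<Gamma> \<sigma> \<beta> \<mu>"
  shows "(ereal \<beta> \<ge> critical_exponent \<Gamma> N \<and> critical_exponent \<Gamma> N > 0) \<and>
    (\<forall>y\<in>conical_limit_set \<Gamma>. measure \<mu> {y} = 0) \<and>
    ((\<lambda>\<gamma>. exp (- \<beta> * N \<gamma>)) summable_on \<Gamma> \<longrightarrow> conical_limit_set \<Gamma> \<in> null_sets \<mu>) \<and>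
    (ereal \<beta> > critical_exponent \<Gamma> N \<longrightarrow> (\<lambda>\<gamma>. exp (- \<beta> * N \<gamma>)) summable_on \<Gamma>) \<and>
    (\<exists>C>0. \<forall>R>0. finite {\<gamma>\<in>\<Gamma>. N \<gamma> \<le> R} \<and>
       real (card {\<gamma>\<in>\<Gamma>. N \<gamma> \<le> R}) \<le> C * exp (real_of_ereal (critical_exponent \<Gamma> N) * R))"
proof -
  interpret patterson_sullivan \<Gamma> d \<sigma> N \<beta> \<mu>
    by unfold_locales (use assms in auto)
  show ?thesis
    using critical_exponent_le_dimension critical_exponent_pos conical_point_null conical_limit_set_null
      summable_of_critical_exponent_less[of \<beta>] orbit_counting_bound finite_sublevel
    by auto
qed

end
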